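(* Let $\mathbb{K}=\mathbb{R}$ or $\mathbb{C}$, let $d,N,k_1,\dots,k_N$ be positive integers, and let $\boldsymbol{k}=(k_1,\dots,k_N)$. Consider the negative gradient flow $\Gamma:\mathcal{FF}^{\mathbb{K}^d,\boldsymbol{k}}\times[0,\infty)\to\mathcal{FF}^{\mathbb{K}^d,\boldsymbol{k}}$ defined by $$\Gamma(\boldsymbol{A}_0,0)=\boldsymbol{A}_0,\qquad \frac{d}{dt}\Gamma(\boldsymbol{A}_0,t)=-\operatorname{grad}\operatorname{FFP}(\Gamma(\boldsymbol{A}_0,t)),$$ where $\operatorname{grad}$ is the Riemannian gradient and $\boldsymbol{A}_0\in\mathcal{FF}^{\mathbb{K}^d,\boldsymbol{k}}$ is an initial frame. If $\boldsymbol{A}_0$ has property $\mathscr{S}$, then $\boldsymbol{A}_\infty:=\lim_{t\to\infty}\Gamma(\boldsymbol{A}_0,t)\in\mathcal{FF}^{\mathbb{K}^d,\boldsymbol{k}}$ is a global minimum of $\operatorname{FFP}$ on $\mathcal{FF}^{\mathbb{K}^d,\boldsymbol{k}}$.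
   Context: $\mathcal{FF}^{\mathbb{K}^d,\boldsymbol{k}}$ denotes the space of (square roots of) fusion frames with ranks $\boldsymbol{k}$: the set of $N$-tuples $\boldsymbol{A}=(A_1,\dots,A_N)$ of linear maps $A_i:\mathbb{K}^d\to\mathbb{K}^{k_i}$ such that each $P_i:=A_i^*A_i$ is an orthogonal projector of rank $k_i$ (equivalently, the rows of $A_i$ are orthonormal) and the frame operator $S_{\boldsymbol{A}}:=\sum_{i=1}^N A_i^*A_i$ is positive definite. It is a submanifold of $\prod_{i=1}^N\mathbb{K}^{k_i\times d}$, with the Riemannian metric induced by the real part of the Frobenius inner product. The fusion frame potential $\operatorname{FFP}:\mathcal{FF}^{\mathbb{K}^d,\boldsymbol{k}}\to\mathbb{R}$ is $\operatorname{FFP}(\boldsymbol{A})=\|S_{\boldsymbol{A}}\|^2$, where $\|\cdot\|$ is the Frobenius norm. Property $\mathscr{S}$: let $n=k_1+\dots+k_N$, and for $\boldsymbol{A}\in\mathcal{FF}^{\mathbb{K}^d,\boldsymbol{k}}$ let $\mathcal{S}_i\subset\mathbb{K}^d$ be the ($k_i$-dimensional) image of $P_i$. Then $\boldsymbol{A}$ has property $\mathscr{S}$ if for all nonzero proper linear subspaces $\mathcal{Q}\subset\mathbb{K}^d$, $$\frac{1}{\dim\mathcal{Q}}\sum_{i=1}^N\dim(\mathcal{S}_i\cap\mathcal{Q})\le\frac{n}{d}.$$ *)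

theory Defs
  imports "HOL-Analysis.Analysis" "Jordan_Normal_Form.Conjugate"
begin

text \<open>
  The definitions are polymorphic in the scalar type and are meant for the types \<open>real\<close> and
  \<open>complex\<close>. The index types \<open>'d\<close> and \<open>'n\<close> stand for the index sets \<open>{1..d}\<close> and \<open>{1..N}\<close>.

  The row numbers of the matrices of a tuple depend on the position in the tuple, so all matrices
  share one row type \<open>'r\<close>, and the rows of the \<open>i\<close>-th matrix are those with an index in a set \<open>R i\<close>
  of \<open>k i\<close> elements; the other rows are zero. This identifies the product of the spaces of
  \<open>k i\<close> by \<open>d\<close> matrices with a linear subspace of the type of tuples, and the inner product of that
  type is the real part of the Frobenius inner product (the inner product of \<open>complex\<close> being
  \<open>Re (x * cnj y)\<close>). The norm on matrices is the Frobenius norm.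
\<close>

definition adj :: "'a::conjugatable_field^'m^'l \<Rightarrow> 'a^'l^'m" where
  "adj A = (\<chi> i j. conjugate (A $ j $ i))"

text \<open>For self-adjoint \<open>M\<close> the scalar \<open>x* M x\<close> is real, hence equal to the real
  inner product below.\<close>

definition positive_definite :: "'a::{conjugatable_field,euclidean_space}^'d^'d \<Rightarrow> bool" where
  "positive_definite M \<longleftrightarrow> adj M = M \<and> (\<forall>x. x \<noteq> 0 \<longrightarrow> x \<bullet> (M *v x) > 0)"

definition orthogonal_projector :: "'a::conjugatable_field^'d^'d \<Rightarrow> bool" where
  "orthogonal_projector P \<longleftrightarrow> P ** P = P \<and> adj P = P"

definition frame_proj :: "'a::conjugatable_field^'d^'r^'n \<Rightarrow> 'n \<Rightarrow> 'a^'d^'d" where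
  "frame_proj A i = adj (A $ i) ** (A $ i)"

definition frame_operator :: "'a::conjugatable_field^'d^'r^'n \<Rightarrow> 'a^'d^'d" where
  "frame_operator A = (\<Sum>i\<in>UNIV. adj (A $ i) ** (A $ i))"

definition fusion_frames ::
    "('n \<Rightarrow> nat) \<Rightarrow> ('n \<Rightarrow> 'r set) \<Rightarrow> ('a::{conjugatable_field,euclidean_space}^'d^'r^'n) set" where
  "fusion_frames k R =
     {A. (\<forall>i. \<forall>r. r \<notin> R i \<longrightarrow> A $ i $ r = 0) \<and>
         (\<forall>i. orthogonal_projector (frame_proj A i) \<and> rank (frame_proj A i) = k i) \<and>
         positive_definite (frame_operator A)}"

definition FFP :: "'a::{conjugatable_field,euclidean_space}^'d^'r^'n \<Rightarrow> real" where
  "FFP A = (norm (frame_operator A))\<^sup>2"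

text \<open>Subspaces and dimensions are taken over the scalar field (\<open>vec.subspace\<close>, \<open>vec.dim\<close>), not over
  the reals.\<close>

definition property_S :: "('n::finite \<Rightarrow> nat) \<Rightarrow> 'a::conjugatable_field^'d^'r^'n \<Rightarrow> bool" where
  "property_S k A \<longleftrightarrow>
     (\<forall>Q. vec.subspace Q \<and> Q \<noteq> {0} \<and> Q \<noteq> UNIV \<longrightarrow>
        1 / real (vec.dim Q) * (\<Sum>i\<in>UNIV. real (vec.dim (range (\<lambda>x. frame_proj A i *v x) \<inter> Q)))
          \<le> real (\<Sum>i\<in>UNIV. k i) / real CARD('d))"

text \<open>Riemannian gradients on a subset \<open>M\<close> of a Euclidean space that is an embedded submanifold,
  with the induced metric: tangent vectors are velocities of differentiable curves in \<open>M\<close>, and the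
  gradient of \<open>F\<close> represents the derivative of \<open>F\<close> along such curves.\<close>

definition curve_in ::
    "'b::euclidean_space set \<Rightarrow> 'b \<Rightarrow> 'b \<Rightarrow> (real \<Rightarrow> 'b) \<Rightarrow> bool" where
  "curve_in M p v c \<longleftrightarrow>
     c 0 = p \<and> (c has_vector_derivative v) (at 0) \<and>
     (\<exists>e>0. \<forall>t\<in>{-e<..<e}. c t \<in> M \<and> c differentiable (at t))"

definition tangent_space :: "'b::euclidean_space set \<Rightarrow> 'b \<Rightarrow> 'b set" where
  "tangent_space M p = {v. \<exists>c. curve_in M p v c}"

definition is_riemannian_gradient ::
    "'b::euclidean_space set \<Rightarrow> ('b \<Rightarrow> real) \<Rightarrow> 'b \<Rightarrow> 'b \<Rightarrow> bool" where
  "is_riemannian_gradient M F p g \<longleftrightarrow>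
     g \<in> tangent_space M p \<and>
     (\<forall>v c. curve_in M p v c \<longrightarrow> ((\<lambda>t. F (c t)) has_real_derivative (g \<bullet> v)) (at 0))"

definition riemannian_gradient ::
    "'b::euclidean_space set \<Rightarrow> ('b \<Rightarrow> real) \<Rightarrow> 'b \<Rightarrow> 'b" where
  "riemannian_gradient M F p = (THE g. is_riemannian_gradient M F p g)"

definition global_minimum_on :: "'b set \<Rightarrow> ('b \<Rightarrow> real) \<Rightarrow> 'b \<Rightarrow> bool" where
  "global_minimum_on M F p \<longleftrightarrow> p \<in> M \<and> (\<forall>q\<in>M. F p \<le> F q)"

text \<open>Only the values of \<open>\<Gamma> p t\<close> for \<open>p \<in> M\<close> and \<open>t \<ge> 0\<close> matter; the derivative at \<open>t = 0\<close> is
  one-sided.\<close>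

definition negative_gradient_flow ::
    "'b::euclidean_space set \<Rightarrow> ('b \<Rightarrow> real) \<Rightarrow> ('b \<Rightarrow> real \<Rightarrow> 'b) \<Rightarrow> bool" where
  "negative_gradient_flow M F \<Gamma> \<longleftrightarrow>
     (\<forall>p\<in>M. \<Gamma> p 0 = p \<and>
        (\<forall>t\<ge>0. \<Gamma> p t \<in> M \<and>
           (\<Gamma> p has_vector_derivative - riemannian_gradient M F (\<Gamma> p t)) (at t within {0..})))"

end

theory Submission
  imports Defs
begin

text \<open>Write \<open>S\<close> for the frame operator, \<open>P i\<close> for the projectors \<open>adj (A $ i) ** A $ i\<close>, \<open>n\<close> for
the sum of the ranks and \<open>c = n / d\<close>. As \<open>S\<close> has trace \<open>n\<close>, Pythagoras gives
\<open>FFP A = (norm (S - c I))\<^sup>2 + n\<^sup>2 / d\<close>, so tight frames (\<open>S = c I\<close>) are global minima, and it suffices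
to show that a trajectory starting at a frame with property S converges to a tight frame.
Real and complex scalars are treated together in the type class \<open>rc_scalar\<close>.

The gradient is \<open>4 A\<^sub>i (P\<^sub>i S - S P\<^sub>i)\<close>. The flow thus has the form \<open>A\<^sub>i' = A\<^sub>i \<Omega>\<^sub>i\<close> with
skew-adjoint \<open>\<Omega>\<^sub>i\<close>; it preserves \<open>A\<^sub>i A\<^sub>i\<^sup>*\<close>, and \<open>x \<bullet> S x\<close> has a bounded logarithmic derivative,
so the flow exists for all times and stays among the fusion frames
(\<open>global_gradient_flow\<close>). The flow in both time directions also exhibits the gradient as
the velocity of a curve (\<open>riemannian_gradient_FFP\<close>).

The excess \<open>(norm (S - c I))\<^sup>2\<close> tends to zero (\<open>excess_decay\<close>). This is a Kempf-Ness argument.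
Let \<open>K' = 4 S K\<close> and \<open>K 0 = I\<close>. Then \<open>B\<^sub>i = A\<^sub>i K\<close> satisfies \<open>B\<^sub>i' = 4 H\<^sub>i B\<^sub>i\<close> with
\<open>H\<^sub>i = A\<^sub>i S A\<^sub>i\<^sup>*\<close>, and Liouville's formula expresses the maximal minors of \<open>B\<^sub>i\<close> and \<open>det K\<close>
by the integrals of \<open>tr H\<^sub>i\<close> and \<open>tr S\<close>, whose combination
\<open>(\<Sum>i. tr H\<^sub>i) - c tr S\<close> is the excess. Diagonalising \<open>K\<^sup>* K\<close> shows that the
integrated excess is bounded if suitable minors of the initial frame are bounded away from zero. Property S
implies that nonzero minors exist whose columns are spread evenly enough among the eigenvectors
(\<open>balanced_minors\<close>), and compactness makes the bound uniform. As the excess decreases, it is at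
most a constant divided by the time.

Convergence follows from a Lojasiewicz inequality: the squared gradient dominates the cube of
\<open>norm (S - c I)\<close> near tight frames (\<open>lojasiewicz_FFP\<close>), so the trajectory has finite length. The
inequality is elementary here. If \<open>S - c I\<close> almost commutes with all \<open>P\<^sub>i\<close>, then the
compression of \<open>P\<^sub>i\<close> to a cluster of eigenvectors of \<open>S\<close> is almost a projector, and its trace is
almost an integer. The sum of these integers differs from the rational number \<open>c\<close> times
the size of the cluster by either zero or at least \<open>1 / d\<close>, which leaves no room for a small
nonzero \<open>S - c I\<close> (\<open>commutator_lower_bound\<close>).\<close>

section \<open>Real and complex scalars\<close>

text \<open>One identity suffices to tie the conjugation to the norm: polarising it yields the inner product, and it
forces the conjugation to fix the reals.\<close>

class rc_scalar = conjugatable_field + real_normed_field + euclidean_space +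
  assumes mult_conjugate_self: "x * conjugate x = (x \<bullet> x) *\<^sub>R 1"

instance real :: rc_scalar
  by standard simp
instance complex :: rc_scalar
  by standard (simp add: complex_mult_cnj inner_complex_def power2_eq_square scaleR_conv_of_real)

lemma conjugate_one [simp]: "conjugate (1::'a::rc_scalar) = 1"
proof -
  have "conjugate (1::'a) = conjugate (1 * conjugate 1)"
    by (simp only: conjugate_dist_mul conjugate_id mult_1_right)
  then show ?thesis by (simp only: mult_1_left conjugate_id)
qed

lemma mult_conjugate_of_real:
  fixes x :: "'a::rc_scalar" shows "x * conjugate x = of_real (x \<bullet> x)"
  by (simp add: mult_conjugate_self of_real_def)

lemma conjugate_of_real [simp]: "conjugate (of_real r :: 'a::rc_scalar) = of_real r"
proof -
  have pos: "conjugate (of_real r :: 'a) = of_real r" if "r \<ge> 0" for r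
  proof -
    \<comment> \<open>Every nonnegative real is of the form \<open>s * conjugate s\<close>, which the
      conjugation fixes.\<close>
    define s where "s = of_real (sqrt (r / ((1::'a) \<bullet> 1))) * (1::'a)"
    have "s * conjugate s = of_real (s \<bullet> s)" by (rule mult_conjugate_of_real)
    also have "s \<bullet> s = r"
      using that by (simp add: s_def of_real_def power2_eq_square[symmetric] flip: mult.assoc)
    finally have *: "of_real r = s * conjugate s" by simp
    show ?thesis unfolding * by (simp add: conjugate_dist_mul mult.commute)
  qed
  show ?thesis
    using pos[of r] pos[of "-r"] conjugate_neg[of "of_real r :: 'a"]
    by (cases "r \<ge> 0") (auto simp: conjugate_neg)
qed

lemma conjugate_diff: "conjugate (x - y :: 'a::rc_scalar) = conjugate x - conjugate y"
  by (metis conjugate_dist_add conjugate_neg add_uminus_conv_diff)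

lemma conjugate_scaleR: "conjugate (r *\<^sub>R x :: 'a::rc_scalar) = r *\<^sub>R conjugate x"
  by (simp add: scaleR_conv_of_real conjugate_dist_mul)

lemma polarization: "x * conjugate y + y * conjugate x = of_real (2 * (x \<bullet> (y::'a::rc_scalar)))"
proof -
  have "(x + y) * conjugate (x + y) = of_real ((x + y) \<bullet> (x + y))"
    by (rule mult_conjugate_of_real)
  then have "x * conjugate y + y * conjugate x + (x * conjugate x + y * conjugate y)
      = of_real (2 * (x \<bullet> y)) + (of_real (x \<bullet> x) + of_real (y \<bullet> y))"
    by (simp add: conjugate_dist_add algebra_simps inner_commute)
  then show ?thesis by (simp add: mult_conjugate_of_real)
qed

definition re_part :: "'a::rc_scalar \<Rightarrow> real" where "re_part x = x \<bullet> 1"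

lemma re_part_eq: "x + conjugate x = of_real (2 * re_part (x::'a::rc_scalar))"
  using polarization[of x 1] by (simp add: re_part_def)

lemma inner_one_one [simp]: "(1::'a::rc_scalar) \<bullet> 1 = 1"
  using mult_conjugate_of_real[of "1::'a"] by (simp del: of_real_inner_1)

lemma re_part_of_real [simp]: "re_part (of_real r :: 'a::rc_scalar) = r"
  by (simp add: re_part_def of_real_def)

lemma re_part_simps [simp]:
  "re_part (0::'a::rc_scalar) = 0" "re_part (1::'a) = 1" "re_part (x + y :: 'a) = re_part x + re_part y"
  "re_part (x - y :: 'a) = re_part x - re_part y" "re_part (- x :: 'a) = - re_part x"
  "re_part (r *\<^sub>R x :: 'a) = r * re_part x"
  by (simp_all add: re_part_def inner_simps)

lemma re_part_sum: "re_part (sum f A :: 'a::rc_scalar) = (\<Sum>x\<in>A. re_part (f x))"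
  by (simp add: re_part_def inner_sum_left)

lemma re_part_conjugate [simp]: "re_part (conjugate x :: 'a::rc_scalar) = re_part x"
  using re_part_eq[of x] re_part_eq[of "conjugate x"]
  by (simp add: add.commute) 

lemma inner_re_part: "x \<bullet> y = re_part (x * conjugate (y::'a::rc_scalar))"
proof -
  have "of_real (2 * (x \<bullet> y)) = (of_real (2 * re_part (x * conjugate y)) :: 'a)"
    using polarization[of x y] re_part_eq[of "x * conjugate y"]
    by (simp add: conjugate_dist_mul mult.commute)
  then show ?thesis unfolding of_real_eq_iff by simp
qed

lemma inner_conjugate [simp]: "conjugate x \<bullet> conjugate y = x \<bullet> (y::'a::rc_scalar)"
  by (subst inner_commute) (simp add: inner_re_part mult.commute)

lemma self_conjugate_of_real: "conjugate x = (x::'a::rc_scalar) \<Longrightarrow> x = of_real (re_part x)"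
  using re_part_eq[of x] by (simp flip: mult_2)

lemma norm_conjugate [simp]: "norm (conjugate x :: 'a::rc_scalar) = norm x"
  by (simp add: norm_eq_sqrt_inner inner_re_part mult.commute)

lemma mult_conjugate_norm: "x * conjugate x = of_real ((norm (x::'a::rc_scalar))\<^sup>2)"
  by (simp add: mult_conjugate_of_real power2_norm_eq_inner)

section \<open>Adjoint matrices\<close>

lemma adj_nth [simp]: "adj A $ i $ j = conjugate (A $ j $ i)"
  by (simp add: adj_def)

lemma adj_adj [simp]: "adj (adj A) = A"
  by (simp add: vec_eq_iff)

lemma adj_mul: "adj (A ** B) = adj B ** adj (A :: 'a::rc_scalar^'m^'l)"
  by (simp add: vec_eq_iff matrix_matrix_mult_def sum_conjugate conjugate_dist_mul mult.commute)

lemma adj_add: "adj (A + B) = adj A + adj (B :: 'a::rc_scalar^'m^'l)"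
  and adj_diff: "adj (A - B) = adj A - adj (B :: 'a::rc_scalar^'m^'l)"
  and adj_scaleR: "adj (r *\<^sub>R A) = r *\<^sub>R adj (A :: 'a::rc_scalar^'m^'l)"
  by (simp_all add: vec_eq_iff conjugate_dist_add conjugate_diff conjugate_neg conjugate_scaleR)

lemma adj_zero [simp]: "adj (0 :: 'a::rc_scalar^'m^'l) = 0"
  by (simp add: vec_eq_iff)

lemma adj_sum: "adj (sum f A) = (\<Sum>i\<in>A. adj (f i :: 'a::rc_scalar^'m^'l))"
  by (induction A rule: infinite_finite_induct) (auto simp: adj_add)

lemma adj_mat_one [simp]: "adj (mat 1 :: 'a::rc_scalar^'m^'m) = mat 1"
  by (simp add: vec_eq_iff mat_def)

lemma matrix_inner_trace:
  "A \<bullet> B = re_part (trace (A ** adj (B :: 'a::rc_scalar^'m^'l)))"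
  by (simp add: inner_vec_def trace_def matrix_matrix_mult_def inner_re_part re_part_sum)

lemma inner_adj: "adj A \<bullet> adj B = A \<bullet> (B :: 'a::rc_scalar^'m^'l)"
  unfolding inner_vec_def by (subst sum.swap) (simp add: inner_conjugate)

lemma norm_adj [simp]: "norm (adj A) = norm (A :: 'a::rc_scalar^'m^'l)"
  by (simp add: norm_eq_sqrt_inner inner_adj)

lemma inner_mat_mult_right:
  "(A ** B) \<bullet> C = A \<bullet> (C ** adj (B :: 'a::rc_scalar^'m^'l))"
  by (simp add: matrix_inner_trace adj_mul matrix_mul_assoc)

lemma inner_mat_mult_left:
  "(A ** B) \<bullet> C = B \<bullet> (adj A ** (C :: 'a::rc_scalar^'m^'l))"
  using inner_mat_mult_right[of "adj B" "adj A" "adj C"] inner_adj[of "A ** B" C]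
    inner_adj[of B "adj A ** C"]
  by (simp add: adj_mul)

lemma inner_matrix_vector: "x \<bullet> (A *v y) = (adj A *v x) \<bullet> y"
  for A :: "'a::rc_scalar^'m^'l"
proof -
  have "x \<bullet> (A *v y) = re_part (\<Sum>i\<in>UNIV. \<Sum>j\<in>UNIV. x $ i * conjugate (A $ i $ j) * conjugate (y $ j))"
    by (simp add: inner_vec_def inner_re_part matrix_vector_mult_def sum_conjugate
        conjugate_dist_mul sum_distrib_left mult.assoc re_part_sum)
  also have "\<dots> = (adj A *v x) \<bullet> y"
    by (subst sum.swap) (simp add: inner_vec_def inner_re_part matrix_vector_mult_def
        sum_distrib_right sum_distrib_left mult_ac re_part_sum)
  finally show ?thesis .
qed

lemma bounded_bilinear_matrix_mult:
  "bounded_bilinear (\<lambda>(A :: 'a::rc_scalar^'m^'l) (B :: 'a^'k^'m). A ** B)"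
proof -
  have "bilinear (\<lambda>(A :: 'a^'m^'l) (B :: 'a^'k^'m). A ** B)"
    unfolding bilinear_def
    by (auto intro!: linearI simp: matrix_add_ldistrib matrix_scaleR vec_eq_iff
        matrix_matrix_mult_def sum.distrib scaleR_sum_right algebra_simps)
  then show ?thesis by (simp add: bilinear_conv_bounded_bilinear)
qed

lemma bounded_bilinear_matrix_vector:
  "bounded_bilinear (\<lambda>(A :: 'a::rc_scalar^'m^'l) (x :: 'a^'m). A *v x)"
proof -
  have "bilinear (\<lambda>(A :: 'a^'m^'l) (x :: 'a^'m). A *v x)"
    unfolding bilinear_def
    by (auto intro!: linearI simp: vec_eq_iff matrix_vector_mult_def sum.distrib scaleR_sum_right algebra_simps)
  then show ?thesis by (simp add: bilinear_conv_bounded_bilinear)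
qed

lemmas matrix_bilin =
  bounded_bilinear.diff_left[OF bounded_bilinear_matrix_mult]
  bounded_bilinear.diff_right[OF bounded_bilinear_matrix_mult]
  bounded_bilinear.add_left[OF bounded_bilinear_matrix_mult]
  bounded_bilinear.add_right[OF bounded_bilinear_matrix_mult]
  bounded_bilinear.minus_left[OF bounded_bilinear_matrix_mult]
  bounded_bilinear.minus_right[OF bounded_bilinear_matrix_mult]
  bounded_bilinear.scaleR_left[OF bounded_bilinear_matrix_mult]
  bounded_bilinear.scaleR_right[OF bounded_bilinear_matrix_mult]
  bounded_bilinear.zero_left[OF bounded_bilinear_matrix_mult]
  bounded_bilinear.zero_right[OF bounded_bilinear_matrix_mult]

lemma bounded_linear_adj: "bounded_linear (adj :: 'a::rc_scalar^'m^'l \<Rightarrow> _)"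
  by (simp add: linear_conv_bounded_linear[symmetric] linearI adj_add adj_scaleR)

lemma norm_matrix_squared: "(norm A)\<^sup>2 = (\<Sum>i\<in>UNIV. \<Sum>j\<in>UNIV. (norm (A $ i $ j))\<^sup>2)"
  for A :: "'a::rc_scalar^'m^'l"
  by (simp add: power2_norm_eq_inner inner_vec_def)

lemma norm_vec_squared: "(norm x)\<^sup>2 = (\<Sum>i\<in>UNIV. (norm (x $ i))\<^sup>2)"
  for x :: "'a::rc_scalar^'m"
  by (simp add: power2_norm_eq_inner inner_vec_def)

lemma norm_sum_mult_squared_le:
  fixes f g :: "'b \<Rightarrow> 'a::rc_scalar"
  shows "(norm (\<Sum>k\<in>S. f k * g k))\<^sup>2 \<le> (\<Sum>k\<in>S. (norm (f k))\<^sup>2) * (\<Sum>k\<in>S. (norm (g k))\<^sup>2)"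
proof -
  have "norm (\<Sum>k\<in>S. f k * g k) \<le> (\<Sum>k\<in>S. norm (f k) * norm (g k))"
    by (rule norm_sum[THEN order_trans]) (simp add: norm_mult)
  also have "\<dots> \<le> L2_set (\<lambda>k. norm (f k)) S * L2_set (\<lambda>k. norm (g k)) S"
    using L2_set_mult_ineq[of "\<lambda>k. norm (f k)" "\<lambda>k. norm (g k)" S] by simp
  finally have "(norm (\<Sum>k\<in>S. f k * g k))\<^sup>2 \<le> (L2_set (\<lambda>k. norm (f k)) S * L2_set (\<lambda>k. norm (g k)) S)\<^sup>2"
    by (rule power_mono) simp
  then show ?thesis by (simp add: L2_set_def power_mult_distrib sum_nonneg)
qed

lemma norm_matrix_mult_le:
  "norm (A ** B) \<le> norm A * norm B"
  for A :: "'a::rc_scalar^'m^'l" and B :: "'a^'k^'m"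
proof (rule power2_le_imp_le)
  have "(norm (A ** B))\<^sup>2 \<le> (\<Sum>i\<in>UNIV. \<Sum>j\<in>UNIV. (\<Sum>k\<in>UNIV. (norm (A $ i $ k))\<^sup>2) * (\<Sum>k\<in>UNIV. (norm (B $ k $ j))\<^sup>2))"
    unfolding norm_matrix_squared
    by (intro sum_mono) (simp add: matrix_matrix_mult_def norm_sum_mult_squared_le)
  also have "\<dots> = (\<Sum>i\<in>UNIV. \<Sum>k\<in>UNIV. (norm (A $ i $ k))\<^sup>2) * (\<Sum>j\<in>UNIV. \<Sum>k\<in>UNIV. (norm (B $ k $ j))\<^sup>2)"
    by (simp add: sum_product)
  also have "(\<Sum>j\<in>UNIV. \<Sum>k\<in>UNIV. (norm (B $ k $ j))\<^sup>2) = (norm B)\<^sup>2"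
    unfolding norm_matrix_squared by (rule sum.swap)
  finally show "(norm (A ** B))\<^sup>2 \<le> (norm A * norm B)\<^sup>2"
    by (simp add: norm_matrix_squared power_mult_distrib)
qed simp

lemma norm_matrix_vector_le: "norm (A *v x) \<le> norm A * norm x"
  for A :: "'a::rc_scalar^'m^'l"
proof (rule power2_le_imp_le)
  have "(norm (A *v x))\<^sup>2 \<le> (\<Sum>i\<in>UNIV. (\<Sum>k\<in>UNIV. (norm (A $ i $ k))\<^sup>2) * (\<Sum>k\<in>UNIV. (norm (x $ k))\<^sup>2))"
    unfolding norm_vec_squared[of "A *v x"]
    by (intro sum_mono) (simp add: matrix_vector_mult_def norm_sum_mult_squared_le)
  then show "(norm (A *v x))\<^sup>2 \<le> (norm A * norm x)\<^sup>2"
    by (simp add: norm_matrix_squared norm_vec_squared power_mult_distrib sum_distrib_right)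
qed simp

section \<open>The spectral theorem\<close>

definition herm :: "'a::rc_scalar^'m \<Rightarrow> 'a^'m \<Rightarrow> 'a" where
  "herm x y = (\<Sum>j\<in>UNIV. x $ j * conjugate (y $ j))"

lemma herm_add_left: "herm (x + y) z = herm x z + herm y z"
  and herm_add_right: "herm x (y + z) = herm x y + herm x z"
  and herm_scale_left: "herm (a *s x) z = a * herm x z"
  and herm_scale_right: "herm x (a *s z) = conjugate a * herm x z"
  and herm_diff_left: "herm (x - y) z = herm x z - herm y z"
  and herm_diff_right: "herm x (y - z) = herm x y - herm x z"
  and herm_zero_left [simp]: "herm 0 z = 0"
  and herm_zero_right [simp]: "herm x 0 = 0"
  by (simp_all add: herm_def sum.distrib conjugate_dist_add conjugate_dist_mul algebra_simps
      sum_distrib_left sum_negf sum_subtractf conjugate_neg conjugate_diff)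

lemma herm_sum_left: "herm (sum f S) z = (\<Sum>i\<in>S. herm (f i) z)"
  by (induction S rule: infinite_finite_induct) (auto simp: herm_add_left)

lemma herm_sum_right: "herm z (sum f S) = (\<Sum>i\<in>S. herm z (f i))"
  by (induction S rule: infinite_finite_induct) (auto simp: herm_add_right)

lemma herm_commute: "herm y x = conjugate (herm x y)"
  by (simp add: herm_def sum_conjugate conjugate_dist_mul mult.commute)

lemma re_part_herm: "re_part (herm x y) = x \<bullet> y"
  by (simp add: herm_def re_part_sum inner_vec_def inner_re_part)

lemma herm_self: "herm x x = of_real ((norm x)\<^sup>2)"
  using self_conjugate_of_real[of "herm x x"] herm_commute[of x x]
  by (simp add: re_part_herm power2_norm_eq_inner)

lemma herm_self_eq_0: "herm x x = 0 \<longleftrightarrow> x = 0"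
  by (simp add: herm_self)

lemma herm_adj: "herm (M *v x) y = herm x (adj M *v y)"
  for M :: "'a::rc_scalar^'m^'l"
proof -
  have "herm (M *v x) y = (\<Sum>i\<in>UNIV. \<Sum>j\<in>UNIV. M $ i $ j * x $ j * conjugate (y $ i))"
    by (simp add: herm_def matrix_vector_mult_def sum_distrib_right)
  also have "\<dots> = herm x (adj M *v y)"
    by (subst sum.swap) (simp add: herm_def matrix_vector_mult_def sum_distrib_left sum_conjugate
        conjugate_dist_mul mult_ac)
  finally show ?thesis .
qed

definition orthonormal :: "'a::rc_scalar^'d^'d \<Rightarrow> bool" where
  "orthonormal u \<longleftrightarrow> (\<forall>j k. herm (u $ j) (u $ k) = (if j = k then 1 else 0))"

lemma orthonormal_iff: "orthonormal u \<longleftrightarrow> u ** adj u = mat 1"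
  by (simp add: orthonormal_def vec_eq_iff matrix_matrix_mult_def mat_def herm_def)

lemma orthonormalD: "orthonormal u \<Longrightarrow> herm (u $ j) (u $ k) = (if j = k then 1 else 0)"
  by (simp add: orthonormal_def)

lemma orthonormal_expand:
  assumes "orthonormal u"
  shows "x = (\<Sum>j\<in>UNIV. herm x (u $ j) *s (u $ j))"
proof -
  have "adj u ** u = mat 1"
    using assms by (simp add: orthonormal_iff matrix_left_right_inverse)
  then have *: "(\<Sum>j\<in>UNIV. conjugate (u $ j $ a) * u $ j $ b) = (if a = b then 1 else 0)" for a b
    by (simp add: vec_eq_iff matrix_matrix_mult_def mat_def)
  have "(\<Sum>j\<in>UNIV. herm x (u $ j) *s (u $ j)) $ b = x $ b" for b
  proof -
    have "(\<Sum>j\<in>UNIV. herm x (u $ j) *s (u $ j)) $ b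
        = (\<Sum>a\<in>UNIV. x $ a * (\<Sum>j\<in>UNIV. conjugate (u $ j $ a) * u $ j $ b))"
      by (simp add: herm_def sum_distrib_right sum_distrib_left mult.assoc) (rule sum.swap)
    then show ?thesis by (simp add: * if_distrib[of "(*) _"] cong: if_cong)
  qed
  then show ?thesis by (simp add: vec_eq_iff)
qed

lemma re_part_of_nat [simp]: "re_part (of_nat n :: 'a::rc_scalar) = real n"
  using re_part_of_real[of "real n"] by (simp only: of_real_of_nat_eq)

lemma norm_orthonormal:
  assumes "orthonormal (u::'a::rc_scalar^'d^'d)"
  shows "(norm u)\<^sup>2 = CARD('d)"
  using assms by (simp add: orthonormal_iff power2_norm_eq_inner matrix_inner_trace trace_I)

lemma compact_orthonormal: "compact {u. orthonormal (u::'a::rc_scalar^'d^'d)}"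
proof -
  have "bounded {u. orthonormal (u::'a^'d^'d)}"
  proof (intro boundedI, clarify)
    fix u :: "'a^'d^'d" assume "orthonormal u"
    then have "norm u = sqrt (CARD('d))"
      using norm_orthonormal[of u] by (metis norm_ge_zero real_sqrt_unique)
    then show "norm u \<le> sqrt (CARD('d))" by simp
  qed
  moreover have "closed {u. orthonormal (u::'a^'d^'d)}"
    unfolding orthonormal_iff
    by (intro closed_Collect_eq bounded_bilinear.continuous_on[OF bounded_bilinear_matrix_mult]
        bounded_linear.continuous_on[OF bounded_linear_adj] continuous_intros)
  ultimately show ?thesis by (simp add: compact_eq_bounded_closed)
qed

lemma re_part_of_real_mult: "re_part (of_real r * x) = r * re_part (x::'a::rc_scalar)"
  by (simp flip: scaleR_conv_of_real)

lemma sum_two: "finite S \<Longrightarrow> p \<in> S \<Longrightarrow> q \<in> S \<Longrightarrow> p \<noteq> q \<Longrightarrow> sum f S = f p + f q + sum f (S - {p, q})"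
  by (simp add: sum.remove[of S p] sum.remove[of "S - {p}" q] insert_commute add.assoc
      Diff_insert2[symmetric])

text \<open>The vectors with indices \<open>p\<close> and \<open>q\<close> are rotated in the plane that they span. The phase \<open>t\<close> makes the
cross term of the quadratic form real and nonnegative, so that its size enters the gain linearly in \<open>s\<close>.\<close>

lemma rotation_gain:
  fixes u :: "'a::rc_scalar^'d^'d" and M :: "'a^'d^'d"
  assumes u: "orthonormal u" and M: "adj M = M" and pq: "p \<noteq> q" and cs: "c\<^sup>2 + s\<^sup>2 = (1::real)"
    and r: "r = norm (herm (M *v u $ p) (u $ q))"
  obtains u' where "orthonormal u'"
    "(\<Sum>j\<in>UNIV. w j * (u' $ j \<bullet> (M *v u' $ j))) = (\<Sum>j\<in>UNIV. w j * (u $ j \<bullet> (M *v u $ j)))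
      + (w p - w q) * (s\<^sup>2 * (u $ q \<bullet> (M *v u $ q) - u $ p \<bullet> (M *v u $ p)) + 2 * c * s * r)"
proof -
  define z where "z = herm (M *v u $ p) (u $ q)"
  define t where "t = (if z = 0 then 1 else z / of_real (norm z))"
  have "norm t = 1" by (simp add: t_def norm_divide)
  then have tt: "t * conjugate t = 1" by (simp add: mult_conjugate_norm)
  have zt: "conjugate t * z = of_real r"
  proof (cases "z = 0")
    case False
    have "conjugate t * z = conjugate (of_real (1 / norm z)) * conjugate z * z"
      using False by (simp add: t_def conjugate_dist_mul[symmetric] mult.commute)
    also have "\<dots> = of_real ((norm z)\<^sup>2 / norm z)"
      by (simp only: conjugate_of_real mult.assoc mult.commute[of "conjugate z"] mult_conjugate_norm) simp
    also have "\<dots> = of_real r" by (simp add: r z_def power2_eq_square)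
    finally show ?thesis .
  qed (simp add: r z_def[symmetric])
  define C S where "C = (of_real c :: 'a)" and "S = (of_real s :: 'a)"
  have CS: "conjugate C = C" "conjugate S = S" by (simp_all add: C_def S_def)
  have CS1: "C * C + S * S = 1" using cs by (simp add: C_def S_def power2_eq_square flip: of_real_mult of_real_add)
  define u' where "u' = (\<chi> j. if j = p then C *s u $ p + (S * t) *s u $ q
      else if j = q then (- S * conjugate t) *s u $ p + C *s u $ q else u $ j)"
  show thesis
  proof (rule that)
    have up: "u' $ p = C *s u $ p + (S * t) *s u $ q"
      and uq: "u' $ q = (- S * conjugate t) *s u $ p + C *s u $ q"
      and uo: "\<And>j. j \<noteq> p \<Longrightarrow> j \<noteq> q \<Longrightarrow> u' $ j = u $ j"
      using pq by (simp_all add: u'_def)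
    note hs = herm_add_left herm_add_right herm_diff_left herm_diff_right herm_scale_left herm_scale_right
    have STT: "S * t * (S * conjugate t) = S * S"
      using tt by (simp add: mult_ac)
    show "orthonormal u'"
      unfolding orthonormal_def
    proof (intro allI)
      fix j k
      have "herm (u' $ p) (u' $ p) = C * C + S * t * (S * conjugate t)"
        "herm (u' $ q) (u' $ q) = C * C + S * t * (S * conjugate t)"
        and 0: "herm (u' $ p) (u' $ q) = 0" "herm (u' $ q) (u' $ p) = 0"
        using pq
        by (simp_all add: up uq hs orthonormalD[OF u] CS conjugate_dist_mul conjugate_neg algebra_simps)
      then have 1: "herm (u' $ p) (u' $ p) = 1" "herm (u' $ q) (u' $ q) = 1"
        unfolding STT CS1 by blast+
      have 2: "herm (u' $ p) (u $ j) = 0" "herm (u' $ q) (u $ j) = 0"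
        "herm (u $ j) (u' $ p) = 0" "herm (u $ j) (u' $ q) = 0" if "j \<noteq> p" "j \<noteq> q" for j
        using that by (simp_all add: up uq hs orthonormalD[OF u])
      show "herm (u' $ j) (u' $ k) = (if j = k then 1 else 0)"
        using 0 1 2 pq by (cases "j = p"; cases "j = q"; cases "k = p"; cases "k = q")
          (auto simp: uo orthonormalD[OF u])
    qed
    show "(\<Sum>j\<in>UNIV. w j * (u' $ j \<bullet> (M *v u' $ j))) = (\<Sum>j\<in>UNIV. w j * (u $ j \<bullet> (M *v u $ j)))
      + (w p - w q) * (s\<^sup>2 * (u $ q \<bullet> (M *v u $ q) - u $ p \<bullet> (M *v u $ p)) + 2 * c * s * r)"
    proof -
      have zt': "t * conjugate z = of_real r"
        using arg_cong[OF zt, of conjugate] by (simp add: conjugate_dist_mul)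
      have zz: "herm (M *v u $ q) (u $ p) = conjugate z"
        using herm_adj[of M "u $ q" "u $ p"] M herm_commute[of "u $ q" "M *v u $ p"] by (simp add: z_def)
      have re: "x \<bullet> (M *v x) = re_part (herm (M *v x) x)" for x
        by (simp add: re_part_herm inner_commute)
      note hs' = hs matrix_vector_right_distrib vec.scale conjugate_dist_mul CS conjugate_neg
      have P: "herm (M *v u' $ p) (u' $ p) = of_real (c\<^sup>2) * herm (M *v u $ p) (u $ p)
          + of_real (2 * c * s) * of_real r + of_real (s\<^sup>2) * herm (M *v u $ q) (u $ q)"
      proof -
        have "herm (M *v u' $ p) (u' $ p) = C * C * herm (M *v u $ p) (u $ p)
            + C * S * (conjugate t * z) + C * S * (t * conjugate z)
            + (S * t * (S * conjugate t)) * herm (M *v u $ q) (u $ q)"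
          by (simp add: up hs' zz z_def[symmetric] algebra_simps)
        then show ?thesis unfolding zt zt' STT by (simp add: C_def S_def power2_eq_square algebra_simps)
      qed
      have Q: "herm (M *v u' $ q) (u' $ q) = of_real (s\<^sup>2) * herm (M *v u $ p) (u $ p)
          - of_real (2 * c * s) * of_real r + of_real (c\<^sup>2) * herm (M *v u $ q) (u $ q)"
      proof -
        have "herm (M *v u' $ q) (u' $ q) = C * C * herm (M *v u $ q) (u $ q)
            - C * S * (conjugate t * z) - C * S * (t * conjugate z)
            + (S * t * (S * conjugate t)) * herm (M *v u $ p) (u $ p)"
          by (simp add: uq hs' zz z_def[symmetric] algebra_simps)
        then show ?thesis unfolding zt zt' STT by (simp add: C_def S_def power2_eq_square algebra_simps)
      qed
      have c2: "c\<^sup>2 = 1 - s\<^sup>2" using cs by simp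
      show ?thesis
        using pq
        by (simp add: sum_two[of UNIV p q] re P Q re_part_of_real_mult uo c2 algebra_simps
            del: of_real_power of_real_mult)
    qed
  qed
qed

text \<open>An orthonormal family that maximises the weighted sum \<open>\<Sum>j. w j * (u $ j \<bullet> (M *v u $ j))\<close> for
distinct weights \<open>w\<close> diagonalises \<open>M\<close>: at a maximum no rotation of two members gains, which
forces the off-diagonal entry between them to vanish. Compactness provides the maximum.\<close>

theorem spectral_theorem:
  fixes M :: "'a::rc_scalar^'d^'d"
  assumes M: "adj M = M"
  obtains u :: "'a^'d^'d" and l :: "'d \<Rightarrow> real" where
    "orthonormal u" "\<And>j. M *v (u $ j) = of_real (l j) *s (u $ j)"
proof -
  obtain w :: "'d \<Rightarrow> nat" where w: "inj w"
    using finite_imp_inj_to_nat_seg[of "UNIV :: 'd set"] by auto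
  define f where "f = (\<lambda>u::'a^'d^'d. \<Sum>j\<in>UNIV. real (w j) * (u $ j \<bullet> (M *v u $ j)))"
  have "orthonormal (mat 1 :: 'a^'d^'d)" by (simp add: orthonormal_iff)
  moreover have "continuous_on {u. orthonormal u} f"
    unfolding f_def
    by (intro continuous_intros bounded_bilinear.continuous_on[OF bounded_bilinear_matrix_vector])
  ultimately obtain u where u: "orthonormal u" and max: "\<And>v. orthonormal v \<Longrightarrow> f v \<le> f u"
    using continuous_attains_sup[OF compact_orthonormal, of f] by blast
  have off: "herm (M *v u $ p) (u $ q) = 0" if pq: "p \<noteq> q" for p q
  proof (rule ccontr)
    define r where "r = norm (herm (M *v u $ p) (u $ q))"
    define D where "D = u $ q \<bullet> (M *v u $ q) - u $ p \<bullet> (M *v u $ p)"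
    assume "herm (M *v u $ p) (u $ q) \<noteq> 0"
    then have r: "r > 0" by (simp add: r_def)
    define W where "W = real (w p) - real (w q)"
    have W: "W \<noteq> 0" using w pq by (auto simp: W_def inj_def)
    have le: "W * (s\<^sup>2 * D + 2 * c * s * r) \<le> 0" if cs1: "c\<^sup>2 + s\<^sup>2 = 1" for c s :: real
    proof -
      obtain u' where "orthonormal u'" "f u' = f u + W * (s\<^sup>2 * D + 2 * c * s * r)"
        unfolding f_def W_def D_def by (rule rotation_gain[OF u M pq cs1 r_def, of "\<lambda>j. real (w j)"])
      with max[of u'] show ?thesis by simp
    qed
    \<comment> \<open>The rotation is the rational point of the circle with parameter \<open>t\<close>,
      and \<open>t\<close> is so small that the term linear in \<open>s\<close> dominates.\<close>
    define t where "t = min (1/2) (r / (2 * (\<bar>D\<bar> + 1)))"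
    have t: "0 < t" "t \<le> 1/2" using r unfolding t_def by (simp_all only: min.cobounded1) simp
    have tD: "t * \<bar>D\<bar> \<le> r / 2"
    proof -
      have "t * (2 * (\<bar>D\<bar> + 1)) \<le> r"
        using min.cobounded2[of "1/2" "r / (2 * (\<bar>D\<bar> + 1))"] unfolding t_def[symmetric]
        by (simp add: pos_le_divide_eq)
      then show ?thesis using t by (simp add: algebra_simps)
    qed
    define c s where "c = (1 - t\<^sup>2) / (1 + t\<^sup>2)" and "s = 2 * t / (1 + t\<^sup>2)"
    have t1: "1 + t\<^sup>2 > 0" by (simp add: add_pos_nonneg)
    have cs: "c\<^sup>2 + s\<^sup>2 = 1"
      using t1 by (simp add: c_def s_def divide_simps) (simp add: power2_eq_square algebra_simps)
    have "W * (s\<^sup>2 * D + 2 * c * s * r) \<le> 0" "W * (s\<^sup>2 * D - 2 * c * s * r) \<le> 0"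
      using le[of c s] le[of c "-s"] cs by simp_all
    then have *: "2 * c * s * r \<le> s\<^sup>2 * \<bar>D\<bar>"
    proof (cases "W > 0")
      case True
      then have "s\<^sup>2 * D + 2 * c * s * r \<le> 0"
        using \<open>W * (s\<^sup>2 * D + 2 * c * s * r) \<le> 0\<close> by (simp add: mult_le_0_iff)
      moreover have "s\<^sup>2 * - D \<le> s\<^sup>2 * \<bar>D\<bar>" by (rule mult_left_mono) auto
      ultimately show ?thesis by simp
    next
      case False
      then have "s\<^sup>2 * D - 2 * c * s * r \<ge> 0"
        using W \<open>W * (s\<^sup>2 * D - 2 * c * s * r) \<le> 0\<close> by (simp add: mult_le_0_iff)
      moreover have "s\<^sup>2 * D \<le> s\<^sup>2 * \<bar>D\<bar>" by (rule mult_left_mono) auto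
      ultimately show ?thesis by simp
    qed
    have s: "s > 0" using t t1 by (simp add: s_def)
    have "s * (2 * c * r) \<le> s * (s * \<bar>D\<bar>)"
      using * by (simp add: power2_eq_square mult_ac)
    then have "2 * c * r \<le> s * \<bar>D\<bar>" using s by simp
    then have "(1 + t\<^sup>2) * (2 * c * r) \<le> (1 + t\<^sup>2) * (s * \<bar>D\<bar>)"
      using t1 by (intro mult_left_mono) auto
    moreover have "(1 + t\<^sup>2) * c = 1 - t\<^sup>2" "(1 + t\<^sup>2) * s = 2 * t"
      using t1 by (simp_all add: c_def s_def)
    ultimately have "2 * ((1 - t\<^sup>2) * r) \<le> 2 * (t * \<bar>D\<bar>)"
      by (metis (no_types, lifting) mult.assoc mult.left_commute)
    then have "(1 - t\<^sup>2) * r \<le> t * \<bar>D\<bar>" by simp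
    moreover have "t\<^sup>2 \<le> 1/4" using power_mono[of t "1/2" 2] t by (simp add: power2_eq_square)
    then have "(3/4) * r \<le> (1 - t\<^sup>2) * r" using r by (intro mult_right_mono) auto
    ultimately show False using tD r by linarith
  qed
  have "M *v (u $ p) = of_real (u $ p \<bullet> (M *v u $ p)) *s (u $ p)" for p
  proof -
    have "M *v (u $ p) = (\<Sum>j\<in>UNIV. herm (M *v u $ p) (u $ j) *s (u $ j))"
      by (rule orthonormal_expand[OF u])
    also have "\<dots> = herm (M *v u $ p) (u $ p) *s (u $ p)"
      by (subst sum.remove[of _ p]) (auto simp: off intro!: sum.neutral)
    also have "herm (M *v u $ p) (u $ p) = of_real (u $ p \<bullet> (M *v u $ p))"
    proof -
      have "conjugate (herm (M *v u $ p) (u $ p)) = herm (M *v u $ p) (u $ p)"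
        using herm_adj[of M "u $ p" "u $ p"] M herm_commute[of "M *v u $ p" "u $ p"] by simp
      from self_conjugate_of_real[OF this] show ?thesis by (simp add: re_part_herm inner_commute)
    qed
    finally show ?thesis .
  qed
  from that[OF u this] show thesis .
qed

section \<open>Orthogonal projectors and fusion frames\<close>

lemma orthonormal_adj_mult: "orthonormal u \<Longrightarrow> adj u ** u = mat 1"
  by (simp add: orthonormal_iff matrix_left_right_inverse)

lemma trace_orthonormal:
  assumes "orthonormal u"
  shows "trace M = (\<Sum>j\<in>UNIV. herm (M *v (u $ j)) (u $ j))"
proof -
  have "trace M = trace (M ** (transpose u ** transpose (adj u)))"
    using orthonormal_adj_mult[OF assms]
    by (simp flip: matrix_transpose_mul)
  also have "\<dots> = trace (transpose (adj u) ** (M ** transpose u))"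
    unfolding matrix_mul_assoc by (subst trace_mul_sym) (simp add: matrix_mul_assoc)
  also have "\<dots> = (\<Sum>j\<in>UNIV. herm (M *v (u $ j)) (u $ j))"
    by (simp add: trace_def herm_def matrix_matrix_mult_def matrix_vector_mult_def transpose_def mult.commute)
  finally show ?thesis .
qed

lemma inj_orthonormal: "orthonormal u \<Longrightarrow> inj (($) u)"
  by (rule injI) (metis orthonormalD zero_neq_one)

lemma independent_orthonormal:
  assumes "orthonormal u" shows "vec.independent (($) u ` T)"
proof (rule vec.independent_if_scalars_zero)
  fix f x assume s: "(\<Sum>x\<in>($) u ` T. f x *s x) = 0" and x: "x \<in> ($) u ` T"
  then obtain j where j: "j \<in> T" "x = u $ j" by auto
  have "0 = herm (\<Sum>k\<in>T. f (u $ k) *s (u $ k)) (u $ j)"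
    using s inj_on_subset[OF inj_orthonormal[OF assms]] by (simp add: sum.reindex)
  also have "\<dots> = f (u $ j)"
    using j by (simp add: herm_sum_left herm_scale_left orthonormalD[OF assms] if_distrib[of "(*) _"]
        cong: if_cong)
  finally show "f x = 0" using j by simp
qed simp

lemma dim_span_orthonormal:
  assumes "orthonormal u" shows "vec.dim (vec.span (($) u ` T)) = card T"
  using vec.dim_span_eq_card_independent[OF independent_orthonormal[OF assms, of T]]
    inj_on_subset[OF inj_orthonormal[OF assms], of T]
  by (simp add: card_image)

lemma range_projector:
  assumes u: "orthonormal u" and Pu: "\<And>j. P *v (u $ j) = of_real (l j) *s (u $ j)"
    and P: "P ** P = P"
  shows "range (\<lambda>x. P *v x) = vec.span (($) u ` {j. l j = 1})" and "l j = 0 \<or> l j = 1"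
proof -
  have l: "l j = 0 \<or> l j = 1" for j
  proof -
    have "(P ** P) *v (u $ j) = of_real (l j * l j) *s (u $ j)"
      by (simp add: matrix_vector_mul_assoc[symmetric] Pu vec.scale)
    then have "of_real (l j * l j) *s (u $ j) = of_real (l j) *s (u $ j)" by (simp add: P Pu)
    then have "herm (of_real (l j * l j) *s (u $ j)) (u $ j) = herm (of_real (l j) *s (u $ j)) (u $ j)"
      by (rule arg_cong)
    then have "l j * l j = l j"
      by (simp add: herm_scale_left orthonormalD[OF u] flip: of_real_mult)
    then show ?thesis by simp
  qed
  then show "l j = 0 \<or> l j = 1" .
  show "range (\<lambda>x. P *v x) = vec.span (($) u ` {j. l j = 1})"
  proof
    show "range (\<lambda>x. P *v x) \<subseteq> vec.span (($) u ` {j. l j = 1})"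
    proof clarify
      fix x
      have "P *v x = P *v (\<Sum>j\<in>UNIV. herm x (u $ j) *s (u $ j))"
        using orthonormal_expand[OF u, of x] by simp
      also have "\<dots> = (\<Sum>j\<in>UNIV. herm x (u $ j) *s (of_real (l j) *s (u $ j)))"
        by (simp add: vec.sum vec.scale Pu)
      also have "\<dots> \<in> vec.span (($) u ` {j. l j = 1})"
      proof (rule vec.span_sum, rule vec.span_scale)
        fix j show "of_real (l j) *s (u $ j) \<in> vec.span (($) u ` {j. l j = 1})"
          using l[of j] by (auto intro: vec.span_base vec.span_zero)
      qed
      finally show "P *v x \<in> vec.span (($) u ` {j. l j = 1})" .
    qed
    show "vec.span (($) u ` {j. l j = 1}) \<subseteq> range (\<lambda>x. P *v x)"
    proof (rule vec.span_minimal)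
      show "($) u ` {j. l j = 1} \<subseteq> range (\<lambda>x. P *v x)"
        using Pu by (auto simp: image_iff) (metis of_real_1 vector_smult_lid)
      show "vec.subspace (range (\<lambda>x. P *v x))"
        by (rule vec.subspace_image[OF vec.subspace_UNIV])
    qed
  qed
qed

text \<open>In an orthonormal eigenbasis the trace counts the eigenvalues one.\<close>

lemma projector_trace_dim:
  assumes "orthogonal_projector (P :: 'a::rc_scalar^'d^'d)"
  shows "trace P = of_nat (vec.dim (range (\<lambda>x. P *v x)))"
proof -
  have P: "P ** P = P" "adj P = P" using assms by (auto simp: orthogonal_projector_def)
  obtain u l where u: "orthonormal u" and Pu: "\<And>j. P *v (u $ j) = of_real (l j) *s (u $ j)"
    by (rule spectral_theorem[OF P(2)]) blast
  note r = range_projector[OF u Pu P(1)]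
  have "trace P = (\<Sum>j\<in>UNIV. of_real (l j))"
    by (simp add: trace_orthonormal[OF u] Pu herm_scale_left orthonormalD[OF u])
  also have "\<dots> = (\<Sum>j\<in>UNIV. if l j = 1 then 1 else 0)"
    using r(2) by (intro sum.cong) (metis of_real_0 of_real_1)+
  also have "\<dots> = of_nat (card {j. l j = 1})"
    by (simp add: sum.If_cases)
  finally show ?thesis by (simp add: r(1) dim_span_orthonormal[OF u] del: vec.dim_span)
qed

lemma matrix_vector_axis: "A *v axis i 1 = column i A" for A :: "'a::field^'m^'l"
  by (simp add: vec_eq_iff matrix_vector_mult_def axis_def column_def if_distrib[of "(*) _"] cong: if_cong)

lemma span_columns: "vec.span (columns A) = range (\<lambda>x. A *v x)"
  for A :: "'a::field^'m^'l"
proof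
  show "vec.span (columns A) \<subseteq> range (\<lambda>x. A *v x)"
  proof (rule vec.span_minimal)
    show "columns A \<subseteq> range (\<lambda>x. A *v x)"
    proof
      fix y assume "y \<in> columns A"
      then obtain i where "y = A *v axis i 1"
        by (auto simp: columns_def matrix_vector_axis)
      then show "y \<in> range (\<lambda>x. A *v x)" by (rule range_eqI)
    qed
    show "vec.subspace (range (\<lambda>x. A *v x))"
      by (rule vec.subspace_image[OF vec.subspace_UNIV])
  qed
  show "range (\<lambda>x. A *v x) \<subseteq> vec.span (columns A)"
  proof clarify
    fix x
    show "A *v x \<in> vec.span (columns A)"
      unfolding matrix_mult_sum
      by (rule vec.span_sum, rule vec.span_scale, rule vec.span_base) (auto simp: columns_def)
  qed
qed

text \<open>As \<open>rank\<close> is the dimension of the row space, the transposed projector is used.\<close>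

lemma projector_trace_rank:
  assumes "orthogonal_projector (P :: 'a::rc_scalar^'d^'d)"
  shows "trace P = of_nat (rank P)"
proof -
  have P: "P ** P = P" "adj P = P" using assms by (auto simp: orthogonal_projector_def)
  have "adj (transpose P) = transpose (adj P)" by (simp add: vec_eq_iff transpose_def)
  then have "orthogonal_projector (transpose P)"
    using P by (simp add: orthogonal_projector_def flip: matrix_transpose_mul)
  then have "trace (transpose P) = of_nat (vec.dim (range (\<lambda>x. transpose P *v x)))"
    by (rule projector_trace_dim)
  also have "vec.dim (range (\<lambda>x. transpose P *v x)) = rank P"
    unfolding span_columns[symmetric] by (simp add: row_rank_def_gen columns_transpose)
  finally show ?thesis by (simp add: trace_def transpose_def)
qed

definition coord_proj :: "'r set \<Rightarrow> 'a::rc_scalar^'r^'r" where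
  "coord_proj R = (\<chi> r s. if r = s \<and> r \<in> R then 1 else 0)"

lemma coord_proj_mult: "coord_proj R ** A = (\<chi> r. if r \<in> R then A $ r else 0)"
proof -
  have "(\<Sum>k\<in>UNIV. (if i = k \<and> i \<in> R then 1 else 0) * A $ k $ j) = (if i \<in> R then A $ i $ j else 0)" for i j
    by (cases "i \<in> R") (simp_all add: if_distrib[of "\<lambda>x. x * _"] cong: if_cong)
  then show ?thesis
    by (simp add: vec_eq_iff matrix_matrix_mult_def coord_proj_def)
qed

lemma adj_coord_proj [simp]: "adj (coord_proj R) = coord_proj R"
  by (auto simp: vec_eq_iff coord_proj_def)

lemma trace_coord_proj: "trace (coord_proj R :: 'a::rc_scalar^'r^'r) = of_nat (card (R :: 'r::finite set))"
  by (simp add: trace_def coord_proj_def sum.If_cases)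

lemma norm_matrix_trace: "(norm A)\<^sup>2 = re_part (trace (adj A ** A))"
  for A :: "'a::rc_scalar^'m^'l"
  by (simp only: power2_norm_eq_inner matrix_inner_trace trace_mul_sym[of A])

lemma adj_mult_self_eq_0: "adj A ** A = 0 \<Longrightarrow> A = 0" for A :: "'a::rc_scalar^'m^'l"
  using norm_matrix_trace[of A] by (simp add: trace_def)

lemma mult_adj_nth: "(A ** adj A) $ r $ s = herm (A $ r) (A $ s)"
  by (simp add: matrix_matrix_mult_def herm_def)

lemma coord_proj_mult_rows:
  assumes "A ** adj A = coord_proj R"
  shows "r \<notin> R \<Longrightarrow> A $ r = 0" and "coord_proj R ** A = A"
proof -
  have *: "A $ r = 0" if "r \<notin> R" for r
    using mult_adj_nth[of A r r] that unfolding assms by (simp add: coord_proj_def herm_self_eq_0)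
  then show "r \<notin> R \<Longrightarrow> A $ r = 0" .
  show "coord_proj R ** A = A" using * by (simp add: coord_proj_mult vec_eq_iff)
qed

lemma partial_isometry:
  fixes A :: "'a::rc_scalar^'m^'l"
  assumes "(adj A ** A) ** (adj A ** A) = adj A ** A"
  shows "A ** (adj A ** A) = A"
proof -
  let ?P = "adj A ** A"
  let ?X = "A ** ?P - A"
  have "adj ?X ** ?X = ?P ** ?P ** ?P - ?P ** ?P - ?P ** ?P + ?P"
    by (simp add: adj_diff adj_mul matrix_mul_assoc matrix_bilin)
  also have "\<dots> = 0" by (simp add: assms)
  finally show ?thesis using adj_mult_self_eq_0[of ?X] by simp
qed

lemma projector_of_rows:
  fixes A :: "'a::rc_scalar^'d^'r"
  assumes "A ** adj A = coord_proj R"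
  shows "orthogonal_projector (adj A ** A)" and "rank (adj A ** A) = card R"
    and "vec.dim (range (\<lambda>x. (adj A ** A) *v x)) = card R"
proof -
  have "(adj A ** A) ** (adj A ** A) = adj A ** ((A ** adj A) ** A)"
    by (simp add: matrix_mul_assoc)
  then have "(adj A ** A) ** (adj A ** A) = adj A ** A"
    unfolding assms coord_proj_mult_rows(2)[OF assms] .
  then show P: "orthogonal_projector (adj A ** A)"
    by (simp add: orthogonal_projector_def adj_mul)
  have tr: "trace (adj A ** A) = of_nat (card R)"
    by (simp add: trace_mul_sym[of "adj A"] assms trace_coord_proj)
  then show "rank (adj A ** A) = card R" "vec.dim (range (\<lambda>x. (adj A ** A) *v x)) = card R"
    using projector_trace_rank[OF P] projector_trace_dim[OF P] by simp_all
qed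

text \<open>Both \<open>A ** adj A\<close> and \<open>coord_proj R\<close> are orthogonal projectors, the second fixes the range of the
first, and they have the same trace. Their difference is a projector of trace zero, so it vanishes.\<close>

lemma rows_of_projector:
  fixes A :: "'a::rc_scalar^'d^'r"
  assumes zero: "\<And>r. r \<notin> R \<Longrightarrow> A $ r = 0" and P: "orthogonal_projector (adj A ** A)"
    and rank: "rank (adj A ** A) = card R"
  shows "A ** adj A = coord_proj R"
proof -
  let ?E = "coord_proj R :: 'a^'r^'r"
  define Q where "Q = A ** adj A"
  have EA: "?E ** A = A" using zero by (simp add: coord_proj_mult vec_eq_iff)
  have AP: "A ** (adj A ** A) = A"
    using P by (intro partial_isometry) (simp add: orthogonal_projector_def)
  have QQ: "Q ** Q = Q"
    unfolding Q_def by (metis AP matrix_mul_assoc)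
  have EQ: "?E ** Q = Q" by (simp add: Q_def matrix_mul_assoc EA)
  have aQ: "adj Q = Q" by (simp add: Q_def adj_mul)
  have QE: "Q ** ?E = Q" using arg_cong[OF EQ, of adj] by (simp add: adj_mul aQ)
  have EE: "?E ** ?E = ?E" by (simp add: coord_proj_mult vec_eq_iff) (simp add: coord_proj_def)
  have "adj (?E - Q) ** (?E - Q) = ?E - Q"
    by (simp add: adj_diff aQ matrix_bilin QQ EQ QE EE)
  then have "(norm (?E - Q))\<^sup>2 = re_part (trace (?E - Q))"
    by (simp add: norm_matrix_trace)
  also have "trace Q = of_nat (card R)"
    using projector_trace_rank[OF P] rank by (simp add: Q_def trace_mul_sym[of A])
  then have "trace (?E - Q) = 0" by (simp add: trace_sub trace_coord_proj)
  finally show ?thesis by (simp add: Q_def)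
qed

lemma inner_adj_mult_self: "x \<bullet> ((adj B ** B) *v x) = (norm (B *v x))\<^sup>2"
  for B :: "'a::rc_scalar^'m^'l"
  by (simp add: inner_matrix_vector[of x "adj B"] power2_norm_eq_inner flip: matrix_vector_mul_assoc)

lemma matrix_vector_sum_left: "sum f S *v x = (\<Sum>i\<in>S. f i *v x)"
  by (induction S rule: infinite_finite_induct) (auto simp: matrix_vector_mult_add_rdistrib)

lemma inner_frame_operator: "x \<bullet> (frame_operator A *v x) = (\<Sum>i\<in>UNIV. (norm (A $ i *v x))\<^sup>2)"
  for A :: "'a::rc_scalar^'d^'r^'n"
  by (simp add: frame_operator_def matrix_vector_sum_left inner_sum_right inner_adj_mult_self)

lemma adj_frame_operator [simp]: "adj (frame_operator A) = frame_operator A"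
  for A :: "'a::rc_scalar^'d^'r^'n"
  by (simp add: frame_operator_def adj_sum adj_mul)

text \<open>Tuples of matrices with orthonormal rows: the fusion frame conditions without positive definiteness.
This set is closed, so limits of trajectories belong to it.\<close>

definition row_frames :: "('n::finite \<Rightarrow> 'r set) \<Rightarrow> ('a::rc_scalar^'d^'r^'n) set" where
  "row_frames R = {A. \<forall>i. A $ i ** adj (A $ i) = coord_proj (R i)}"

lemma row_framesD: "A \<in> row_frames R \<Longrightarrow> A $ i ** adj (A $ i) = coord_proj (R i)"
  by (simp add: row_frames_def)

lemma fusion_frames_iff:
  fixes A :: "'a::rc_scalar^'d^'r^'n"
  assumes "\<And>i. card (R i) = k i"
  shows "A \<in> fusion_frames k R \<longleftrightarrow>
    A \<in> row_frames R \<and> (\<forall>x. x \<noteq> 0 \<longrightarrow> x \<bullet> (frame_operator A *v x) > 0)"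
  using assms rows_of_projector[of "R i" "A $ i" for i] projector_of_rows[of "A $ i" "R i" for i]
    coord_proj_mult_rows(1)[of "A $ i" "R i" for i]
  unfolding fusion_frames_def row_frames_def frame_proj_def positive_definite_def
  by (auto; metis)

section \<open>Global solutions of ordinary differential equations\<close>

text \<open>The oriented integral of \<open>f\<close> from \<open>0\<close> to \<open>t\<close>, for either sign of \<open>t\<close>; one of the two terms is zero.\<close>

definition primitive :: "(real \<Rightarrow> 'b::euclidean_space) \<Rightarrow> real \<Rightarrow> 'b" where
  "primitive f t = integral {0..t} f - integral {t..0} f"

lemma primitive_zero [simp]: "primitive f 0 = 0"
  by (simp add: primitive_def)

lemma has_vector_derivative_primitive:
  fixes f :: "real \<Rightarrow> 'b::euclidean_space"
  assumes "continuous_on UNIV f"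
  shows "(primitive f has_vector_derivative f t) (at t)"
proof -
  define a b where "a = - (\<bar>t\<bar> + 1)" and "b = \<bar>t\<bar> + 1"
  have ab: "a < t" "t < b" "a < 0" "0 < b" by (auto simp: a_def b_def)
  have int: "f integrable_on {c..d}" for c d
    using continuous_on_subset[OF assms] by (intro integrable_continuous_interval) auto
  have eq: "integral {a..s} f - integral {a..0} f = primitive f s" if "s \<in> {a<..<b}" for s
  proof (cases "s \<ge> 0")
    case True
    then have "integral {a..0} f + integral {0..s} f = integral {a..s} f"
      using ab int by (intro Henstock_Kurzweil_Integration.integral_combine) auto
    moreover have "integral {s..0} f = 0" using True by (cases "s = 0") auto
    ultimately show ?thesis by (simp add: primitive_def algebra_simps)
  next
    case False
    then have "integral {a..s} f + integral {s..0} f = integral {a..0} f"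
      using that int by (intro Henstock_Kurzweil_Integration.integral_combine) auto
    then show ?thesis using False by (simp add: primitive_def algebra_simps)
  qed
  have "((\<lambda>s. integral {a..s} f) has_vector_derivative f t) (at t within {a..b})"
    using ab continuous_on_subset[OF assms] by (intro integral_has_vector_derivative) auto
  then have "((\<lambda>s. integral {a..s} f) has_vector_derivative f t) (at t)"
    using ab by (simp add: at_within_Icc_at)
  then have "((\<lambda>s. integral {a..s} f - integral {a..0} f) has_vector_derivative f t) (at t)"
    by (auto intro!: derivative_eq_intros)
  then show ?thesis
    by (rule has_vector_derivative_transform_within_open[of _ _ _ "{a<..<b}"])
      (use ab eq in auto)
qed

lemma norm_primitive_le:
  fixes f :: "real \<Rightarrow> 'b::euclidean_space"
  assumes cont: "continuous_on UNIV f" and a: "a > 0"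
    and bd: "\<And>s. norm (f s) \<le> M * exp (a * \<bar>s\<bar>)"
  shows "norm (primitive f t) \<le> M / a * exp (a * \<bar>t\<bar>)"
proof -
  have M: "M \<ge> 0" using order_trans[OF norm_ge_zero bd[of 0]] by simp
  note der = has_vector_derivative_primitive[OF cont]
  have contp: "continuous_on S (primitive f)" for S
    using der by (meson continuous_at_imp_continuous_on has_vector_derivative_continuous)
  consider "t = 0" | "t > 0" | "t < 0" by linarith
  then show ?thesis
  proof cases
    case 1 then show ?thesis using M a by simp
  next
    case 2
    have "norm (primitive f t - primitive f 0) \<le> M / a * exp (a * t) - M / a * exp (a * 0)"
    proof (rule differentiable_bound_general[OF 2 contp _ der])
      show "((\<lambda>s. M / a * exp (a * s)) has_vector_derivative M * exp (a * s)) (at s)" for s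
        using a by (auto intro!: derivative_eq_intros simp flip: has_real_derivative_iff_has_vector_derivative)
      show "norm (f s) \<le> M * exp (a * s)" if "0 < s" for s using bd[of s] that by simp
    qed (use a in \<open>auto intro!: continuous_intros\<close>)
    also have "\<dots> \<le> M / a * exp (a * \<bar>t\<bar>)" using 2 M a by simp
    finally show ?thesis by simp
  next
    case 3
    have "norm (primitive f 0 - primitive f t) \<le> - M / a * exp (- (a * 0)) - - M / a * exp (- (a * t))"
    proof (rule differentiable_bound_general[OF 3 contp _ der])
      show "((\<lambda>s. - M / a * exp (- (a * s))) has_vector_derivative M * exp (- (a * s))) (at s)" for s
        using a by (auto intro!: derivative_eq_intros simp flip: has_real_derivative_iff_has_vector_derivative)
      show "norm (f s) \<le> M * exp (- (a * s))" if "s < 0" for s using bd[of s] that by simp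
    qed (use a in \<open>auto intro!: continuous_intros\<close>)
    also have "\<dots> \<le> M / a * exp (a * \<bar>t\<bar>)" using 3 M a by simp
    finally show ?thesis by simp
  qed
qed

text \<open>Picard iteration for \<open>u t = exp (- a * \<bar>t\<bar>) *\<^sub>R x t\<close>: by \<open>norm_primitive_le\<close> it is a contraction of the
bounded continuous functions on the whole line once \<open>a\<close> exceeds twice the Lipschitz constant. The exponential
weight replaces the patching of local solutions.\<close>

theorem global_solution:
  fixes F :: "real \<Rightarrow> 'b::euclidean_space \<Rightarrow> 'b"
  assumes cont: "continuous_on UNIV (\<lambda>p. F (fst p) (snd p))"
    and lip: "\<And>t x y. norm (F t x - F t y) \<le> L * norm (x - y)"
    and bd: "\<And>t. norm (F t 0) \<le> B"
  obtains x where "x 0 = x0" "\<And>t. (x has_vector_derivative F t (x t)) (at t)"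
proof -
  \<comment> \<open>The contraction factor \<open>\<bar>L\<bar> / a\<close> is at most
    \<open>1/2\<close>.\<close>
  define a where "a = 2 * \<bar>L\<bar> + 1"
  have a: "a > 0" by (simp add: a_def)
  have B: "B \<ge> 0" using bd[of 0] norm_ge_zero[of "F 0 0"] by linarith
  have lip': "norm (F t x - F t y) \<le> \<bar>L\<bar> * norm (x - y)" for t x y
    using lip[of t x y] by (rule order_trans) (simp add: mult_right_mono)
  define G where "G = (\<lambda>(u::real \<Rightarrow>\<^sub>C 'b) s. F s (exp (a * \<bar>s\<bar>) *\<^sub>R apply_bcontfun u s))"
  have G_cont: "continuous_on UNIV (G u)" for u
  proof -
    have "continuous_on UNIV ((\<lambda>p. F (fst p) (snd p)) \<circ> (\<lambda>s. (s, exp (a * \<bar>s\<bar>) *\<^sub>R apply_bcontfun u s)))"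
      by (rule continuous_on_compose) (auto intro!: continuous_intros continuous_on_subset[OF cont])
    then show ?thesis by (simp add: G_def o_def)
  qed
  have G_bd: "norm (G u s) \<le> (B + \<bar>L\<bar> * norm u) * exp (a * \<bar>s\<bar>)" for u s
  proof -
    have "norm (G u s) \<le> norm (F s 0) + norm (G u s - F s 0)" by norm
    also have "\<dots> \<le> B + \<bar>L\<bar> * (exp (a * \<bar>s\<bar>) * norm (apply_bcontfun u s))"
      using lip'[of s "exp (a * \<bar>s\<bar>) *\<^sub>R apply_bcontfun u s" 0] bd[of s] by (simp add: G_def)
    also have "\<dots> \<le> B * exp (a * \<bar>s\<bar>) + \<bar>L\<bar> * (exp (a * \<bar>s\<bar>) * norm u)"
      using B a norm_bounded[of u s]
      by (intro add_mono mult_left_mono) (auto simp: mult_le_cancel_left1)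
    finally show ?thesis by (simp add: algebra_simps)
  qed
  define T where "T = (\<lambda>u. Bcontfun (\<lambda>t. exp (- (a * \<bar>t\<bar>)) *\<^sub>R (x0 + primitive (G u) t)))"
  have T: "apply_bcontfun (T u) t = exp (- (a * \<bar>t\<bar>)) *\<^sub>R (x0 + primitive (G u) t)" for u t
  proof -
    have "(\<lambda>t. exp (- (a * \<bar>t\<bar>)) *\<^sub>R (x0 + primitive (G u) t)) \<in> bcontfun"
    proof (rule bcontfun_normI)
      have "continuous_on UNIV (primitive (G u))"
        using has_vector_derivative_primitive[OF G_cont]
        by (meson continuous_at_imp_continuous_on has_vector_derivative_continuous)
      then show "continuous_on UNIV (\<lambda>t. exp (- (a * \<bar>t\<bar>)) *\<^sub>R (x0 + primitive (G u) t))"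
        by (intro continuous_intros)
      fix t
      have "norm (exp (- (a * \<bar>t\<bar>)) *\<^sub>R (x0 + primitive (G u) t))
          \<le> exp (- (a * \<bar>t\<bar>)) * (norm x0 + norm (primitive (G u) t))"
        by (simp add: norm_triangle_ineq)
      also have "\<dots> \<le> exp (- (a * \<bar>t\<bar>)) * (norm x0 * exp (a * \<bar>t\<bar>)
          + (B + \<bar>L\<bar> * norm u) / a * exp (a * \<bar>t\<bar>))"
        using norm_primitive_le[OF G_cont a G_bd] a
        by (intro mult_left_mono add_mono) (auto simp: mult_le_cancel_left1)
      also have "\<dots> = norm x0 + (B + \<bar>L\<bar> * norm u) / a"
        by (simp add: exp_minus field_simps)
      finally show "norm (exp (- (a * \<bar>t\<bar>)) *\<^sub>R (x0 + primitive (G u) t)) \<le> norm x0 + (B + \<bar>L\<bar> * norm u) / a" .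
    qed
    then show ?thesis by (simp add: T_def Bcontfun_inverse)
  qed
  have prim_diff: "primitive (G u) t - primitive (G v) t = primitive (\<lambda>s. G u s - G v s) t" for u v t
  proof -
    have "G w integrable_on {c..d}" for w c d
      using continuous_on_subset[OF G_cont] by (intro integrable_continuous_interval) auto
    then show ?thesis by (simp add: primitive_def Henstock_Kurzweil_Integration.integral_diff)
  qed
  have "dist (T u) (T v) \<le> 1/2 * dist u v" for u v
  proof (rule dist_bound)
    fix t
    have *: "norm (G u s - G v s) \<le> (\<bar>L\<bar> * dist u v) * exp (a * \<bar>s\<bar>)" for s
    proof -
      have "norm (G u s - G v s) \<le> \<bar>L\<bar> * (exp (a * \<bar>s\<bar>) * dist (apply_bcontfun u s) (apply_bcontfun v s))"
        using lip'[of s "exp (a * \<bar>s\<bar>) *\<^sub>R apply_bcontfun u s" "exp (a * \<bar>s\<bar>) *\<^sub>R apply_bcontfun v s"]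
        by (simp add: G_def dist_norm flip: scaleR_diff_right)
      also have "\<dots> \<le> \<bar>L\<bar> * (exp (a * \<bar>s\<bar>) * dist u v)"
        by (intro mult_left_mono dist_bounded) auto
      finally show ?thesis by (simp add: mult_ac)
    qed
    have "dist (apply_bcontfun (T u) t) (apply_bcontfun (T v) t)
        = exp (- (a * \<bar>t\<bar>)) * norm (primitive (\<lambda>s. G u s - G v s) t)"
      unfolding T dist_norm prim_diff[symmetric]
      by (simp flip: scaleR_diff_right)
    also have "\<dots> \<le> exp (- (a * \<bar>t\<bar>)) * ((\<bar>L\<bar> * dist u v) / a * exp (a * \<bar>t\<bar>))"
      using a * G_cont by (intro mult_left_mono norm_primitive_le) (auto intro!: continuous_intros)
    also have "\<dots> = \<bar>L\<bar> / a * dist u v" by (simp add: exp_minus)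
    also have "\<dots> \<le> 1/2 * dist u v"
      using a by (intro mult_right_mono) (auto simp: a_def divide_simps)
    finally show "dist (apply_bcontfun (T u) t) (apply_bcontfun (T v) t) \<le> 1/2 * dist u v" .
  qed
  then obtain u where u: "T u = u"
    using banach_fix_type[of "1/2" T] by auto
  define x where "x = (\<lambda>t. exp (a * \<bar>t\<bar>) *\<^sub>R apply_bcontfun u t)"
  have x: "x t = x0 + primitive (G u) t" for t
  proof -
    have "x t = exp (a * \<bar>t\<bar>) *\<^sub>R apply_bcontfun (T u) t" by (simp add: x_def u)
    then show ?thesis unfolding T by (simp flip: exp_add)
  qed
  show thesis
  proof (rule that)
    show "x 0 = x0" by (simp add: x)
    show "(x has_vector_derivative F t (x t)) (at t)" for t
    proof -
      have "((\<lambda>t. x0 + primitive (G u) t) has_vector_derivative G u t) (at t)"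
        by (auto intro!: derivative_eq_intros has_vector_derivative_primitive[OF G_cont])
      moreover have "x = (\<lambda>t. x0 + primitive (G u) t)" by (rule ext) (rule x)
      moreover have "G u t = F t (x t)" by (simp add: G_def x_def)
      ultimately show ?thesis by simp
    qed
  qed
qed

section \<open>The gradient of the frame potential\<close>

lemmas matrix_mult_has_vector_derivative =
  bounded_bilinear.has_vector_derivative[OF bounded_bilinear_matrix_mult]
lemmas adj_has_vector_derivative = bounded_linear.has_vector_derivative[OF bounded_linear_adj]
lemmas nth_has_vector_derivative = bounded_linear.has_vector_derivative[OF bounded_linear_vec_nth]

lemma frame_operator_sum: "frame_operator A = (\<Sum>i\<in>UNIV. frame_proj A i)"
  by (simp add: frame_operator_def frame_proj_def)

lemma adj_frame_proj [simp]: "adj (frame_proj A i) = frame_proj A i"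
  for A :: "'a::rc_scalar^'d^'r^'n"
  by (simp add: frame_proj_def adj_mul)

lemma FFP_has_real_derivative:
  fixes A :: "real \<Rightarrow> 'a::rc_scalar^'d^'r^'n"
  assumes "(A has_vector_derivative A') (at t within T)"
  shows "((\<lambda>t. FFP (A t)) has_real_derivative
    (\<chi> i. 4 *\<^sub>R (A t $ i ** frame_operator (A t))) \<bullet> A') (at t within T)"
proof -
  let ?S = "frame_operator (A t)"
  let ?S' = "\<Sum>i\<in>UNIV. adj (A t $ i) ** (A' $ i) + adj (A' $ i) ** (A t $ i)"
  have S: "((\<lambda>t. frame_operator (A t)) has_vector_derivative ?S') (at t within T)"
    unfolding frame_operator_def
    by (intro has_vector_derivative_sum matrix_mult_has_vector_derivative
        adj_has_vector_derivative nth_has_vector_derivative assms)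
  have 1: "?S \<bullet> (adj (A t $ i) ** (A' $ i)) = (A t $ i ** ?S) \<bullet> (A' $ i)" for i
    using inner_mat_mult_left[of "adj (A t $ i)" "A' $ i" ?S] by (simp add: inner_commute)
  have 2: "?S \<bullet> (adj (A' $ i) ** (A t $ i)) = (A t $ i ** ?S) \<bullet> (A' $ i)" for i
    using inner_adj[of ?S "adj (A' $ i) ** (A t $ i)"] 1 by (simp add: adj_mul)
  have "?S \<bullet> ?S' + ?S' \<bullet> ?S = (\<chi> i. 4 *\<^sub>R (A t $ i ** ?S)) \<bullet> A'"
    by (simp add: inner_commute[of _ ?S] inner_sum_right inner_add_right 1 2 inner_vec_def[of _ A']
        sum_distrib_left flip: sum.distrib)
  with bounded_bilinear.has_vector_derivative[OF bounded_bilinear_inner S S] show ?thesis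
    by (simp add: FFP_def power2_norm_eq_inner has_real_derivative_iff_has_vector_derivative)
qed

text \<open>On \<open>row_frames\<close> this is \<open>4 A\<^sub>i S (1 - P\<^sub>i)\<close>, the Euclidean gradient without its component normal to
the constraint. The commutator, which is skew-adjoint at every tuple, shows that the flow
preserves the constraint.\<close>

definition grad_FFP :: "'a::rc_scalar^'d^'r^'n \<Rightarrow> 'a^'d^'r^'n" where
  "grad_FFP A = (\<chi> i. 4 *\<^sub>R (A $ i ** (frame_proj A i ** frame_operator A - frame_operator A ** frame_proj A i)))"

lemma row_frames_mult_proj: "A \<in> row_frames R \<Longrightarrow> A $ i ** frame_proj A i = A $ i"
  by (simp add: frame_proj_def matrix_mul_assoc row_framesD coord_proj_mult_rows(2))

lemma grad_FFP_nth:
  assumes "A \<in> row_frames R"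
  shows "grad_FFP A $ i = 4 *\<^sub>R (A $ i ** frame_operator A
    - (A $ i ** frame_operator A ** adj (A $ i)) ** A $ i)"
  using row_frames_mult_proj[OF assms, of i]
  by (simp add: grad_FFP_def matrix_bilin matrix_mul_assoc)
    (simp add: frame_proj_def matrix_mul_assoc)

text \<open>The vectors \<open>H ** A\<close> are the normal vectors of the manifold of matrices with orthonormal rows.\<close>

lemma hermitian_mult_inner_tangent:
  fixes A v :: "'a::rc_scalar^'d^'r"
  assumes "adj H = H" and "A ** adj v + v ** adj A = 0"
  shows "(H ** A) \<bullet> v = 0"
proof -
  have "(H ** A) \<bullet> v = H \<bullet> (v ** adj A)" by (rule inner_mat_mult_right)
  moreover have "H \<bullet> (v ** adj A) = H \<bullet> (A ** adj v)"
    using inner_adj[of H "v ** adj A"] assms(1) by (simp add: adj_mul)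
  moreover have "H \<bullet> (A ** adj v) + H \<bullet> (v ** adj A) = 0"
    unfolding inner_add_right[symmetric] assms(2) by simp
  ultimately show ?thesis by simp
qed

lemma grad_FFP_inner:
  assumes "A \<in> row_frames R" and "\<And>i. A $ i ** adj (v $ i) + v $ i ** adj (A $ i) = 0"
  shows "(\<chi> i. 4 *\<^sub>R (A $ i ** frame_operator A)) \<bullet> v = grad_FFP A \<bullet> v"
proof -
  have "((A $ i ** frame_operator A ** adj (A $ i)) ** A $ i) \<bullet> (v $ i) = 0" for i
    by (rule hermitian_mult_inner_tangent[OF _ assms(2)]) (simp add: adj_mul matrix_mul_assoc)
  then show ?thesis
    by (simp add: inner_vec_def[of _ v] grad_FFP_nth[OF assms(1)] inner_diff_left del: inner_real_def)
qed

section \<open>The gradient flow\<close>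

text \<open>Boundedness is recorded with the Lipschitz condition because both together are preserved by
bilinear operations, hence hold for polynomial maps on balls.\<close>

definition lip_bounded_on :: "'b::real_normed_vector set \<Rightarrow> ('b \<Rightarrow> 'c::real_normed_vector) \<Rightarrow> bool" where
  "lip_bounded_on X f \<longleftrightarrow>
     (\<exists>L\<ge>0. \<forall>x\<in>X. norm (f x) \<le> L \<and> (\<forall>y\<in>X. norm (f x - f y) \<le> L * norm (x - y)))"

lemma lip_bounded_on_linear:
  assumes f: "bounded_linear f" and g: "lip_bounded_on X g"
  shows "lip_bounded_on X (\<lambda>x. f (g x))"
proof -
  obtain K where K: "K \<ge> 0" "\<And>x. norm (f x) \<le> norm x * K"
    using bounded_linear.nonneg_bounded[OF f] by blast
  obtain L where L: "L \<ge> 0" "\<And>x. x \<in> X \<Longrightarrow> norm (g x) \<le> L"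
    "\<And>x y. x \<in> X \<Longrightarrow> y \<in> X \<Longrightarrow> norm (g x - g y) \<le> L * norm (x - y)"
    using g unfolding lip_bounded_on_def by blast
  have "norm (f (g x)) \<le> L * K" if "x \<in> X" for x
    using K(2)[of "g x"] mult_right_mono[OF L(2)[OF that] K(1)] by linarith
  moreover have "norm (f (g x) - f (g y)) \<le> (L * K) * norm (x - y)" if "x \<in> X" "y \<in> X" for x y
    using K(2)[of "g x - g y"] mult_right_mono[OF L(3)[OF that] K(1)]
    by (simp add: linear_diff[OF bounded_linear.linear[OF f]] mult_ac)
  ultimately show ?thesis unfolding lip_bounded_on_def using K L by (intro exI[of _ "L * K"]) auto
qed

lemma lip_bounded_on_add:
  assumes "lip_bounded_on X f" "lip_bounded_on X g"
  shows "lip_bounded_on X (\<lambda>x. f x + g x)"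
proof -
  obtain L where L: "L \<ge> 0" "\<And>x. x \<in> X \<Longrightarrow> norm (f x) \<le> L"
    "\<And>x y. x \<in> X \<Longrightarrow> y \<in> X \<Longrightarrow> norm (f x - f y) \<le> L * norm (x - y)"
    using assms(1) unfolding lip_bounded_on_def by blast
  obtain K where K: "K \<ge> 0" "\<And>x. x \<in> X \<Longrightarrow> norm (g x) \<le> K"
    "\<And>x y. x \<in> X \<Longrightarrow> y \<in> X \<Longrightarrow> norm (g x - g y) \<le> K * norm (x - y)"
    using assms(2) unfolding lip_bounded_on_def by blast
  have "norm (f x + g x) \<le> L + K" if "x \<in> X" for x
    using norm_triangle_ineq[of "f x" "g x"] L(2) K(2) that by fastforce
  moreover have "norm (f x + g x - (f y + g y)) \<le> (L + K) * norm (x - y)" if "x \<in> X" "y \<in> X" for x y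
  proof -
    have "norm (f x + g x - (f y + g y)) \<le> norm (f x - f y) + norm (g x - g y)"
      using norm_triangle_ineq[of "f x - f y" "g x - g y"] by (simp add: algebra_simps)
    also have "\<dots> \<le> L * norm (x - y) + K * norm (x - y)"
      using L(3) K(3) that by (intro add_mono) auto
    finally show ?thesis by (simp add: algebra_simps)
  qed
  ultimately show ?thesis unfolding lip_bounded_on_def using K L by (intro exI[of _ "L + K"]) auto
qed

lemma lip_bounded_on_const: "lip_bounded_on X (\<lambda>x. c)"
  unfolding lip_bounded_on_def by (intro exI[of _ "norm c"]) auto

lemma lip_bounded_on_sum:
  assumes "\<And>i. i \<in> I \<Longrightarrow> lip_bounded_on X (f i)"
  shows "lip_bounded_on X (\<lambda>x. \<Sum>i\<in>I. f i x)"
  using assms by (induction I rule: infinite_finite_induct)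
    (auto intro: lip_bounded_on_add lip_bounded_on_const)

lemma lip_bounded_on_bilinear:
  assumes b: "bounded_bilinear b" and "lip_bounded_on X f" "lip_bounded_on X g"
  shows "lip_bounded_on X (\<lambda>x. b (f x) (g x))"
proof -
  obtain M where M: "M \<ge> 0" "\<And>x y. norm (b x y) \<le> norm x * norm y * M"
    using bounded_bilinear.nonneg_bounded[OF b] by blast
  obtain L where L: "L \<ge> 0" "\<And>x. x \<in> X \<Longrightarrow> norm (f x) \<le> L"
    "\<And>x y. x \<in> X \<Longrightarrow> y \<in> X \<Longrightarrow> norm (f x - f y) \<le> L * norm (x - y)"
    using assms(2) unfolding lip_bounded_on_def by blast
  obtain K where K: "K \<ge> 0" "\<And>x. x \<in> X \<Longrightarrow> norm (g x) \<le> K"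
    "\<And>x y. x \<in> X \<Longrightarrow> y \<in> X \<Longrightarrow> norm (g x - g y) \<le> K * norm (x - y)"
    using assms(3) unfolding lip_bounded_on_def by blast
  have "norm (b (f x) (g x)) \<le> 2 * L * K * M" if "x \<in> X" for x
  proof -
    have "norm (b (f x) (g x)) \<le> norm (f x) * norm (g x) * M" by (rule M)
    also have "\<dots> \<le> L * K * M" using L K M that by (intro mult_mono mult_nonneg_nonneg) auto
    also have "\<dots> \<le> 2 * L * K * M" using L K M by simp
    finally show ?thesis .
  qed
  moreover have "norm (b (f x) (g x) - b (f y) (g y)) \<le> 2 * L * K * M * norm (x - y)"
    if "x \<in> X" "y \<in> X" for x y
  proof -
    have "b (f x) (g x) - b (f y) (g y) = b (f x - f y) (g x) + b (f y) (g x - g y)"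
      by (simp add: bounded_bilinear.diff_left[OF b] bounded_bilinear.diff_right[OF b])
    then have "norm (b (f x) (g x) - b (f y) (g y)) \<le> norm (b (f x - f y) (g x)) + norm (b (f y) (g x - g y))"
      by (simp add: norm_triangle_ineq)
    also have "\<dots> \<le> norm (f x - f y) * norm (g x) * M + norm (f y) * norm (g x - g y) * M"
      by (intro add_mono M)
    also have "\<dots> \<le> (L * norm (x - y)) * K * M + L * (K * norm (x - y)) * M"
      using L K M that by (intro add_mono mult_mono mult_nonneg_nonneg) auto
    finally show ?thesis by (simp add: algebra_simps)
  qed
  ultimately show ?thesis unfolding lip_bounded_on_def using K L M
    by (intro exI[of _ "2 * L * K * M"]) auto
qed

lemma lip_bounded_on_vec:
  fixes f :: "'i::finite \<Rightarrow> 'b::real_normed_vector \<Rightarrow> 'c::real_normed_vector"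
  assumes "\<And>i. lip_bounded_on X (f i)"
  shows "lip_bounded_on X (\<lambda>x. \<chi> i. f i x)"
proof -
  have "\<forall>i. \<exists>L\<ge>0. \<forall>x\<in>X. norm (f i x) \<le> L \<and> (\<forall>y\<in>X. norm (f i x - f i y) \<le> L * norm (x - y))"
    using assms unfolding lip_bounded_on_def by blast
  then obtain L where L: "\<And>i. L i \<ge> 0" "\<And>i x. x \<in> X \<Longrightarrow> norm (f i x) \<le> L i"
    "\<And>i x y. x \<in> X \<Longrightarrow> y \<in> X \<Longrightarrow> norm (f i x - f i y) \<le> L i * norm (x - y)"
    by metis
  have *: "norm v \<le> (\<Sum>i\<in>UNIV. norm (v $ i))" for v :: "'c^'i"
    unfolding norm_vec_def by (rule L2_set_le_sum) simp
  show ?thesis unfolding lip_bounded_on_def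
  proof (intro exI[of _ "sum L UNIV"] conjI ballI)
    show "sum L UNIV \<ge> 0" using L by (simp add: sum_nonneg)
    fix x assume x: "x \<in> X"
    show "norm (\<chi> i. f i x) \<le> sum L UNIV"
      by (rule *[THEN order_trans]) (simp add: sum_mono L(2) x)
    fix y assume y: "y \<in> X"
    show "norm ((\<chi> i. f i x) - (\<chi> i. f i y)) \<le> sum L UNIV * norm (x - y)"
      by (rule *[THEN order_trans]) (simp add: sum_mono L(3) x y sum_distrib_right)
  qed
qed

text \<open>Composing a locally Lipschitz field with this map makes it globally Lipschitz. The map only rescales its
argument, so a field of the form \<open>A\<^sub>i \<Omega>\<^sub>i\<close> with skew-adjoint \<open>\<Omega>\<^sub>i\<close> keeps that form up to a positive factor.\<close>

definition radial_cutoff :: "real \<Rightarrow> 'b::real_normed_vector \<Rightarrow> 'b" where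
  "radial_cutoff r x = (1 / max 1 (norm x / r)) *\<^sub>R x"

lemma radial_cutoff_id: "r > 0 \<Longrightarrow> norm x \<le> r \<Longrightarrow> radial_cutoff r x = x"
  by (simp add: radial_cutoff_def max_def divide_simps)

lemma norm_radial_cutoff: "r > 0 \<Longrightarrow> norm (radial_cutoff r x) \<le> r"
  by (auto simp: radial_cutoff_def max_def divide_simps mult_ac)

lemma radial_cutoff_lipschitz:
  assumes r: "r > 0"
  shows "norm (radial_cutoff r x - radial_cutoff r y) \<le> 2 * norm (x - y)"
proof -
  define a b where "a = max 1 (norm x / r)" and "b = max 1 (norm y / r)"
  have ab: "a \<ge> 1" "b \<ge> 1" by (auto simp: a_def b_def)
  have "\<bar>norm x / r - norm y / r\<bar> \<le> norm (x - y) / r"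
    using r norm_triangle_ineq3[of x y] by (simp add: divide_right_mono flip: diff_divide_distrib)
  then have abd: "\<bar>b - a\<bar> \<le> norm (x - y) / r"
    by (auto simp: a_def b_def max_def)
  have yb: "norm y / b \<le> r"
  proof -
    have "norm y / r \<le> b" by (simp add: b_def)
    then show ?thesis using r ab by (simp add: divide_simps mult.commute)
  qed
  have eq: "radial_cutoff r x - radial_cutoff r y
      = (1 / a) *\<^sub>R (x - y) + ((b - a) / a) *\<^sub>R ((1 / b) *\<^sub>R y)"
    using ab by (simp add: radial_cutoff_def a_def[symmetric] b_def[symmetric] algebra_simps diff_divide_distrib)
  have "norm (radial_cutoff r x - radial_cutoff r y)
      \<le> norm ((1 / a) *\<^sub>R (x - y)) + norm (((b - a) / a) *\<^sub>R ((1 / b) *\<^sub>R y))"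
    unfolding eq by (rule norm_triangle_ineq)
  also have "\<dots> = norm (x - y) / a + (\<bar>b - a\<bar> / a) * (norm y / b)"
    using ab by simp
  also have "\<dots> \<le> norm (x - y) / 1 + (norm (x - y) / r) / 1 * r"
    using ab abd yb r by (intro add_mono mult_mono frac_le) auto
  also have "\<dots> = 2 * norm (x - y)" using r by simp
  finally show ?thesis .
qed

lemma lip_bounded_on_grad_FFP:
  "lip_bounded_on (cball 0 r) (\<lambda>A. - grad_FFP (A :: 'a::rc_scalar^'d^'r^'n))"
proof -
  let ?X = "cball 0 r :: ('a^'d^'r^'n) set"
  have "lip_bounded_on ?X (\<lambda>A. A)"
    unfolding lip_bounded_on_def by (intro exI[of _ "max 1 \<bar>r\<bar>"]) (auto simp: mult_le_cancel_right1)
  then have nth: "lip_bounded_on ?X (\<lambda>A. A $ i)" for i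
    by (rule lip_bounded_on_linear[OF bounded_linear_vec_nth])
  note mult = lip_bounded_on_bilinear[OF bounded_bilinear_matrix_mult]
  have proj: "lip_bounded_on ?X (\<lambda>A. frame_proj A i)" for i
    unfolding frame_proj_def by (intro mult lip_bounded_on_linear[OF bounded_linear_adj] nth)
  have S: "lip_bounded_on ?X frame_operator"
    unfolding frame_operator_sum by (intro lip_bounded_on_sum proj)
  have neg: "lip_bounded_on X f \<Longrightarrow> lip_bounded_on X (\<lambda>x. - f x)" for X :: "('a^'d^'r^'n) set" and f :: "_ \<Rightarrow> 'c::real_normed_vector"
    by (rule lip_bounded_on_linear[OF bounded_linear_minus[OF bounded_linear_ident]])
  show ?thesis
    unfolding grad_FFP_def diff_conv_add_uminus
    by (intro neg lip_bounded_on_vec lip_bounded_on_linear[OF bounded_linear_scaleR_right]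
        mult lip_bounded_on_add nth S proj)
qed

text \<open>Gronwall's argument in both time directions: \<open>u t * exp (C * t)\<close> increases and
\<open>u t * exp (- (C * t))\<close> decreases.\<close>

lemma positive_of_log_derivative_bound:
  fixes u :: "real \<Rightarrow> real"
  assumes der: "\<And>t. (u has_real_derivative u' t) (at t)" and bd: "\<And>t. \<bar>u' t\<bar> \<le> C * u t"
    and pos: "u 0 > 0"
  shows "u t > 0"
proof (cases "t \<ge> 0")
  case True
  have "u 0 * exp (C * 0) \<le> u t * exp (C * t)"
  proof (rule DERIV_nonneg_imp_nondecreasing[OF True])
    fix s
    have "((\<lambda>s. u s * exp (C * s)) has_real_derivative (u' s + C * u s) * exp (C * s)) (at s)"
      by (auto intro!: derivative_eq_intros der simp: algebra_simps)
    moreover have "(u' s + C * u s) * exp (C * s) \<ge> 0"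
      using bd[of s] by (intro mult_nonneg_nonneg) auto
    ultimately show "\<exists>y. ((\<lambda>s. u s * exp (C * s)) has_real_derivative y) (at s) \<and> 0 \<le> y" by blast
  qed
  then have "0 < u t * exp (C * t)" using pos by simp
  then show ?thesis by (simp add: zero_less_mult_iff)
next
  case False
  then have "t \<le> 0" by simp
  have "u t * exp (- (C * t)) \<ge> u 0 * exp (- (C * 0))"
  proof (rule DERIV_nonpos_imp_nonincreasing[OF \<open>t \<le> 0\<close>])
    fix s
    have "((\<lambda>s. u s * exp (- (C * s))) has_real_derivative (u' s - C * u s) * exp (- (C * s))) (at s)"
      by (auto intro!: derivative_eq_intros der simp: algebra_simps)
    moreover have "(u' s - C * u s) * exp (- (C * s)) \<le> 0"
      using bd[of s] by (intro mult_nonpos_nonneg) auto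
    ultimately show "\<exists>y. ((\<lambda>s. u s * exp (- (C * s))) has_real_derivative y) (at s) \<and> y \<le> 0" by blast
  qed
  then have "0 < u t * exp (- (C * t))" using pos by simp
  then show ?thesis by (simp add: zero_less_mult_iff)
qed

definition flow_generator :: "'a::rc_scalar^'d^'r^'n \<Rightarrow> 'n \<Rightarrow> 'a^'d^'d" where
  "flow_generator A i = 4 *\<^sub>R (frame_operator A ** frame_proj A i - frame_proj A i ** frame_operator A)"

lemma minus_grad_FFP_nth: "(- grad_FFP A) $ i = A $ i ** flow_generator A i"
  for A :: "'a::rc_scalar^'d^'r^'n"
  by (simp add: grad_FFP_def flow_generator_def matrix_bilin flip: scaleR_minus_right)

lemma adj_flow_generator: "adj (flow_generator A i) = - flow_generator A i"
  for A :: "'a::rc_scalar^'d^'r^'n"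
  by (simp add: flow_generator_def adj_scaleR adj_diff adj_mul flip: scaleR_minus_right)

lemma norm_tuple_squared: "(norm A)\<^sup>2 = (\<Sum>i\<in>UNIV. re_part (trace (A $ i ** adj (A $ i))))"
  for A :: "'a::rc_scalar^'d^'r^'n"
  by (simp add: power2_norm_eq_inner inner_vec_def[of A] matrix_inner_trace)

lemma norm_frame_operator_le: "norm (frame_operator A) \<le> (norm A)\<^sup>2"
  for A :: "'a::rc_scalar^'d^'r^'n"
proof -
  have "norm (frame_operator A) \<le> (\<Sum>i\<in>UNIV. norm (A $ i) * norm (A $ i))"
    unfolding frame_operator_def
    by (rule norm_sum[THEN order_trans], rule sum_mono, rule norm_matrix_mult_le[THEN order_trans]) simp
  also have "\<dots> = (norm A)\<^sup>2"
    by (simp add: norm_vec_def L2_set_def sum_nonneg power2_eq_square)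
  finally show ?thesis .
qed

text \<open>The truncated field is globally Lipschitz, and along its solutions \<open>A\<^sub>i A\<^sub>i\<^sup>*\<close> is constant. Hence the norm is
constant, and the solution never leaves the ball on which the truncation is the identity.\<close>

lemma global_gradient_flow_row_frames:
  fixes A0 :: "'a::rc_scalar^'d^'r^'n"
  obtains A where "A 0 = A0" "\<And>t. (A has_vector_derivative - grad_FFP (A t)) (at t)"
    "\<And>t i. A t $ i ** adj (A t $ i) = A0 $ i ** adj (A0 $ i)" "\<And>t. norm (A t) = norm A0"
proof -
  \<comment> \<open>One is added to have a positive radius for the zero tuple, too.\<close>
  define r where "r = norm A0 + 1"
  have r: "r > 0" by (simp add: r_def add_nonneg_pos)
  define F where "F = (\<lambda>(t::real) A. - grad_FFP (radial_cutoff r (A :: 'a^'d^'r^'n)))"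
  obtain L where L: "L \<ge> 0" "\<And>x. x \<in> cball 0 r \<Longrightarrow> norm (- grad_FFP (x :: 'a^'d^'r^'n)) \<le> L"
    "\<And>x y. x \<in> cball 0 r \<Longrightarrow> y \<in> cball 0 r \<Longrightarrow> norm (- grad_FFP x - - grad_FFP (y :: 'a^'d^'r^'n)) \<le> L * norm (x - y)"
    using lip_bounded_on_grad_FFP[of r] unfolding lip_bounded_on_def by blast
  have cut: "radial_cutoff r x \<in> cball 0 r" for x :: "'a^'d^'r^'n"
    using norm_radial_cutoff[OF r] by simp
  have lip: "norm (F t x - F t y) \<le> (L * 2) * norm (x - y)" for t x y
  proof -
    have "norm (F t x - F t y) \<le> L * norm (radial_cutoff r x - radial_cutoff r y)"
      unfolding F_def by (rule L(3)[OF cut cut])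
    also have "\<dots> \<le> L * (2 * norm (x - y))"
      by (intro mult_left_mono radial_cutoff_lipschitz[OF r] L(1))
    finally show ?thesis by simp
  qed
  have "continuous_on UNIV (F 0)"
  proof (rule lipschitz_on_continuous_on[of "L * 2"], rule lipschitz_onI)
    show "dist (F 0 x) (F 0 y) \<le> L * 2 * dist x y" for x y using lip by (simp add: dist_norm)
  qed (use L in auto)
  then have "continuous_on UNIV (\<lambda>p. F 0 (snd p :: 'a^'d^'r^'n))"
    by (rule continuous_on_compose2) (auto intro: continuous_intros)
  then have cont: "continuous_on UNIV (\<lambda>p. F (fst p) (snd p))"
    by (simp add: F_def)
  have bd: "norm (F t 0) \<le> L" for t unfolding F_def by (rule L(2)[OF cut])
  obtain A where A0: "A 0 = A0" and A: "\<And>t. (A has_vector_derivative F t (A t)) (at t)"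
    using global_solution[OF cont lip bd] by blast
  have const: "A t $ i ** adj (A t $ i) = A0 $ i ** adj (A0 $ i)" for t i
  proof -
    have "((\<lambda>t. A t $ i ** adj (A t $ i)) has_vector_derivative 0) (at t)" for t
    proof -
      define s where "s = 1 / max 1 (norm (A t) / r)"
      define W where "W = flow_generator (radial_cutoff r (A t)) i"
      have F: "F t (A t) $ i = s *\<^sub>R (A t $ i ** W)"
        unfolding F_def minus_grad_FFP_nth by (simp add: W_def s_def radial_cutoff_def matrix_bilin)
      have "A t $ i ** adj (F t (A t) $ i) + F t (A t) $ i ** adj (A t $ i) = 0"
        unfolding F
        by (simp add: adj_scaleR adj_mul matrix_bilin W_def adj_flow_generator matrix_mul_assoc
            flip: scaleR_add_right)
      then show ?thesis
        using matrix_mult_has_vector_derivative[OF nth_has_vector_derivative[OF A[of t], of i]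
            adj_has_vector_derivative[OF nth_has_vector_derivative[OF A[of t], of i]]] by simp
    qed
    then obtain c where "\<And>t. A t $ i ** adj (A t $ i) = c"
      using has_vector_derivative_zero_constant[of UNIV "\<lambda>t. A t $ i ** adj (A t $ i)"] by auto
    then show ?thesis using A0 by metis
  qed
  have norm: "norm (A t) = norm A0" for t
  proof -
    have "(norm (A t))\<^sup>2 = (norm A0)\<^sup>2"
      unfolding norm_tuple_squared const ..
    then show ?thesis by simp
  qed
  have "(A has_vector_derivative - grad_FFP (A t)) (at t)" for t
  proof -
    have "radial_cutoff r (A t) = A t"
      by (rule radial_cutoff_id[OF r]) (simp add: norm r_def)
    then show "(A has_vector_derivative - grad_FFP (A t)) (at t)"
      using A[of t] by (simp add: F_def)
  qed
  from that[OF A0 this const norm] show thesis .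
qed

lemma inner_frame_operator_bilinear:
  "y \<bullet> (frame_operator A *v x) = (\<Sum>i\<in>UNIV. (A $ i *v y) \<bullet> (A $ i *v x))"
  for A :: "'a::rc_scalar^'d^'r^'n"
proof -
  have "y \<bullet> ((adj B ** B) *v x) = (B *v y) \<bullet> (B *v x)" for B :: "'a^'d^'r"
    by (simp add: inner_matrix_vector[of y "adj B"] flip: matrix_vector_mul_assoc)
  then show ?thesis by (simp add: frame_operator_def matrix_vector_sum_left inner_sum_right)
qed

text \<open>The factor \<open>x \<bullet> S x\<close> on the right, instead of \<open>x \<bullet> x\<close>, is what makes the logarithmic derivative of
\<open>x \<bullet> S x\<close> bounded along the flow.\<close>

lemma frame_operator_vector_norm_le:
  fixes A :: "'a::rc_scalar^'d^'r^'n"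
  shows "(norm (frame_operator A *v x))\<^sup>2 \<le> (norm A)\<^sup>2 * (x \<bullet> (frame_operator A *v x))"
proof -
  let ?S = "frame_operator A"
  let ?y = "?S *v x"
  have "(norm ?y)\<^sup>2 = (\<Sum>i\<in>UNIV. (A $ i *v ?y) \<bullet> (A $ i *v x))"
    unfolding power2_norm_eq_inner by (rule inner_frame_operator_bilinear)
  also have "\<dots> \<le> (\<Sum>i\<in>UNIV. (norm (A $ i) * norm ?y) * norm (A $ i *v x))"
    by (intro sum_mono norm_cauchy_schwarz[THEN order_trans] mult_right_mono norm_matrix_vector_le) simp
  also have "\<dots> = norm ?y * (\<Sum>i\<in>UNIV. norm (A $ i) * norm (A $ i *v x))"
    by (simp add: sum_distrib_left mult_ac)
  finally have "norm ?y * norm ?y \<le> norm ?y * (\<Sum>i\<in>UNIV. norm (A $ i) * norm (A $ i *v x))"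
    by (simp add: power2_eq_square)
  then have "norm ?y \<le> (\<Sum>i\<in>UNIV. norm (A $ i) * norm (A $ i *v x))"
    by (cases "norm ?y = 0") (auto intro: sum_nonneg simp: mult_le_cancel_left)
  also have "\<dots> \<le> L2_set (\<lambda>i. norm (A $ i)) UNIV * L2_set (\<lambda>i. norm (A $ i *v x)) UNIV"
    using L2_set_mult_ineq[of "\<lambda>i. norm (A $ i)" "\<lambda>i. norm (A $ i *v x)" UNIV] by simp
  finally have "(norm ?y)\<^sup>2 \<le> (norm A * L2_set (\<lambda>i. norm (A $ i *v x)) UNIV)\<^sup>2"
    by (intro power_mono) (auto simp: norm_vec_def)
  then show ?thesis
    by (simp add: power_mult_distrib inner_frame_operator L2_set_def sum_nonneg)
qed

lemma fusion_frames_row_frames: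
  assumes "\<And>i. card (R i) = k i" and "A \<in> fusion_frames k R"
  shows "A \<in> row_frames R"
  using iffD1[OF fusion_frames_iff[OF assms(1)] assms(2)] by (rule conjunct1)

text \<open>For fixed \<open>x\<close> the derivative of \<open>u t = x \<bullet> S x = (\<Sum>i. (norm (A\<^sub>i x))\<^sup>2)\<close> is
\<open>8 (\<Sum>i. A\<^sub>i x \<bullet> H\<^sub>i A\<^sub>i x) - 8 (norm (S x))\<^sup>2\<close>, and both terms are bounded by multiples of \<open>u t\<close>. So \<open>u\<close>
stays positive.\<close>

theorem global_gradient_flow:
  fixes A0 :: "'a::rc_scalar^'d^'r^'n"
  assumes k: "\<And>i. card (R i) = k i" and A0: "A0 \<in> fusion_frames k R"
  obtains A where "A 0 = A0" "\<And>t. (A has_vector_derivative - grad_FFP (A t)) (at t)"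
    "\<And>t. A t \<in> fusion_frames k R"
proof -
  obtain A where A: "A 0 = A0" "\<And>t. (A has_vector_derivative - grad_FFP (A t)) (at t)"
    and const: "\<And>t i. A t $ i ** adj (A t $ i) = A0 $ i ** adj (A0 $ i)"
    and norm: "\<And>t. norm (A t) = norm A0"
    by (rule global_gradient_flow_row_frames[of A0], rule that; assumption)
  have "A0 \<in> row_frames R" by (rule fusion_frames_row_frames[OF k A0])
  then have rf: "A t \<in> row_frames R" for t
    unfolding row_frames_def mem_Collect_eq const .
  have "x \<bullet> (frame_operator (A t) *v x) > 0" if x: "x \<noteq> 0" for x t
  proof -
    define N where "N = (norm A0)\<^sup>2"
    have N: "N \<ge> 0" by (simp add: N_def)
    define u where "u = (\<lambda>t. x \<bullet> (frame_operator (A t) *v x))"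
    define H where "H = (\<lambda>t i. A t $ i ** frame_operator (A t) ** adj (A t $ i))"
    define u' where "u' = (\<lambda>t. \<Sum>i\<in>UNIV. 2 * ((A t $ i *v x) \<bullet> ((- grad_FFP (A t) $ i) *v x)))"
    have u_nonneg: "u t \<ge> 0" for t unfolding u_def inner_frame_operator by (simp add: sum_nonneg)
    have der: "(u has_real_derivative u' t) (at t)" for t
    proof -
      have "((\<lambda>t. (A t $ i *v x) \<bullet> (A t $ i *v x)) has_vector_derivative
         2 * ((A t $ i *v x) \<bullet> ((- grad_FFP (A t) $ i) *v x))) (at t)" for i
      proof -
        have "((\<lambda>t. A t $ i *v x) has_vector_derivative (- grad_FFP (A t) $ i) *v x) (at t)"
          using bounded_linear.has_vector_derivative[OF bounded_bilinear.bounded_linear_left[OF bounded_bilinear_matrix_vector]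
              nth_has_vector_derivative[OF A(2)]] by simp
        from bounded_bilinear.has_vector_derivative[OF bounded_bilinear_inner this this]
        show ?thesis by (simp add: inner_commute)
      qed
      then show ?thesis
        unfolding u_def u'_def inner_frame_operator power2_norm_eq_inner has_real_derivative_iff_has_vector_derivative
        by (intro has_vector_derivative_sum)
    qed
    have bd: "\<bar>u' t\<bar> \<le> (8 * N + 8 * N\<^sup>2) * u t" for t
    proof -
      let ?S = "frame_operator (A t)"
      have 1: "(A t $ i *v x) \<bullet> ((- grad_FFP (A t) $ i) *v x)
          = 4 * ((A t $ i *v x) \<bullet> (H t i *v (A t $ i *v x))) - 4 * ((A t $ i *v x) \<bullet> (A t $ i *v (?S *v x)))" for i
      proof -
        have "(- grad_FFP (A t) $ i) *v x = 4 *\<^sub>R (H t i *v (A t $ i *v x)) - 4 *\<^sub>R (A t $ i *v (?S *v x))"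
          unfolding vector_uminus_component grad_FFP_nth[OF rf]
          by (simp add: H_def bounded_bilinear.diff_left[OF bounded_bilinear_matrix_vector]
              bounded_bilinear.minus_left[OF bounded_bilinear_matrix_vector]
              bounded_bilinear.scaleR_left[OF bounded_bilinear_matrix_vector] matrix_vector_mul_assoc
              scaleR_diff_right)
        then show ?thesis by (simp add: inner_diff_right)
      qed
      have 2: "(\<Sum>i\<in>UNIV. (A t $ i *v x) \<bullet> (A t $ i *v (?S *v x))) = (norm (?S *v x))\<^sup>2"
        unfolding power2_norm_eq_inner inner_frame_operator_bilinear
        by (intro sum.cong refl) (rule inner_commute)
      have 3: "(norm (?S *v x))\<^sup>2 \<le> N * u t"
        using frame_operator_vector_norm_le[of "A t" x] by (simp add: N_def norm u_def)
      have 4: "\<bar>\<Sum>i\<in>UNIV. (A t $ i *v x) \<bullet> (H t i *v (A t $ i *v x))\<bar> \<le> N\<^sup>2 * u t"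
      proof -
        have nH: "norm (H t i) \<le> N\<^sup>2" for i
        proof -
          have nA: "norm (A t $ i) \<le> norm A0" using Finite_Cartesian_Product.norm_nth_le[of "A t" i] norm by simp
          have nS: "norm ?S \<le> N" using norm_frame_operator_le[of "A t"] by (simp add: norm N_def)
          have "norm (H t i) \<le> norm (A t $ i) * norm ?S * norm (A t $ i)"
            unfolding H_def
            by (rule norm_matrix_mult_le[THEN order_trans])
              (simp add: mult_right_mono norm_matrix_mult_le)
          also have "\<dots> \<le> norm A0 * N * norm A0"
            using nA nS N by (intro mult_mono mult_nonneg_nonneg) auto
          finally show ?thesis by (simp add: N_def power2_eq_square mult_ac)
        qed
        have "\<bar>\<Sum>i\<in>UNIV. (A t $ i *v x) \<bullet> (H t i *v (A t $ i *v x))\<bar>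
            \<le> (\<Sum>i\<in>UNIV. N\<^sup>2 * (norm (A t $ i *v x))\<^sup>2)"
        proof (rule sum_abs[THEN order_trans], rule sum_mono)
          fix i
          have "\<bar>(A t $ i *v x) \<bullet> (H t i *v (A t $ i *v x))\<bar> \<le> norm (A t $ i *v x) * norm (H t i *v (A t $ i *v x))"
            by (rule Cauchy_Schwarz_ineq2)
          also have "\<dots> \<le> norm (A t $ i *v x) * (N\<^sup>2 * norm (A t $ i *v x))"
            by (intro mult_left_mono norm_matrix_vector_le[THEN order_trans] mult_right_mono nH) auto
          finally show "\<bar>(A t $ i *v x) \<bullet> (H t i *v (A t $ i *v x))\<bar> \<le> N\<^sup>2 * (norm (A t $ i *v x))\<^sup>2"
            by (simp add: power2_eq_square mult_ac)
        qed
        then show ?thesis by (simp add: u_def inner_frame_operator sum_distrib_left)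
      qed
      have "u' t = 8 * (\<Sum>i\<in>UNIV. (A t $ i *v x) \<bullet> (H t i *v (A t $ i *v x))) - 8 * (norm (?S *v x))\<^sup>2"
        unfolding u'_def 1 2[symmetric] by (simp add: sum_subtractf sum_distrib_left)
      moreover have "(8 * N + 8 * N\<^sup>2) * u t = 8 * (N * u t) + 8 * (N\<^sup>2 * u t)" by (simp add: algebra_simps)
      moreover have "(norm (?S *v x))\<^sup>2 \<ge> 0" by simp
      ultimately show ?thesis using 3 4 by linarith
    qed
    have "u 0 > 0"
      using iffD1[OF fusion_frames_iff[OF k] A0] x by (simp add: u_def A(1))
    from positive_of_log_derivative_bound[OF der bd this, of t] show ?thesis by (simp add: u_def)
  qed
  then have "A t \<in> fusion_frames k R" for t
    using rf by (intro iffD2[OF fusion_frames_iff[OF k]] conjI allI impI)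
  from that[OF A this] show thesis .
qed

text \<open>The time-reversed flow is a curve with velocity \<open>grad_FFP A\<close>. Two gradients are tangent vectors with
the same inner products with all tangent vectors, in particular with each other, so they are equal.\<close>

theorem riemannian_gradient_FFP:
  fixes A :: "'a::rc_scalar^'d^'r^'n"
  assumes k: "\<And>i. card (R i) = k i" and A: "A \<in> fusion_frames k R"
  shows "riemannian_gradient (fusion_frames k R) FFP A = grad_FFP A"
proof -
  let ?M = "fusion_frames k R :: ('a^'d^'r^'n) set"
  have rf: "B \<in> row_frames R" if "B \<in> ?M" for B by (rule fusion_frames_row_frames[OF k that])
  obtain f where f: "f 0 = A" "\<And>t. (f has_vector_derivative - grad_FFP (f t)) (at t)" "\<And>t. f t \<in> ?M"
    using global_gradient_flow[OF k A] by blast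
  have f': "((\<lambda>t. f (- t)) has_vector_derivative grad_FFP (f (- t))) (at t)" for t
    using vector_diff_chain_at[of uminus "-1" t f "- grad_FFP (f (- t))"] f(2)[of "- t"]
    by (simp add: o_def has_vector_derivative_minus[OF has_vector_derivative_id])
  have "(\<lambda>t. f (- t)) differentiable (at t)" for t
    using f'[of t] unfolding has_vector_derivative_def by (rule differentiableI)
  then have "curve_in ?M A (grad_FFP A) (\<lambda>t. f (- t))"
    unfolding curve_in_def using f(1,3) f'[of 0] by (auto intro!: exI[of _ 1])
  then have tan: "grad_FFP A \<in> tangent_space ?M A" by (auto simp: tangent_space_def)
  have der: "((\<lambda>t. FFP (c t)) has_real_derivative grad_FFP A \<bullet> v) (at 0)" if c: "curve_in ?M A v c" for v c
  proof -
    have c0: "c 0 = A" and cv: "(c has_vector_derivative v) (at 0)" using c by (auto simp: curve_in_def)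
    obtain e where e: "e > 0" "\<And>t. t \<in> {-e<..<e} \<Longrightarrow> c t \<in> ?M" using c by (auto simp: curve_in_def)
    have "A $ i ** adj (v $ i) + v $ i ** adj (A $ i) = 0" for i
    proof -
      have 1: "((\<lambda>t. c t $ i ** adj (c t $ i)) has_vector_derivative (A $ i ** adj (v $ i) + v $ i ** adj (A $ i))) (at 0)"
        using matrix_mult_has_vector_derivative[OF nth_has_vector_derivative[OF cv, of i]
            adj_has_vector_derivative[OF nth_has_vector_derivative[OF cv, of i]]] by (simp add: c0)
      have "((\<lambda>t. c t $ i ** adj (c t $ i)) has_vector_derivative 0) (at 0)"
        by (rule has_vector_derivative_transform_within_open[of "\<lambda>_. coord_proj (R i)" _ _ "{-e<..<e}"])
          (use e row_framesD[OF rf[OF e(2)]] in auto)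
      with 1 show ?thesis by (rule vector_derivative_unique_at)
    qed
    from grad_FFP_inner[OF rf[OF A] this] FFP_has_real_derivative[OF cv]
    show ?thesis by (simp add: c0)
  qed
  have grad: "is_riemannian_gradient ?M FFP A (grad_FFP A)"
    using tan der by (auto simp: is_riemannian_gradient_def)
  show ?thesis unfolding riemannian_gradient_def
  proof (rule the_equality)
    show "is_riemannian_gradient ?M FFP A (grad_FFP A)" by (rule grad)
  next
    fix g assume g: "is_riemannian_gradient ?M FFP A g"
    have eq: "g \<bullet> v = grad_FFP A \<bullet> v" if v: "v \<in> tangent_space ?M A" for v
    proof -
      obtain c where "curve_in ?M A v c" using v by (auto simp: tangent_space_def)
      then show ?thesis using g der unfolding is_riemannian_gradient_def by (metis DERIV_unique)
    qed
    have "g \<in> tangent_space ?M A" using g by (simp add: is_riemannian_gradient_def)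
    with eq[OF this] eq[OF tan] have "(g - grad_FFP A) \<bullet> (g - grad_FFP A) = 0"
      by (simp add: inner_diff_left inner_diff_right inner_commute)
    then show "g = grad_FFP A" by simp
  qed
qed

section \<open>A Lojasiewicz inequality near tight frames\<close>

definition diag_matrix :: "('d \<Rightarrow> real) \<Rightarrow> 'a::rc_scalar^'d^'d" where
  "diag_matrix l = (\<chi> i j. if i = j then of_real (l i) else 0)"

lemma diag_matrix_mult_left: "(diag_matrix l ** A) $ i $ j = of_real (l i) * A $ i $ j"
proof -
  have "(\<Sum>k\<in>UNIV. (if i = k then of_real (l i) else 0) * A $ k $ j) = of_real (l i) * A $ i $ j"
    by (simp add: if_distrib[of "\<lambda>x. x * _"] cong: if_cong)
  then show ?thesis by (simp add: matrix_matrix_mult_def diag_matrix_def)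
qed

lemma diag_matrix_mult_right: "(A ** diag_matrix l) $ i $ j = A $ i $ j * of_real (l j)"
proof -
  have "(\<Sum>k\<in>UNIV. A $ i $ k * (if k = j then of_real (l k) else 0)) = A $ i $ j * of_real (l j)"
    by (simp add: if_distrib[of "(*) _"] cong: if_cong)
  then show ?thesis by (simp add: matrix_matrix_mult_def diag_matrix_def)
qed

lemma transpose_orthonormal:
  assumes u: "orthonormal u"
  shows "adj (transpose u) ** transpose u = mat 1" and "transpose u ** adj (transpose u) = mat 1"
proof -
  have "adj (transpose u) ** transpose u = transpose (u ** adj u)"
    by (simp add: vec_eq_iff transpose_def matrix_matrix_mult_def mult.commute)
  then show "adj (transpose u) ** transpose u = mat 1" using u by (simp add: orthonormal_iff)
  then show "transpose u ** adj (transpose u) = mat 1" by (simp add: matrix_left_right_inverse)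
qed

lemma conj_eigenbasis:
  assumes u: "orthonormal u" and Mu: "\<And>j. M *v (u $ j) = of_real (l j) *s (u $ j)"
  shows "adj (transpose u) ** M ** transpose u = diag_matrix l"
proof -
  have "(adj (transpose u) ** M ** transpose u) $ j $ k = herm (M *v (u $ k)) (u $ j)" for j k
    unfolding matrix_mul_assoc[symmetric]
    by (simp add: matrix_matrix_mult_def herm_def matrix_vector_mult_def transpose_def mult.commute)
  then show ?thesis
    by (auto simp: vec_eq_iff Mu herm_scale_left orthonormalD[OF u] diag_matrix_def)
qed

corollary unitary_diagonalization:
  fixes M :: "'a::rc_scalar^'d^'d"
  assumes M: "adj M = M"
  obtains C :: "'a^'d^'d" and l where "adj C ** C = mat 1" "C ** adj C = mat 1"
    "adj C ** M ** C = diag_matrix l"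
proof -
  obtain u l where u: "orthonormal u" and Mu: "\<And>j. M *v (u $ j) = of_real (l j) *s (u $ j)"
    by (rule spectral_theorem[OF M]) blast
  show thesis by (rule that[OF transpose_orthonormal[OF u] conj_eigenbasis[OF u Mu]])
qed

lemma trace_unitary_conj: "C ** adj C = mat 1 \<Longrightarrow> trace (adj C ** X ** C) = trace X"
  for C :: "'a::rc_scalar^'d^'d"
  using trace_mul_sym[of "adj C" "X ** C"]
  by (simp add: matrix_mul_assoc[symmetric])

lemma norm_unitary_conj:
  fixes C :: "'a::rc_scalar^'d^'d"
  assumes "C ** adj C = mat 1"
  shows "norm (adj C ** X ** C) = norm X"
proof -
  have "adj (adj C ** X ** C) ** (adj C ** X ** C) = adj C ** (adj X ** ((C ** adj C) ** X)) ** C"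
    by (simp add: adj_mul matrix_mul_assoc)
  then have "adj (adj C ** X ** C) ** (adj C ** X ** C) = adj C ** (adj X ** X) ** C"
    by (simp add: assms)
  then have "(norm (adj C ** X ** C))\<^sup>2 = (norm X)\<^sup>2"
    unfolding norm_matrix_trace using trace_unitary_conj[OF assms] by metis
  then show ?thesis by simp
qed

lemma of_real_smult: "of_real r *s x = r *\<^sub>R (x :: 'a::rc_scalar^'d)"
  by (simp add: vec_eq_iff) (simp add: scaleR_conv_of_real)

text \<open>An eigenvalue \<open>l\<close> with \<open>\<bar>l - l\<^sup>2\<bar> \<le> \<eta>\<close> has distance at most \<open>2 \<eta>\<close> from \<open>0\<close> or \<open>1\<close>, because one
of the factors \<open>l\<close> and \<open>1 - l\<close> is at least \<open>1/2\<close> in absolute value.\<close>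

lemma near_projector_trace:
  fixes Q :: "'a::rc_scalar^'d^'d"
  assumes Q: "adj Q = Q" and eta: "norm (Q - Q ** Q) \<le> \<eta>"
  obtains m :: int where "\<bar>re_part (trace Q) - of_int m\<bar> \<le> 2 * real CARD('d) * \<eta>"
proof -
  obtain u l where u: "orthonormal u" and Qu: "\<And>j. Q *v (u $ j) = of_real (l j) *s (u $ j)"
    by (rule spectral_theorem[OF Q]) blast
  have nu: "norm (u $ j) = 1" for j
  proof -
    have "of_real ((norm (u $ j))\<^sup>2) = (of_real 1 :: 'a)"
      using herm_self[of "u $ j"] orthonormalD[OF u, of j j] by simp
    then have "(norm (u $ j))\<^sup>2 = 1" by (simp only: of_real_eq_iff)
    then show ?thesis using norm_ge_zero[of "u $ j"] by (auto simp only: power2_eq_1_iff)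
  qed
  have small: "\<bar>l j\<bar> * \<bar>1 - l j\<bar> \<le> \<eta>" for j
  proof -
    have "(Q - Q ** Q) *v (u $ j) = of_real (l j - l j * l j) *s (u $ j)"
      by (simp add: bounded_bilinear.diff_left[OF bounded_bilinear_matrix_vector]
          matrix_vector_mul_assoc[symmetric] Qu vec.scale vec.scale_left_diff_distrib)
    also have "\<dots> = (l j - l j * l j) *\<^sub>R (u $ j)"
      by (rule of_real_smult)
    finally have "\<bar>l j - l j * l j\<bar> = norm ((Q - Q ** Q) *v (u $ j))" by (simp add: nu)
    also have "\<dots> \<le> norm (Q - Q ** Q) * norm (u $ j)" by (rule norm_matrix_vector_le)
    also have "\<dots> \<le> \<eta>" using eta by (simp add: nu)
    finally show ?thesis by (simp add: abs_mult[symmetric] algebra_simps)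
  qed
  define m where "m = (\<Sum>j\<in>UNIV. if l j > 1/2 then 1 else 0 :: int)"
  have close: "\<bar>l j - of_int (if l j > 1/2 then 1 else 0)\<bar> \<le> 2 * \<eta>" for j
  proof (cases "l j > 1/2")
    case True
    then have "(1/2) * \<bar>1 - l j\<bar> \<le> \<bar>l j\<bar> * \<bar>1 - l j\<bar>" by (intro mult_right_mono) auto
    with small[of j] True show ?thesis by (simp add: abs_minus_commute)
  next
    case False
    then have "\<bar>l j\<bar> * (1/2) \<le> \<bar>l j\<bar> * \<bar>1 - l j\<bar>" by (intro mult_left_mono) auto
    with small[of j] False show ?thesis by simp
  qed
  have "re_part (trace Q) = (\<Sum>j\<in>UNIV. l j)"
    by (simp add: trace_orthonormal[OF u] Qu herm_scale_left orthonormalD[OF u] re_part_sum)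
  then have "re_part (trace Q) - of_int m = (\<Sum>j\<in>UNIV. l j - of_int (if l j > 1/2 then 1 else 0))"
    by (simp add: m_def sum_subtractf of_int_sum)
  also have "\<bar>\<dots>\<bar> \<le> (\<Sum>j\<in>(UNIV::'d set). 2 * \<eta>)"
    by (rule sum_abs[THEN order_trans]) (intro sum_mono close)
  finally show thesis by (intro that[of m]) (simp add: mult_ac)
qed

lemma increasing_enumeration:
  fixes f :: "'d::finite \<Rightarrow> real"
  obtains e :: "nat \<Rightarrow> 'd" where "bij_betw e {..<CARD('d)} UNIV"
    "\<And>i j. i \<le> j \<Longrightarrow> j < CARD('d) \<Longrightarrow> f (e i) \<le> f (e j)"
proof -
  obtain xs :: "'d list" where xs: "set xs = UNIV" "distinct xs"
    using finite_distinct_list[of "UNIV :: 'd set"] by auto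
  define ys where "ys = sort_key f xs"
  have ys: "set ys = UNIV" "distinct ys" "sorted (map f ys)" using xs by (auto simp: ys_def)
  then have len: "length ys = CARD('d)" by (metis distinct_card)
  show thesis
  proof (rule that)
    show "bij_betw ((!) ys) {..<CARD('d)} UNIV"
      using ys len by (intro bij_betw_nth) auto
    show "f (ys ! i) \<le> f (ys ! j)" if "i \<le> j" "j < CARD('d)" for i j
      using sorted_nth_mono[OF ys(3) that(1)] that len by simp
  qed
qed

text \<open>The differences of consecutive values in increasing order add up to at least \<open>d * \<delta>\<close>, and there are fewer
than \<open>d\<close> of them.\<close>

lemma spectral_gap:
  fixes f :: "'d::finite \<Rightarrow> real"
  assumes "\<delta> > 0" and "real CARD('d) * \<delta> \<le> f p - f q"
  obtains T where "T \<noteq> {}" "T \<noteq> UNIV" "\<And>j k. j \<in> T \<Longrightarrow> k \<notin> T \<Longrightarrow> f j - f k \<ge> \<delta>"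
proof -
  obtain e where e: "bij_betw e {..<CARD('d)} (UNIV :: 'd set)"
    and mono: "\<And>i j. i \<le> j \<Longrightarrow> j < CARD('d) \<Longrightarrow> f (e i) \<le> f (e j)"
    by (rule increasing_enumeration[of f]) blast
  have surj: "\<exists>i<CARD('d). x = e i" for x
    using e by (metis UNIV_I bij_betw_imp_surj_on imageE lessThan_iff)
  have inj: "i = j" if "e i = e j" "i < CARD('d)" "j < CARD('d)" for i j
    using e that by (auto simp: bij_betw_def inj_on_def)
  have "\<exists>i. Suc i < CARD('d) \<and> f (e (Suc i)) - f (e i) \<ge> \<delta>"
  proof (rule ccontr)
    assume "\<nexists>i. Suc i < CARD('d) \<and> f (e (Suc i)) - f (e i) \<ge> \<delta>"
    then have small: "f (e (Suc i)) - f (e i) < \<delta>" if "Suc i < CARD('d)" for i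
      using that by force
    have le: "f (e i) - f (e 0) \<le> real i * \<delta>" if "i < CARD('d)" for i
      using that
    proof (induction i)
      case (Suc i) with small[of i] show ?case by (simp add: algebra_simps)
    qed simp
    obtain i j where ij: "i < CARD('d)" "p = e i" "j < CARD('d)" "q = e j" using surj by metis
    have "f p - f q \<le> f (e i) - f (e 0)" using mono[of 0 j] ij by simp
    also have "\<dots> \<le> real i * \<delta>" using le ij by simp
    also have "\<dots> < real CARD('d) * \<delta>" using ij assms(1) by simp
    finally show False using assms(2) by simp
  qed
  then obtain i where i: "Suc i < CARD('d)" "f (e (Suc i)) - f (e i) \<ge> \<delta>" by blast
  define T where "T = e ` {Suc i..<CARD('d)}"
  show thesis
  proof (rule that[of T])
    show "T \<noteq> {}" using i by (auto simp: T_def)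
    have "e i \<notin> T" using inj i by (fastforce simp: T_def)
    then show "T \<noteq> UNIV" by blast
    fix x y assume "x \<in> T" "y \<notin> T"
    obtain a where a: "a \<ge> Suc i" "a < CARD('d)" "x = e a" using \<open>x \<in> T\<close> by (auto simp: T_def)
    obtain b where b: "b < CARD('d)" "y = e b" using surj by blast
    then have "b \<le> i" using \<open>y \<notin> T\<close> unfolding T_def by (metis atLeastLessThan_iff imageI not_less_eq_eq)
    then have "f y \<le> f (e i)" using mono[of b i] b i by simp
    moreover have "f (e (Suc i)) \<le> f x" using mono[of "Suc i" a] a by simp
    ultimately show "f x - f y \<ge> \<delta>" using i by linarith
  qed
qed

lemma coord_proj_idem: "coord_proj T ** coord_proj T = (coord_proj T :: 'a::rc_scalar^'r^'r)"
  by (simp add: coord_proj_mult vec_eq_iff) (simp add: coord_proj_def)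

text \<open>The defect of \<open>E ** P ** E\<close> from being idempotent is \<open>X ** adj X\<close> for the off-diagonal block
\<open>X = E ** P ** (mat 1 - E)\<close>, so it is quadratically small.\<close>

lemma compressed_projector_defect:
  fixes P E :: "'a::rc_scalar^'d^'d"
  assumes P: "adj P = P" "P ** P = P" and E: "adj E = E" "E ** E = E"
  shows "norm (E ** P ** E - (E ** P ** E) ** (E ** P ** E)) \<le> (norm (E ** P ** (mat 1 - E)))\<^sup>2"
proof -
  let ?X = "E ** P ** (mat 1 - E)"
  have aX: "adj ?X = (mat 1 - E) ** P ** E"
    by (simp add: adj_mul adj_diff P E matrix_mul_assoc)
  have "?X ** adj ?X = E ** P ** ((mat 1 - E) ** (mat 1 - E)) ** P ** E"
    unfolding aX by (simp add: matrix_mul_assoc)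
  also have "(mat 1 - E) ** (mat 1 - E) = mat 1 - E"
    by (simp add: matrix_bilin E)
  also have "E ** P ** (mat 1 - E) ** P ** E = E ** (P ** P) ** E - E ** P ** (E ** E) ** P ** E"
    by (simp add: matrix_bilin E matrix_mul_assoc)
  also have "\<dots> = E ** P ** E - (E ** P ** E) ** (E ** P ** E)"
    by (simp add: P matrix_mul_assoc)
  finally have "norm (E ** P ** E - (E ** P ** E) ** (E ** P ** E)) = norm (?X ** adj ?X)" by simp
  also have "\<dots> \<le> norm ?X * norm (adj ?X)" by (rule norm_matrix_mult_le)
  finally show ?thesis by (simp add: power2_eq_square)
qed

text \<open>The heart of the Lojasiewicz inequality. The eigenvalues \<open>l\<close> are split at a gap of size \<open>\<delta>\<close> proportional to \<open>y\<close>,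
and \<open>a\<close> is the sum of the upper cluster \<open>T\<close>. As the sum of all eigenvalues is zero, \<open>a\<close> is at least \<open>\<delta> / d\<close>.
The commutators bound the off-diagonal blocks of \<open>P i\<close>, so each compression to \<open>T\<close> has almost an integer as
its trace; these traces add up to \<open>n / d * card T + a\<close>. If the integers add up to \<open>n / d * card T\<close>, then \<open>a\<close> itself is
bounded by the error. Otherwise the error is at least \<open>1 / d - \<bar>a\<bar>\<close>, which is large as \<open>y\<close> is small.\<close>

lemma commutator_lower_bound:
  fixes P :: "'n::finite \<Rightarrow> 'a::rc_scalar^'d^'d" and l :: "'d \<Rightarrow> real" and n :: nat
  assumes P: "\<And>i. adj (P i) = P i" "\<And>i. P i ** P i = P i"
    and sum: "(\<Sum>i\<in>UNIV. P i) = (real n / real CARD('d)) *\<^sub>R mat 1 + diag_matrix l"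
    and tr: "(\<Sum>j\<in>UNIV. l j) = 0"
    and y: "y > 0" "y\<^sup>2 = (\<Sum>j\<in>UNIV. (l j)\<^sup>2)" "y \<le> 1 / (2 * (real CARD('d))\<^sup>2)"
  shows "(\<Sum>i\<in>UNIV. (norm (P i ** diag_matrix l - diag_matrix l ** P i))\<^sup>2)
    \<ge> y ^ 3 / (4 * real CARD('d) ^ 8)"
proof -
  define d where "d = real CARD('d)"
  have d: "d \<ge> 1" by (simp add: d_def Suc_leI)
  define \<delta> where "\<delta> = y / d\<^sup>2"
  have \<delta>: "\<delta> > 0" using y d by (simp add: \<delta>_def)
  have l_le: "\<bar>l j\<bar> \<le> y" for j
  proof -
    have "(l j)\<^sup>2 \<le> y\<^sup>2" unfolding y(2) by (rule member_le_sum) auto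
    then show ?thesis using y(1) by (simp add: abs_le_square_iff[symmetric])
  qed
  obtain p where "l p = Max (range l)"
    using Max_in[of "range l"] by (metis UNIV_not_empty empty_is_image finite finite_imageI imageE)
  then have p: "l j \<le> l p" for j by simp
  obtain q where "l q = Min (range l)"
    using Min_in[of "range l"] by (metis UNIV_not_empty empty_is_image finite finite_imageI imageE)
  then have q: "l q \<le> l j" for j by simp
  have range: "d * \<delta> \<le> l p - l q"
  proof -
    have "(\<Sum>j\<in>UNIV. l j) \<le> (\<Sum>j\<in>(UNIV::'d set). l p)" by (intro sum_mono p)
    then have "0 \<le> d * l p" by (simp add: tr d_def)
    then have "0 \<le> l p" using d by (simp add: zero_le_mult_iff)
    have "(\<Sum>j\<in>(UNIV::'d set). l q) \<le> (\<Sum>j\<in>UNIV. l j)" by (intro sum_mono q)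
    then have "d * l q \<le> 0" by (simp add: tr d_def)
    then have "l q \<le> 0" using d by (simp add: mult_le_0_iff)
    define w where "w = l p - l q"
    have w: "\<bar>l j\<bar> \<le> w" for j
      using p[of j] q[of j] \<open>0 \<le> l p\<close> \<open>l q \<le> 0\<close> by (simp add: w_def abs_le_iff)
    then have w0: "w \<ge> 0" by (meson abs_ge_zero order_trans)
    have "y\<^sup>2 \<le> (\<Sum>j\<in>(UNIV::'d set). w\<^sup>2)"
      unfolding y(2) using w w0 by (intro sum_mono) (simp add: abs_le_square_iff[symmetric])
    also have "\<dots> = d * w\<^sup>2" by (simp add: d_def)
    also have "\<dots> \<le> d * d * w\<^sup>2" using d by (intro mult_right_mono) (auto simp: mult_le_cancel_left1)
    also have "\<dots> = (d * w)\<^sup>2" by (simp add: power2_eq_square mult_ac)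
    finally have "y \<le> d * w" by (rule power2_le_imp_le) (use d w0 in simp)
    then have "y / d \<le> w" using d by (simp add: pos_divide_le_eq mult.commute)
    moreover have "d * \<delta> = y / d" using d by (simp add: \<delta>_def power2_eq_square)
    ultimately show ?thesis by (simp add: w_def)
  qed
  obtain T where T: "T \<noteq> {}" "T \<noteq> UNIV" and gap: "\<And>j k. j \<in> T \<Longrightarrow> k \<notin> T \<Longrightarrow> l j - l k \<ge> \<delta>"
    using spectral_gap[OF \<delta>, of l p q] range by (auto simp: d_def)
  define E :: "'a^'d^'d" where "E = coord_proj T"
  have E: "adj E = E" "E ** E = E" by (simp_all add: E_def coord_proj_idem)
  define a where "a = (\<Sum>j\<in>T. l j)"
  have a_le: "\<bar>a\<bar> \<le> d * y"
  proof -
    have "\<bar>a\<bar> \<le> (\<Sum>j\<in>T. y)" unfolding a_def by (rule sum_abs[THEN order_trans]) (intro sum_mono l_le)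
    also have "\<dots> \<le> (\<Sum>j\<in>(UNIV::'d set). y)" using y by (intro sum_mono2) auto
    finally show ?thesis by (simp add: d_def)
  qed
  have a_ge: "\<delta> \<le> d * a"
  proof -
    have "\<delta> \<le> (\<Sum>j\<in>T. \<Sum>k\<in>-T. \<delta>)"
    proof -
      have "1 \<le> card T" "1 \<le> card (- T)" using T by (auto simp: Suc_le_eq card_gt_0_iff)
      then have "1 * 1 \<le> card T * card (- T)" by (rule mult_le_mono)
      then have "1 \<le> real (card T * card (- T))" by linarith
      then have "1 * \<delta> \<le> real (card T * card (- T)) * \<delta>" using \<delta> by (intro mult_right_mono) auto
      then show ?thesis by simp
    qed
    also have "\<dots> \<le> (\<Sum>j\<in>T. \<Sum>k\<in>-T. l j - l k)" using gap by (intro sum_mono) auto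
    also have "\<dots> = real (card (- T)) * a - real (card T) * (\<Sum>k\<in>-T. l k)"
      by (simp add: sum_subtractf a_def sum_distrib_left)
    also have "(\<Sum>k\<in>-T. l k) = - a"
      using tr sum.subset_diff[of T UNIV l] by (simp add: a_def Compl_eq_Diff_UNIV)
    also have "real (card (- T)) * a - real (card T) * - a = d * a"
    proof -
      have "card T + card (- T) = CARD('d)"
        using card_Un_disjoint[of T "- T"] by simp
      then have "real (card T) + real (card (- T)) = d" unfolding d_def by (metis of_nat_add)
      then show ?thesis by (simp add: algebra_simps flip: distrib_left)
    qed
    finally show ?thesis .
  qed
  define \<epsilon> where "\<epsilon> = (\<lambda>i. norm (E ** P i ** (mat 1 - E)))"
  \<comment> \<open>The total squared size of the off-diagonal blocks controls the distances of the
    traces to integers.\<close>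
  define \<epsilon>2 where "\<epsilon>2 = (\<Sum>i\<in>UNIV. (\<epsilon> i)\<^sup>2)"
  define D where "D = (\<Sum>i\<in>UNIV. (norm (P i ** diag_matrix l - diag_matrix l ** P i))\<^sup>2)"
  have D_ge: "\<delta>\<^sup>2 * \<epsilon>2 \<le> D"
  proof -
    have "\<delta>\<^sup>2 * (\<epsilon> i)\<^sup>2 \<le> (norm (P i ** diag_matrix l - diag_matrix l ** P i))\<^sup>2" for i
    proof -
      have off: "(E ** P i ** (mat 1 - E)) $ j $ k = (if j \<in> T \<and> k \<notin> T then P i $ j $ k else 0)" for j k
      proof -
        have "(X ** E) $ j $ k = (if k \<in> T then X $ j $ k else 0)" for X :: "'a^'d^'d"
        proof -
          have "X ** E = adj (E ** adj X)" by (simp add: adj_mul E)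
          then show ?thesis by (simp add: E_def coord_proj_mult if_distrib cong: if_cong)
        qed
        then show ?thesis by (simp add: matrix_bilin) (simp add: E_def coord_proj_mult)
      qed
      have "\<delta>\<^sup>2 * (\<epsilon> i)\<^sup>2 = (\<Sum>j\<in>UNIV. \<Sum>k\<in>UNIV. \<delta>\<^sup>2 * (norm (if j \<in> T \<and> k \<notin> T then P i $ j $ k else 0))\<^sup>2)"
        unfolding \<epsilon>_def norm_matrix_squared off by (simp add: sum_distrib_left)
      also have "\<dots> \<le> (\<Sum>j\<in>UNIV. \<Sum>k\<in>UNIV. (norm ((P i ** diag_matrix l - diag_matrix l ** P i) $ j $ k))\<^sup>2)"
      proof (intro sum_mono)
        fix j k
        have "(P i ** diag_matrix l - diag_matrix l ** P i) $ j $ k = of_real (l k - l j) * P i $ j $ k"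
          by (simp add: diag_matrix_mult_left diag_matrix_mult_right algebra_simps)
        then have eq: "(norm ((P i ** diag_matrix l - diag_matrix l ** P i) $ j $ k))\<^sup>2 = (l k - l j)\<^sup>2 * (norm (P i $ j $ k))\<^sup>2"
          by (simp only: norm_mult power_mult_distrib norm_of_real power2_abs)
        show "\<delta>\<^sup>2 * (norm (if j \<in> T \<and> k \<notin> T then P i $ j $ k else 0))\<^sup>2
            \<le> (norm ((P i ** diag_matrix l - diag_matrix l ** P i) $ j $ k))\<^sup>2"
        proof (cases "j \<in> T \<and> k \<notin> T")
          case True
          then have "\<delta>\<^sup>2 \<le> (l j - l k)\<^sup>2" using gap \<delta> by (intro power_mono) auto
          then show ?thesis unfolding eq using True by (simp add: mult_right_mono power2_commute[of "l k"])
        next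
          case False then show ?thesis by (subst if_not_P) simp_all
        qed
      qed
      also have "\<dots> = (norm (P i ** diag_matrix l - diag_matrix l ** P i))\<^sup>2"
        by (rule norm_matrix_squared[symmetric])
      finally show ?thesis .
    qed
    then show ?thesis unfolding D_def \<epsilon>2_def sum_distrib_left by (rule sum_mono)
  qed
  have "\<exists>m :: int. \<bar>re_part (trace (E ** P i ** E)) - of_int m\<bar> \<le> 2 * d * (\<epsilon> i)\<^sup>2" for i
  proof -
    have "norm (E ** P i ** E - (E ** P i ** E) ** (E ** P i ** E)) \<le> (\<epsilon> i)\<^sup>2"
      unfolding \<epsilon>_def by (rule compressed_projector_defect[OF P E])
    moreover have "adj (E ** P i ** E) = E ** P i ** E" by (simp add: adj_mul E P matrix_mul_assoc)
    ultimately show ?thesis using near_projector_trace unfolding d_def by metis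
  qed
  then obtain m :: "'n \<Rightarrow> int" where m: "\<And>i. \<bar>re_part (trace (E ** P i ** E)) - of_int (m i)\<bar> \<le> 2 * d * (\<epsilon> i)\<^sup>2"
    by metis
  have tr_sum: "(\<Sum>i\<in>UNIV. re_part (trace (E ** P i ** E))) = real n / d * real (card T) + a"
  proof -
    have "trace (E ** P i ** E) = trace (E ** P i)" for i
      using trace_mul_sym[of "E ** P i" E] by (simp add: matrix_mul_assoc E)
    moreover have "re_part (trace (E ** X)) = (\<Sum>j\<in>T. re_part (X $ j $ j))" for X :: "'a^'d^'d"
      by (simp add: trace_def E_def coord_proj_mult re_part_sum if_distrib[of "\<lambda>x. x $ _"]
          if_distrib[of re_part] sum.If_cases cong: if_cong)
    ultimately have "(\<Sum>i\<in>UNIV. re_part (trace (E ** P i ** E))) = (\<Sum>j\<in>T. re_part ((\<Sum>i\<in>UNIV. P i) $ j $ j))"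
      by (simp add: re_part_sum) (rule sum.swap)
    also have "\<dots> = (\<Sum>j\<in>T. real n / d + l j)"
      unfolding sum by (simp add: mat_def diag_matrix_def d_def)
    finally show ?thesis by (simp add: sum.distrib a_def)
  qed
  \<comment> \<open>\<open>Z / d\<close> is \<open>n / d * card T\<close> minus the sum of the
    integers.\<close>
  define Z :: int where "Z = int n * int (card T) - int CARD('d) * (\<Sum>i\<in>UNIV. m i)"
  have Z: "\<bar>of_int Z / d + a\<bar> \<le> 2 * d * \<epsilon>2"
  proof -
    have "of_int Z / d + a = (\<Sum>i\<in>UNIV. re_part (trace (E ** P i ** E)) - of_int (m i))"
      using d by (simp add: sum_subtractf tr_sum Z_def d_def[symmetric] diff_divide_distrib of_int_sum)
    also have "\<bar>\<dots>\<bar> \<le> (\<Sum>i\<in>UNIV. 2 * d * (\<epsilon> i)\<^sup>2)"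
      by (rule sum_abs[THEN order_trans]) (intro sum_mono m)
    finally show ?thesis by (simp add: \<epsilon>2_def sum_distrib_left)
  qed
  have \<delta>1: "\<delta> \<le> 1"
  proof -
    have d2: "1 \<le> d\<^sup>2" using d by simp
    then have "1 / (2 * d\<^sup>2) \<le> 1" by (subst pos_divide_le_eq) auto
    then have "y \<le> 1" using y(3) unfolding d_def by linarith
    then show ?thesis unfolding \<delta>_def using d2 by (subst pos_divide_le_eq) auto
  qed
  have "\<delta> ^ 3 / (4 * d\<^sup>2) \<le> D"
  proof (cases "Z = 0")
    case True
    then have "a \<le> 2 * d * \<epsilon>2" using Z by simp
    then have "d * a \<le> d * (2 * d * \<epsilon>2)" using d by (intro mult_left_mono) auto
    with a_ge have "\<delta> \<le> 2 * d\<^sup>2 * \<epsilon>2" by (simp add: power2_eq_square mult_ac)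
    then have "\<delta>\<^sup>2 * \<delta> \<le> \<delta>\<^sup>2 * (2 * d\<^sup>2 * \<epsilon>2)" by (intro mult_left_mono) auto
    also have "\<dots> \<le> 2 * d\<^sup>2 * D" using D_ge mult_left_mono[of "\<delta>\<^sup>2 * \<epsilon>2" D "2 * d\<^sup>2"] by (simp add: mult_ac)
    also have "\<dots> \<le> 4 * d\<^sup>2 * D" using D_def by (intro mult_right_mono) (auto simp: sum_nonneg)
    finally show ?thesis using d by (simp add: divide_simps power3_eq_cube power2_eq_square mult_ac)
  next
    case False
    then have "1 \<le> \<bar>of_int Z :: real\<bar>" by linarith
    then have "1 / d \<le> \<bar>of_int Z / d\<bar>" using d by (simp add: divide_right_mono)
    also have "\<dots> \<le> 2 * d * \<epsilon>2 + d * y" using Z a_le by linarith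
    also have "d * y \<le> d * (1 / (2 * d\<^sup>2))" using y(3) d by (intro mult_left_mono) (auto simp: d_def)
    finally have "1 / (2 * d) \<le> 2 * d * \<epsilon>2" using d by (simp add: power2_eq_square field_simps)
    then have "1 \<le> 4 * d\<^sup>2 * \<epsilon>2" using d by (simp add: power2_eq_square field_simps)
    then have "\<delta>\<^sup>2 * 1 \<le> \<delta>\<^sup>2 * (4 * d\<^sup>2 * \<epsilon>2)" by (intro mult_left_mono) auto
    also have "\<dots> \<le> 4 * d\<^sup>2 * D" using D_ge mult_left_mono[of "\<delta>\<^sup>2 * \<epsilon>2" D "4 * d\<^sup>2"] by (simp add: mult_ac)
    finally have "\<delta>\<^sup>2 \<le> 4 * d\<^sup>2 * D" by simp
    moreover have "\<delta> ^ 3 \<le> \<delta>\<^sup>2" using \<delta> \<delta>1 by (simp add: power_decreasing)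
    ultimately show ?thesis using d by (simp add: divide_simps mult_ac)
  qed
  moreover have "\<delta> ^ 3 / (4 * d\<^sup>2) = y ^ 3 / (4 * d ^ 8)"
    by (simp add: \<delta>_def power_divide flip: power_mult power_add)
  ultimately show ?thesis by (simp add: D_def d_def)
qed

lemma trace_frame_operator:
  fixes A :: "'a::rc_scalar^'d^'r^'n"
  assumes A: "A \<in> row_frames R"
  shows "trace (frame_operator A) = of_nat (\<Sum>i\<in>UNIV. card (R i))"
proof -
  have "trace (frame_proj A i) = of_nat (card (R i))" for i
    by (simp add: frame_proj_def trace_mul_sym[of "adj (A $ i)"] row_framesD[OF A] trace_coord_proj)
  moreover have "trace (\<Sum>i\<in>S. f i) = (\<Sum>i\<in>S. trace (f i))" for f :: "'n \<Rightarrow> 'a^'d^'d" and S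
    by (simp add: trace_def) (rule sum.swap)
  ultimately show ?thesis by (simp add: frame_operator_sum)
qed

text \<open>The gradient controls all commutators \<open>P\<^sub>i S - S P\<^sub>i\<close>: such a commutator is \<open>Y - adj Y\<close> for
\<open>Y = P\<^sub>i S (1 - P\<^sub>i)\<close>, and \<open>4 Y\<close> is the product of \<open>A\<^sub>i\<^sup>*\<close> and the gradient.\<close>

lemma lojasiewicz_FFP:
  fixes R :: "'n::finite \<Rightarrow> 'r::finite set"
  assumes n: "n = (\<Sum>i\<in>UNIV. card (R i))"
  obtains \<kappa> \<epsilon> where "\<kappa> > 0" "\<epsilon> > 0"
    "\<And>A :: 'a::rc_scalar^'d^'r^'n. \<lbrakk>A \<in> row_frames R;
       norm (frame_operator A - (real n / real CARD('d)) *\<^sub>R mat 1) \<le> \<epsilon>\<rbrakk>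
     \<Longrightarrow> (norm (grad_FFP A))\<^sup>2 \<ge> \<kappa> * norm (frame_operator A - (real n / real CARD('d)) *\<^sub>R mat 1) ^ 3"
proof -
  define d where "d = real CARD('d)"
  have d: "d > 0" by (simp add: d_def)
  define \<epsilon> where "\<epsilon> = 1 / (2 * d\<^sup>2)"
  \<comment> \<open>\<open>N\<close> bounds \<open>(norm (A $ i))\<^sup>2\<close> and is
    positive.\<close>
  define N where "N = real n + 1"
  have N: "N > 0" by (simp add: N_def)
  define \<kappa> where "\<kappa> = 4 / N * (1 / (4 * d ^ 8))"
  show thesis
  proof (rule that)
    show "\<kappa> > 0" "\<epsilon> > 0" using d N by (simp_all add: \<kappa>_def \<epsilon>_def)
    fix A :: "'a^'d^'r^'n" assume A: "A \<in> row_frames R"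
    define \<mu> where "\<mu> = frame_operator A - (real n / d) *\<^sub>R mat 1"
    assume "norm (frame_operator A - (real n / real CARD('d)) *\<^sub>R mat 1) \<le> \<epsilon>"
    then have small: "norm \<mu> \<le> \<epsilon>" by (simp add: \<mu>_def d_def)
    have a\<mu>: "adj \<mu> = \<mu>" by (simp add: \<mu>_def adj_diff adj_scaleR)
    obtain C :: "'a^'d^'d" and l where C: "adj C ** C = mat 1" "C ** adj C = mat 1"
      and Cl: "adj C ** \<mu> ** C = diag_matrix l"
      by (rule unitary_diagonalization[OF a\<mu>]) blast
    define P where "P = (\<lambda>i. adj C ** frame_proj A i ** C)"
    have proj: "orthogonal_projector (frame_proj A i)" for i
      unfolding frame_proj_def by (rule projector_of_rows[OF row_framesD[OF A]])
    have P1: "adj (P i) = P i" for i by (simp add: P_def adj_mul matrix_mul_assoc)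
    have P2: "P i ** P i = P i" for i
    proof -
      have "P i ** P i = adj C ** (frame_proj A i ** ((C ** adj C) ** frame_proj A i)) ** C"
        by (simp add: P_def matrix_mul_assoc)
      also have "\<dots> = P i" using proj[of i] by (simp add: C(2) P_def orthogonal_projector_def)
      finally show ?thesis .
    qed
    have conj: "adj C ** (X - Y) ** C = adj C ** X ** C - adj C ** Y ** C" for X Y
      by (simp add: matrix_bilin)
    have sum: "(\<Sum>i\<in>UNIV. P i) = (real n / real CARD('d)) *\<^sub>R mat 1 + diag_matrix l"
    proof -
      have "(\<Sum>i\<in>UNIV. P i) = adj C ** frame_operator A ** C"
        by (simp add: P_def frame_operator_sum bounded_bilinear.sum_left[OF bounded_bilinear_matrix_mult]
            bounded_bilinear.sum_right[OF bounded_bilinear_matrix_mult])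
      also have "frame_operator A = \<mu> + (real n / d) *\<^sub>R mat 1" by (simp add: \<mu>_def)
      also have "adj C ** (\<mu> + (real n / d) *\<^sub>R mat 1) ** C = diag_matrix l + (real n / d) *\<^sub>R mat 1"
        by (simp add: matrix_bilin Cl C)
      finally show ?thesis by (simp add: d_def add.commute)
    qed
    have "trace (frame_operator A) = of_nat n" unfolding n by (rule trace_frame_operator[OF A])
    then have "re_part (trace \<mu>) = 0"
      by (simp add: \<mu>_def trace_def re_part_sum sum_subtractf mat_def d_def)
    moreover have "re_part (trace (diag_matrix l :: 'a^'d^'d)) = (\<Sum>j\<in>UNIV. l j)"
      by (simp add: trace_def diag_matrix_def re_part_sum)
    ultimately have tr: "(\<Sum>j\<in>UNIV. l j) = 0"
      using trace_unitary_conj[OF C(2), of \<mu>] unfolding Cl by simp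
    have y2: "(norm \<mu>)\<^sup>2 = (\<Sum>j\<in>UNIV. (l j)\<^sup>2)"
      unfolding norm_unitary_conj[OF C(2), of \<mu>, symmetric] Cl norm_matrix_squared
      by (simp add: diag_matrix_def if_distrib[of norm] if_distrib[of "\<lambda>x. x\<^sup>2"] cong: if_cong)
    have comm: "(norm (P i ** diag_matrix l - diag_matrix l ** P i))\<^sup>2 \<le> N / 4 * (norm (grad_FFP A $ i))\<^sup>2" for i
    proof -
      let ?p = "frame_proj A i" and ?S = "frame_operator A"
      let ?X = "?p ** ?S - ?S ** ?p"
      have "P i ** diag_matrix l = adj C ** (?p ** ((C ** adj C) ** \<mu>)) ** C"
        "diag_matrix l ** P i = adj C ** (\<mu> ** ((C ** adj C) ** ?p)) ** C"
        unfolding Cl[symmetric] by (simp_all add: P_def matrix_mul_assoc)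
      then have "P i ** diag_matrix l - diag_matrix l ** P i = adj C ** (?p ** \<mu> - \<mu> ** ?p) ** C"
        by (simp add: conj C(2))
      also have "?p ** \<mu> - \<mu> ** ?p = ?X" by (simp add: \<mu>_def matrix_bilin)
      finally have n1: "norm (P i ** diag_matrix l - diag_matrix l ** P i) = norm ?X"
        by (simp only: norm_unitary_conj[OF C(2)])
      have pp: "?p ** ?p = ?p" using proj by (simp add: orthogonal_projector_def)
      have "?p ** ?X = (?p ** ?p) ** ?S - ?p ** ?S ** ?p"
        by (simp add: matrix_bilin matrix_mul_assoc)
      then have pX: "?p ** ?X = ?p ** ?S - ?p ** ?S ** ?p" by (simp add: pp)
      have "?X = ?p ** ?X - adj (?p ** ?X)"
        unfolding pX by (simp add: adj_diff adj_mul matrix_mul_assoc)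
      then have "norm ?X \<le> norm (?p ** ?X) + norm (adj (?p ** ?X))"
        using norm_triangle_ineq4[of "?p ** ?X" "adj (?p ** ?X)"] by simp
      then have "norm ?X \<le> 2 * norm (?p ** ?X)" by simp
      also have "?p ** ?X = adj (A $ i) ** (A $ i ** ?X)"
        by (simp add: frame_proj_def matrix_mul_assoc)
      also have "norm (adj (A $ i) ** (A $ i ** ?X)) \<le> norm (adj (A $ i)) * norm (A $ i ** ?X)"
        by (rule norm_matrix_mult_le)
      also have "norm (A $ i ** ?X) = norm (grad_FFP A $ i) / 4" by (simp add: grad_FFP_def)
      finally have "norm ?X \<le> norm (A $ i) * norm (grad_FFP A $ i) / 2" by simp
      then have "(norm ?X)\<^sup>2 \<le> (norm (A $ i) * norm (grad_FFP A $ i) / 2)\<^sup>2"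
        by (intro power_mono) auto
      also have "\<dots> = (norm (A $ i))\<^sup>2 / 4 * (norm (grad_FFP A $ i))\<^sup>2"
        by (simp add: power_mult_distrib power_divide)
      also have "(norm (A $ i))\<^sup>2 \<le> N"
      proof -
        have "(norm (A $ i))\<^sup>2 = real (card (R i))"
          by (simp add: power2_norm_eq_inner matrix_inner_trace row_framesD[OF A] trace_coord_proj)
        moreover have "card (R i) \<le> n" unfolding n by (rule member_le_sum) auto
        ultimately show ?thesis by (simp add: N_def)
      qed
      finally show ?thesis unfolding n1 by (simp add: mult_right_mono divide_right_mono)
    qed
    have "\<kappa> * norm \<mu> ^ 3 \<le> (norm (grad_FFP A))\<^sup>2"
    proof (cases "\<mu> = 0")
      case False
      then have "norm \<mu> ^ 3 / (4 * real CARD('d) ^ 8)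
          \<le> (\<Sum>i\<in>UNIV. (norm (P i ** diag_matrix l - diag_matrix l ** P i))\<^sup>2)"
        using small by (intro commutator_lower_bound[OF P1 P2 sum tr _ y2]) (auto simp: \<epsilon>_def d_def)
      also have "\<dots> \<le> (\<Sum>i\<in>UNIV. N / 4 * (norm (grad_FFP A $ i))\<^sup>2)" by (intro sum_mono comm)
      also have "\<dots> = N / 4 * (norm (grad_FFP A))\<^sup>2"
        by (simp add: norm_vec_def[of "grad_FFP A"] L2_set_def sum_nonneg sum_distrib_left)
      finally have "4 / N * (norm \<mu> ^ 3 / (4 * d ^ 8)) \<le> 4 / N * (N / 4 * (norm (grad_FFP A))\<^sup>2)"
        using N unfolding d_def by (intro mult_left_mono) auto
      then show ?thesis using N by (simp add: \<kappa>_def)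
    qed simp
    then show "(norm (grad_FFP A))\<^sup>2 \<ge> \<kappa> * norm (frame_operator A - (real n / real CARD('d)) *\<^sub>R mat 1) ^ 3"
      by (simp add: \<mu>_def d_def)
  qed
qed

section \<open>Minors adapted to a flag\<close>

text \<open>The maximal minor of \<open>B\<close> with the columns \<open>\<sigma> ` R\<close>. Only the rows in \<open>R\<close> matter, and the identity
on the other rows makes it a square matrix over the full row type with the same determinant.\<close>

definition minor :: "('r \<Rightarrow> 'd) \<Rightarrow> 'r set \<Rightarrow> 'a::rc_scalar^'d^'r \<Rightarrow> 'a^'r^'r" where
  "minor \<sigma> R B = (\<chi> r s. if s \<in> R then B $ r $ \<sigma> s else if r = s then 1 else 0)"

lemma triangular_independent:
  fixes x :: "nat \<Rightarrow> 'a::rc_scalar^'d" and v :: "nat \<Rightarrow> 'a^'d"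
  assumes J: "finite J" and diag: "\<And>l. l \<in> J \<Longrightarrow> herm (x l) (v l) \<noteq> 0"
    and tri: "\<And>l m. l \<in> J \<Longrightarrow> m < l \<Longrightarrow> herm (x l) (v m) = 0"
  shows "vec.independent (x ` J)" and "inj_on x J"
proof -
  show inj: "inj_on x J"
  proof (rule linorder_inj_onI)
    fix l m assume "l < m" "l \<in> J" "m \<in> J"
    then show "x l \<noteq> x m" using diag[of l] tri[of m l] by auto
  qed auto
  show "vec.independent (x ` J)"
  proof (rule vec.independent_if_scalars_zero)
    fix f y assume s: "(\<Sum>y\<in>x ` J. f y *s y) = 0" and y: "y \<in> x ` J"
    then have s: "(\<Sum>l\<in>J. f (x l) *s x l) = 0" using inj by (simp add: sum.reindex)
    have "f (x l) = 0" if "l \<in> J" for l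
      using that
    proof (induction l rule: less_induct)
      case (less l)
      have "0 = herm (\<Sum>m\<in>J. f (x m) *s x m) (v l)" by (simp add: s)
      also have "\<dots> = (\<Sum>m\<in>J. f (x m) * herm (x m) (v l))" by (simp add: herm_sum_left herm_scale_left)
      also have "\<dots> = (\<Sum>m\<in>J. if m = l then f (x l) * herm (x l) (v l) else 0)"
      proof (rule sum.cong)
        fix m assume "m \<in> J"
        then show "f (x m) * herm (x m) (v l) = (if m = l then f (x l) * herm (x l) (v l) else 0)"
          using less.IH[of m] tri[of m l] by (cases m l rule: linorder_cases) auto
      qed simp
      also have "\<dots> = f (x l) * herm (x l) (v l)" using J less.prems by simp
      finally show ?case using diag[OF less.prems] by simp
    qed
    then show "f y = 0" using y by auto
  qed (use J in simp)
qed

text \<open>Let \<open>Q m\<close> be the orthogonal complement of the first \<open>m\<close> vectors of the basis. The columns of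
the minor are the positions \<open>J\<close> at which the dimension of \<open>range P \<inter> Q m\<close> drops. Vectors \<open>x l\<close> that
witness the drops form a basis of \<open>range P\<close> which is triangular with respect to the given basis. The triangular shape
makes the minor nonsingular, and counting the \<open>x l\<close> in \<open>Q m\<close> bounds the number of chosen columns beyond \<open>m\<close>.\<close>

lemma adapted_minor:
  fixes A :: "'a::rc_scalar^'d^'r" and u :: "'a^'d^'d" and e :: "nat \<Rightarrow> 'd"
  assumes A: "A ** adj A = coord_proj R" and u: "orthonormal u"
    and e: "bij_betw e {..<CARD('d)} UNIV"
  shows "\<exists>\<sigma>. det (minor \<sigma> R (A ** transpose u)) \<noteq> 0 \<and>
    (\<forall>m\<le>CARD('d). card R \<le> card {s \<in> R. \<sigma> s \<in> e ` {..<m}}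
      + vec.dim (range (\<lambda>x. (adj A ** A) *v x) \<inter> {x. \<forall>l<m. herm x (u $ e l) = 0}))"
proof -
  define d where "d = CARD('d)"
  define P where "P = adj A ** A"
  define v where "v = (\<lambda>l. u $ e l)"
  define Q where "Q = (\<lambda>m. {x. \<forall>l<m. herm x (v l) = 0})"
  define S where "S = range (\<lambda>x. P *v x)"
  have e_inj: "l = l'" if "e l = e l'" "l < d" "l' < d" for l l'
    using e that by (auto simp: bij_betw_def inj_on_def d_def)
  have e_surj: "\<exists>l<d. j = e l" for j
    using e unfolding d_def by (metis UNIV_I bij_betw_imp_surj_on imageE lessThan_iff)
  have S_sub: "vec.subspace S" unfolding S_def by (rule vec.subspace_image[OF vec.subspace_UNIV])
  have dimS: "vec.dim S = card R" unfolding S_def P_def by (rule projector_of_rows(3)[OF A])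
  define J where "J = {l. l < d \<and> (\<exists>x\<in>S \<inter> Q l. herm x (v l) \<noteq> 0)}"
  have J_fin: "finite J" by (simp add: J_def)
  have "\<forall>l. \<exists>x. l \<in> J \<longrightarrow> x \<in> S \<inter> Q l \<and> herm x (v l) \<noteq> 0" by (auto simp: J_def)
  then obtain x where x: "\<And>l. l \<in> J \<Longrightarrow> x l \<in> S \<inter> Q l \<and> herm (x l) (v l) \<noteq> 0" by metis
  have xtri: "herm (x l) (v m) = 0" if "l \<in> J" "m < l" for l m using x[OF that(1)] that by (auto simp: Q_def)
  have ind: "vec.independent (x ` J')" "inj_on x J'" if "J' \<subseteq> J" for J'
    using triangular_independent[of J' x v] x xtri J_fin finite_subset[OF that] that by blast+
  have tail: "card (J \<inter> {m..}) \<le> vec.dim (S \<inter> Q m)" for m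
  proof -
    have "x ` (J \<inter> {m..}) \<subseteq> S \<inter> Q m" using x by (force simp: Q_def)
    from vec.independent_card_le_dim[OF this] ind[of "J \<inter> {m..}"] show ?thesis by (simp add: card_image)
  qed
  have span: "S \<inter> Q m \<subseteq> vec.span (x ` J)" if "m \<le> d" for m
    using that
  proof (induction rule: inc_induct)
    case base
    show ?case
    proof clarify
      fix y assume "y \<in> Q d"
      then have "herm y (u $ j) = 0" for j using e_surj[of j] by (auto simp: Q_def v_def)
      then have "y = 0" using orthonormal_expand[OF u, of y] by simp
      then show "y \<in> vec.span (x ` J)" by (simp add: vec.span_zero)
    qed
  next
    case (step m)
    show ?case
    proof clarify
      fix y assume y: "y \<in> S" "y \<in> Q m"
      show "y \<in> vec.span (x ` J)"
      proof (cases "herm y (v m) = 0")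
        case True
        then have "y \<in> Q (Suc m)" using y by (auto simp: Q_def less_Suc_eq)
        then show ?thesis using step y by blast
      next
        case False
        then have m: "m \<in> J" using y step by (auto simp: J_def)
        define a where "a = herm y (v m) / herm (x m) (v m)"
        have "y - a *s x m \<in> S"
          using x[OF m] y S_sub by (intro vec.subspace_diff vec.subspace_scale) auto
        moreover have "y - a *s x m \<in> Q (Suc m)"
          using x[OF m] y by (auto simp: Q_def less_Suc_eq herm_diff_left herm_scale_left a_def)
        ultimately have "y - a *s x m \<in> vec.span (x ` J)" using step by blast
        moreover have "a *s x m \<in> vec.span (x ` J)" using m by (intro vec.span_scale vec.span_base) auto
        ultimately have "(y - a *s x m) + a *s x m \<in> vec.span (x ` J)" by (rule vec.span_add)
        then show ?thesis by simp
      qed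
    qed
  qed
  have cardJ: "card J = card R"
  proof -
    have "card (x ` J) = vec.dim S"
    proof (rule vec.basis_card_eq_dim)
      show "x ` J \<subseteq> S" using x by auto
      show "S \<subseteq> vec.span (x ` J)" using span[of 0] by (simp add: Q_def)
      show "vec.independent (x ` J)" by (rule ind) simp
    qed
    then show ?thesis using ind(2)[of J] by (simp add: card_image dimS)
  qed
  have e_J: "inj_on e J" using e_inj by (auto simp: inj_on_def J_def)
  obtain \<tau> where \<tau>: "bij_betw \<tau> R J"
    using finite_same_card_bij[of R J] cardJ J_fin by auto
  have \<tau>J: "\<tau> s \<in> J" if "s \<in> R" for s using \<tau> that by (auto simp: bij_betw_def)
  define \<sigma> where "\<sigma> = e \<circ> \<tau>"
  show ?thesis
  proof (intro exI[of _ \<sigma>] conjI allI impI)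
    show "det (minor \<sigma> R (A ** transpose u)) \<noteq> 0"
    proof -
      let ?M = "minor \<sigma> R (A ** transpose u)"
      have "z = 0" if z: "?M *v z = 0" for z
      proof -
        define y where "y = (\<Sum>s\<in>R. z $ s *s u $ \<sigma> s)"
        have ent: "(A ** transpose u) $ r $ j = (A *v (u $ j)) $ r" for r j
          by (simp add: matrix_matrix_mult_def matrix_vector_mult_def transpose_def)
        have Ay: "(A *v y) $ r = (\<Sum>s\<in>R. z $ s * (A *v u $ \<sigma> s) $ r)" for r
          by (simp add: y_def vec.sum vec.scale)
        have row: "(\<Sum>s\<in>R. z $ s * (A *v u $ \<sigma> s) $ r) + (if r \<in> R then 0 else z $ r) = 0" for r
        proof -
          have "0 = (\<Sum>s\<in>UNIV. ?M $ r $ s * z $ s)"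
            using z by (simp add: vec_eq_iff matrix_vector_mult_def)
          also have "\<dots> = (\<Sum>s\<in>UNIV. (if s \<in> R then z $ s * (A *v u $ \<sigma> s) $ r else 0)
              + (if r = s then (if r \<in> R then 0 else z $ r) else 0))"
            by (intro sum.cong) (auto simp: minor_def ent mult.commute)
          finally show ?thesis by (simp add: sum.distrib sum.If_cases)
        qed
        have zR: "z $ r = 0" if "r \<notin> R" for r
        proof -
          have "(A *v w) $ r = 0" for w
            using coord_proj_mult_rows(1)[OF A that] by (simp add: matrix_vector_mult_def)
          then show ?thesis using row[of r] that by simp
        qed
        have "(A *v y) $ r = 0" for r
          unfolding Ay using row[of r] zR[of r] by (cases "r \<in> R") simp_all
        then have "A *v y = 0" by (simp add: vec_eq_iff)
        then have Py: "P *v y = 0" by (simp add: P_def flip: matrix_vector_mul_assoc)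
        have aP: "adj P = P" by (simp add: P_def adj_mul)
        have herm_y: "herm w y = 0" if "w \<in> S" for w
          using that by (auto simp: S_def herm_adj aP Py)
        have "z $ s = 0" if s: "s \<in> R" for s
        proof (rule ccontr)
          assume "z $ s \<noteq> 0"
          \<comment> \<open>The largest chosen position \<open>\<tau> t\<close> with a nonzero
            coefficient is isolated by pairing with \<open>x (\<tau> t)\<close>.\<close>
          define K where "K = \<tau> ` {s\<in>R. z $ s \<noteq> 0}"
          have K: "finite K" "K \<noteq> {}" using s \<open>z $ s \<noteq> 0\<close> by (auto simp: K_def)
          then have "Max K \<in> K" by simp
          then obtain t where t: "t \<in> R" "z $ t \<noteq> 0" "\<tau> t = Max K" by (auto simp: K_def)
          have max: "\<tau> s' \<le> \<tau> t" if "s' \<in> R" "z $ s' \<noteq> 0" for s'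
            unfolding t(3) using that K by (intro Max_ge) (auto simp: K_def)
          have "0 = herm (x (\<tau> t)) y" using herm_y x[OF \<tau>J[OF t(1)]] by auto
          also have "\<dots> = (\<Sum>s'\<in>R. conjugate (z $ s') * herm (x (\<tau> t)) (v (\<tau> s')))"
            by (simp add: y_def herm_sum_right herm_scale_right \<sigma>_def v_def)
          also have "\<dots> = (\<Sum>s'\<in>R. if s' = t then conjugate (z $ t) * herm (x (\<tau> t)) (v (\<tau> t)) else 0)"
          proof (rule sum.cong)
            fix s' assume s': "s' \<in> R"
            have "\<tau> s' = \<tau> t \<Longrightarrow> s' = t" using \<tau> s' t by (auto simp: bij_betw_def inj_on_def)
            then show "conjugate (z $ s') * herm (x (\<tau> t)) (v (\<tau> s'))
                = (if s' = t then conjugate (z $ t) * herm (x (\<tau> t)) (v (\<tau> t)) else 0)"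
              using max[OF s'] xtri[OF \<tau>J[OF t(1)], of "\<tau> s'"] by force
          qed simp
          also have "\<dots> = conjugate (z $ t) * herm (x (\<tau> t)) (v (\<tau> t))" using t by simp
          finally show False using t x[OF \<tau>J[OF t(1)]] by simp
        qed
        with zR show "z = 0" by (auto simp: vec_eq_iff)
      qed
      then have "\<exists>B. B ** ?M = mat 1" using matrix_left_invertible_ker[of ?M] by blast
      then show ?thesis by (metis invertible_det_nz invertible_left_inverse)
    qed
    fix m assume "m \<le> CARD('d)"
    have "{s \<in> R. \<sigma> s \<in> e ` {..<m}} = {s \<in> R. \<tau> s \<in> J \<inter> {..<m}}"
    proof -
      have "\<sigma> s \<in> e ` {..<m} \<longleftrightarrow> \<tau> s < m" if "s \<in> R" for s
        using e_inj[of "\<tau> s"] \<tau>J[OF that] \<open>m \<le> CARD('d)\<close>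
        by (force simp: \<sigma>_def J_def d_def)
      then show ?thesis using \<tau>J by auto
    qed
    then have "card {s \<in> R. \<sigma> s \<in> e ` {..<m}} = card (\<tau> ` {s \<in> R. \<tau> s \<in> J \<inter> {..<m}})"
      using \<tau> by (subst card_image) (auto simp: bij_betw_def inj_on_def)
    also have "\<tau> ` {s \<in> R. \<tau> s \<in> J \<inter> {..<m}} = J \<inter> {..<m}"
      using \<tau> by (auto simp: bij_betw_def)
    finally have "card {s \<in> R. \<sigma> s \<in> e ` {..<m}} = card (J \<inter> {..<m})" .
    moreover have "card J = card (J \<inter> {..<m}) + card (J \<inter> {m..})"
    proof -
      have "J = (J \<inter> {..<m}) \<union> (J \<inter> {m..})" by auto
      then show ?thesis using J_fin by (subst card_Un_disjoint[symmetric]) auto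
    qed
    ultimately show "card R \<le> card {s \<in> R. \<sigma> s \<in> e ` {..<m}}
        + vec.dim (range (\<lambda>x. (adj A ** A) *v x) \<inter> {x. \<forall>l<m. herm x (u $ e l) = 0})"
      using tail[of m] cardJ by (simp add: S_def P_def Q_def v_def)
  qed
qed

text \<open>Among the first \<open>m\<close> basis vectors, the minors together use at least the average number of columns.\<close>

definition balanced :: "(nat \<Rightarrow> 'd) \<Rightarrow> ('n::finite \<Rightarrow> 'r::finite set) \<Rightarrow> ('n \<Rightarrow> 'r \<Rightarrow> 'd::finite) \<Rightarrow> bool" where
  "balanced e R \<sigma> \<longleftrightarrow> (\<forall>m\<le>CARD('d). real (\<Sum>i\<in>UNIV. card (R i)) * real m / real CARD('d)
     \<le> (\<Sum>i\<in>UNIV. real (card {s \<in> R i. \<sigma> i s \<in> e ` {..<m}})))"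

text \<open>This is the only place where property S enters. It is applied to the orthogonal complement of the
first \<open>m\<close> basis vectors, which has dimension \<open>d - m\<close>: at most \<open>n * (d - m) / d\<close> columns lie beyond \<open>m\<close>.\<close>

lemma balanced_minors:
  fixes A :: "'a::rc_scalar^'d^'r^'n" and u :: "'a^'d^'d" and e :: "nat \<Rightarrow> 'd"
  assumes A: "A \<in> row_frames R" and k: "\<And>i. card (R i) = k i" and S: "property_S k A" and u: "orthonormal u"
    and e: "bij_betw e {..<CARD('d)} UNIV"
  obtains \<sigma> where "balanced e R \<sigma>" "\<And>i. det (minor (\<sigma> i) (R i) (A $ i ** transpose u)) \<noteq> 0"
proof -
  define d where "d = CARD('d)"
  define n where "n = (\<Sum>i\<in>UNIV. card (R i))"
  have d: "d > 0" by (simp add: d_def)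
  let ?Q = "\<lambda>m. {x. \<forall>l<m. herm x (u $ e l) = 0}"
  have "\<exists>\<sigma>. \<forall>i. det (minor (\<sigma> i) (R i) (A $ i ** transpose u)) \<noteq> 0 \<and>
    (\<forall>m\<le>d. card (R i) \<le> card {s \<in> R i. \<sigma> i s \<in> e ` {..<m}}
      + vec.dim (range (\<lambda>x. frame_proj A i *v x) \<inter> ?Q m))"
    unfolding frame_proj_def d_def
    by (intro choice allI adapted_minor[OF row_framesD[OF A] u e])
  then obtain \<sigma> where \<sigma>0: "\<forall>i. det (minor (\<sigma> i) (R i) (A $ i ** transpose u)) \<noteq> 0 \<and>
    (\<forall>m\<le>d. card (R i) \<le> card {s \<in> R i. \<sigma> i s \<in> e ` {..<m}}
      + vec.dim (range (\<lambda>x. frame_proj A i *v x) \<inter> ?Q m))" ..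
  have \<sigma>: "det (minor (\<sigma> i) (R i) (A $ i ** transpose u)) \<noteq> 0"
    "m \<le> d \<Longrightarrow> card (R i) \<le> card {s \<in> R i. \<sigma> i s \<in> e ` {..<m}}
      + vec.dim (range (\<lambda>x. frame_proj A i *v x) \<inter> ?Q m)" for i m
    using \<sigma>0 by blast+
  have dim_le: "(\<Sum>i\<in>UNIV. real (vec.dim (range (\<lambda>x. frame_proj A i *v x) \<inter> ?Q m))) \<le> real n * (real d - real m) / real d"
    if m: "0 < m" "m < d" for m
  proof -
    have e_inj: "l = l'" if "e l = e l'" "l < d" "l' < d" for l l'
      using e that by (auto simp: bij_betw_def inj_on_def d_def)
    have sub: "vec.subspace (?Q m)"
      by (auto simp: vec.subspace_def herm_add_left herm_scale_left)
    have "u $ e m \<in> ?Q m" using e_inj[of m] m by (force simp: orthonormalD[OF u])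
    moreover have "u $ e m \<noteq> 0" using orthonormalD[OF u, of "e m" "e m"] by auto
    ultimately have ne0: "?Q m \<noteq> {0}" by blast
    have "u $ e 0 \<notin> ?Q m" using m by (auto simp: orthonormalD[OF u])
    then have neU: "?Q m \<noteq> UNIV" by blast
    have "vec.dim (?Q m) \<le> card (($) u ` e ` {m..<d})"
    proof (rule vec.dim_le_card)
      show "?Q m \<subseteq> vec.span (($) u ` e ` {m..<d})"
      proof
        fix x assume x: "x \<in> ?Q m"
        have "(\<Sum>j\<in>UNIV. herm x (u $ j) *s (u $ j)) \<in> vec.span (($) u ` e ` {m..<d})"
        proof (rule vec.span_sum)
          fix j
          obtain l where l: "l < d" "j = e l"
            using e unfolding d_def by (metis UNIV_I bij_betw_imp_surj_on imageE lessThan_iff)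
          show "herm x (u $ j) *s (u $ j) \<in> vec.span (($) u ` e ` {m..<d})"
          proof (cases "l < m")
            case True
            then show ?thesis using x l by (simp add: vec.span_zero)
          next
            case False
            then show ?thesis using l by (intro vec.span_scale vec.span_base) auto
          qed
        qed
        then show "x \<in> vec.span (($) u ` e ` {m..<d})" using orthonormal_expand[OF u, of x] by simp
      qed
    qed simp
    also have "\<dots> \<le> d - m" using card_image_le[of "e ` {m..<d}" "($) u"] card_image_le[of "{m..<d}" e] by simp
    finally have dimQ: "real (vec.dim (?Q m)) \<le> real d - real m" using m by linarith
    have pos: "vec.dim (?Q m) > 0"
      using ne0 vec.subspace_0[OF sub] vec.dim_eq_0[of "?Q m"] by blast
    have "1 / real (vec.dim (?Q m)) * (\<Sum>i\<in>UNIV. real (vec.dim (range (\<lambda>x. frame_proj A i *v x) \<inter> ?Q m)))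
        \<le> real n / real d"
      using S sub ne0 neU unfolding property_S_def n_def k d_def by blast
    then have "(\<Sum>i\<in>UNIV. real (vec.dim (range (\<lambda>x. frame_proj A i *v x) \<inter> ?Q m)))
        \<le> real n / real d * real (vec.dim (?Q m))"
      using pos by (simp add: pos_divide_le_eq)
    also have "\<dots> \<le> real n / real d * (real d - real m)" using dimQ by (intro mult_left_mono) auto
    finally show ?thesis by simp
  qed
  have "balanced e R \<sigma>"
    unfolding balanced_def n_def[symmetric] d_def[symmetric]
  proof (intro allI impI)
    fix m assume m: "m \<le> d"
    let ?c = "\<Sum>i\<in>UNIV. real (card {s \<in> R i. \<sigma> i s \<in> e ` {..<m}})"
    let ?D = "\<Sum>i\<in>UNIV. real (vec.dim (range (\<lambda>x. frame_proj A i *v x) \<inter> ?Q m))"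
    consider "m = 0" | "0 < m" "m < d" | "m = d" using m by linarith
    then show "real n * real m / real d \<le> ?c"
    proof cases
      case 1 then show ?thesis by (simp add: sum_nonneg)
    next
      case 2
      have "real n \<le> ?c + ?D"
        unfolding n_def of_nat_sum sum.distrib[symmetric]
        by (intro sum_mono) (use \<sigma>(2)[OF m] in \<open>simp flip: of_nat_add\<close>)
      also have "?D \<le> real n * (real d - real m) / real d" by (rule dim_le[OF 2])
      finally show ?thesis using d by (simp add: field_simps)
    next
      case 3
      have "e ` {..<d} = UNIV" using e by (simp add: bij_betw_def d_def)
      then show ?thesis using 3 d by (simp add: n_def)
    qed
  qed
  from that[OF this \<sigma>(1)] show thesis .
qed

text \<open>The sum over the finitely many balanced choices of columns is a continuous function of the
orthonormal basis, positive by \<open>balanced_minors\<close>, and has a positive minimum by compactness. For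
a fixed choice of columns the minors can vanish at some bases.\<close>

lemma uniform_balanced_minors:
  fixes A :: "'a::rc_scalar^'d^'r^'n" and e :: "nat \<Rightarrow> 'd"
  assumes A: "A \<in> row_frames R" and k: "\<And>i. card (R i) = k i" and S: "property_S k A"
    and e: "bij_betw e {..<CARD('d)} UNIV"
  obtains c where "c > 0" "\<And>u :: 'a^'d^'d. orthonormal u \<Longrightarrow>
    \<exists>\<sigma>. balanced e R \<sigma> \<and> c \<le> (\<Prod>i\<in>UNIV. norm (det (minor (\<sigma> i) (R i) (A $ i ** transpose u))))"
proof -
  define B where "B = {\<sigma> :: 'n \<Rightarrow> 'r \<Rightarrow> 'd. balanced e R \<sigma>}"
  define p where "p = (\<lambda>\<sigma> (u::'a^'d^'d). \<Prod>i\<in>UNIV. norm (det (minor (\<sigma> i) (R i) (A $ i ** transpose u))))"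
  define g where "g = (\<lambda>u. \<Sum>\<sigma>\<in>B. p \<sigma> u)"
  have p_nonneg: "p \<sigma> u \<ge> 0" for \<sigma> u by (simp add: p_def prod_nonneg)
  have fin: "finite B" by simp
  have ent: "minor \<tau> Q (X ** transpose u) $ r $ s
      = (if s \<in> Q then \<Sum>a\<in>UNIV. X $ r $ a * u $ \<tau> s $ a else if r = s then 1 else 0)"
    for \<tau> :: "'r \<Rightarrow> 'd" and Q and X :: "'a^'d^'r" and u r s
    by (simp add: minor_def matrix_matrix_mult_def transpose_def)
  have "continuous_on {u. orthonormal u} (\<lambda>u. minor \<tau> Q (X ** transpose u) $ r $ s)"
    for \<tau> :: "'r \<Rightarrow> 'd" and Q and X :: "'a^'d^'r" and r s
    unfolding ent by (cases "s \<in> Q") (auto intro!: continuous_intros)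
  note cont_entry = this
  have "continuous_on {u. orthonormal u} (\<lambda>u. det (minor \<tau> Q (X ** transpose u)))"
    for \<tau> :: "'r \<Rightarrow> 'd" and Q and X :: "'a^'d^'r"
    unfolding det_def
    by (intro continuous_on_sum continuous_on_mult continuous_on_const continuous_on_prod cont_entry)
  then have cont: "continuous_on {u. orthonormal u} g"
    unfolding g_def p_def by (intro continuous_on_sum continuous_on_prod continuous_on_norm)
  have pos: "g u > 0" if u: "orthonormal u" for u
  proof (rule balanced_minors[OF A k S u e])
    fix \<sigma> assume "balanced e R \<sigma>" and nz: "\<And>i. det (minor (\<sigma> i) (R i) (A $ i ** transpose u)) \<noteq> 0"
    then have "\<sigma> \<in> B" by (simp add: B_def)
    moreover have "p \<sigma> u > 0" unfolding p_def by (intro prod_pos) (simp add: nz)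
    ultimately show "g u > 0" unfolding g_def using fin p_nonneg by (intro sum_pos2)
  qed
  have "orthonormal (mat 1 :: 'a^'d^'d)" by (simp add: orthonormal_iff)
  then obtain u0 :: "'a^'d^'d" where u0: "orthonormal u0" "\<And>u. orthonormal u \<Longrightarrow> g u0 \<le> g u"
    using continuous_attains_inf[OF compact_orthonormal _ cont] by blast
  define c where "c = g u0 / (real (card B) + 1)"
  show thesis
  proof (rule that)
    show "c > 0" using pos[OF u0(1)] by (simp add: c_def)
    fix u :: "'a^'d^'d" assume u: "orthonormal u"
    have "\<exists>\<sigma>\<in>B. c \<le> p \<sigma> u"
    proof (rule ccontr)
      assume "\<not> (\<exists>\<sigma>\<in>B. c \<le> p \<sigma> u)"
      then have "g u \<le> (\<Sum>\<sigma>\<in>B. c)" unfolding g_def by (intro sum_mono) auto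
      also have "\<dots> < (real (card B) + 1) * c" using \<open>c > 0\<close> by (simp add: algebra_simps)
      also have "\<dots> = g u0" by (simp add: c_def)
      finally show False using u0(2)[OF u] by simp
    qed
    then show "\<exists>\<sigma>. balanced e R \<sigma> \<and> c \<le> (\<Prod>i\<in>UNIV. norm (det (minor (\<sigma> i) (R i) (A $ i ** transpose u))))"
      by (auto simp: B_def p_def)
  qed
qed

lemma abel_nonpos:
  fixes x b :: "nat \<Rightarrow> real"
  assumes partial: "\<And>m. m \<le> d \<Longrightarrow> 0 \<le> (\<Sum>l<m. x l)" and total: "(\<Sum>l<d. x l) = 0"
    and mono: "\<And>i j. i \<le> j \<Longrightarrow> j < d \<Longrightarrow> b i \<le> b j"
  shows "(\<Sum>l<d. x l * b l) \<le> 0"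
proof -
  have "(\<Sum>l<Suc m. x l * b l) \<le> (\<Sum>l<Suc m. x l) * b m" if "Suc m \<le> d" for m
    using that
  proof (induction m)
    case (Suc m)
    then have "(\<Sum>l<Suc m. x l * b l) \<le> (\<Sum>l<Suc m. x l) * b m" by simp
    also have "\<dots> \<le> (\<Sum>l<Suc m. x l) * b (Suc m)"
      using Suc partial[of "Suc m"] mono[of m "Suc m"] by (intro mult_left_mono) auto
    finally show ?case by (simp add: algebra_simps)
  qed simp
  from this[of "d - 1"] total show ?thesis by (cases d) auto
qed

text \<open>A balanced choice of columns favours the small values of \<open>f\<close>, so its sum is at most the average.
This is summation by parts (\<open>abel_nonpos\<close>) for the deviation of the number of columns from the average.\<close>

lemma balanced_weight:
  fixes f :: "'d::finite \<Rightarrow> real" and R :: "'n::finite \<Rightarrow> 'r::finite set"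
  assumes e: "bij_betw e {..<CARD('d)} (UNIV :: 'd set)"
    and mono: "\<And>i j. i \<le> j \<Longrightarrow> j < CARD('d) \<Longrightarrow> f (e i) \<le> f (e j)"
    and bal: "balanced e R \<sigma>"
  shows "(\<Sum>i\<in>UNIV. \<Sum>s\<in>R i. f (\<sigma> i s))
    \<le> real (\<Sum>i\<in>UNIV. card (R i)) / real CARD('d) * (\<Sum>j\<in>UNIV. f j)"
proof -
  define d where "d = CARD('d)"
  define n where "n = (\<Sum>i\<in>UNIV. card (R i))"
  have d: "d > 0" by (simp add: d_def)
  define c where "c = (\<lambda>l. \<Sum>i\<in>UNIV. \<Sum>s\<in>R i. if \<sigma> i s = e l then 1 else 0 :: real)"
  define x where "x = (\<lambda>l. c l - real n / real d)"
  have e_inj: "l = l'" if "e l = e l'" "l < d" "l' < d" for l l'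
    using e that by (auto simp: bij_betw_def inj_on_def d_def)
  have pick: "(\<Sum>l<m. if j = e l then g l else 0) = (if l0 < m then g l0 else 0)"
    if "j = e l0" "l0 < d" "m \<le> d" for g :: "nat \<Rightarrow> real" and m l0 j
  proof -
    have "(\<Sum>l<m. if j = e l then g l else 0) = (\<Sum>l<m. if l0 = l then g l else 0)"
      using that e_inj by (intro sum.cong) auto
    then show ?thesis by simp
  qed
  have surj: "\<exists>l<d. j = e l" for j
    using e unfolding d_def by (metis UNIV_I bij_betw_imp_surj_on imageE lessThan_iff)
  have sum_c: "(\<Sum>l<m. c l) = (\<Sum>i\<in>UNIV. real (card {s \<in> R i. \<sigma> i s \<in> e ` {..<m}}))" if m: "m \<le> d" for m
  proof -
    have "(\<Sum>l<m. c l) = (\<Sum>i\<in>UNIV. \<Sum>s\<in>R i. \<Sum>l<m. if \<sigma> i s = e l then 1 else 0)"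
      unfolding c_def by (subst sum.swap, subst (2) sum.swap) simp
    also have "\<dots> = (\<Sum>i\<in>UNIV. \<Sum>s\<in>R i. if \<sigma> i s \<in> e ` {..<m} then 1 else 0)"
    proof (intro sum.cong refl)
      fix i s
      obtain l0 where l0: "l0 < d" "\<sigma> i s = e l0" using surj by blast
      have "\<sigma> i s \<in> e ` {..<m} \<longleftrightarrow> l0 < m" 
      proof
        assume "\<sigma> i s \<in> e ` {..<m}"
        then obtain l where l: "l < m" "e l0 = e l" using l0 by auto
        then have "l0 = l" using e_inj[of l0 l] l0 m by simp
        then show "l0 < m" using l by simp
      qed (use l0 in auto)
      then show "(\<Sum>l<m. if \<sigma> i s = e l then 1 else 0) = (if \<sigma> i s \<in> e ` {..<m} then 1 else 0 :: real)"
        using pick[OF l0(2,1) m, of "\<lambda>_. 1"] by simp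
    qed
    also have "\<dots> = (\<Sum>i\<in>UNIV. real (card {s \<in> R i. \<sigma> i s \<in> e ` {..<m}}))"
      by (intro sum.cong refl) (simp flip: sum.inter_filter)
    finally show ?thesis .
  qed
  have image_d: "e ` {..<d} = UNIV" using e by (simp add: bij_betw_def d_def)
  have "(\<Sum>l<d. x l * f (e l)) \<le> 0"
  proof (rule abel_nonpos)
    fix m assume m: "m \<le> d"
    have "real n * real m / real d \<le> (\<Sum>l<m. c l)"
      using bal m unfolding sum_c[OF m] balanced_def n_def d_def by blast
    then show "0 \<le> (\<Sum>l<m. x l)" by (simp add: x_def sum_subtractf mult.commute)
  next
    show "(\<Sum>l<d. x l) = 0" using d sum_c[of d] by (simp add: x_def sum_subtractf image_d n_def)
  next
    show "f (e i) \<le> f (e j)" if "i \<le> j" "j < d" for i j using mono that by (simp add: d_def)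
  qed
  moreover have "(\<Sum>l<d. c l * f (e l)) = (\<Sum>i\<in>UNIV. \<Sum>s\<in>R i. f (\<sigma> i s))"
  proof -
    have "(\<Sum>l<d. c l * f (e l)) = (\<Sum>i\<in>UNIV. \<Sum>s\<in>R i. \<Sum>l<d. if \<sigma> i s = e l then f (e l) else 0)"
      unfolding c_def sum_distrib_right
      by (subst sum.swap, subst (2) sum.swap) (simp add: if_distrib[of "\<lambda>x. x * _"] cong: if_cong)
    also have "\<dots> = (\<Sum>i\<in>UNIV. \<Sum>s\<in>R i. f (\<sigma> i s))"
    proof (intro sum.cong refl)
      fix i s
      obtain l0 where l0: "l0 < d" "\<sigma> i s = e l0" using surj by blast
      show "(\<Sum>l<d. if \<sigma> i s = e l then f (e l) else 0) = f (\<sigma> i s)"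
        using pick[OF l0(2,1) order_refl, of "\<lambda>l. f (e l)"] l0 by simp
    qed
    finally show ?thesis .
  qed
  moreover have "(\<Sum>l<d. f (e l)) = (\<Sum>j\<in>UNIV. f j)"
    using sum.reindex_bij_betw[OF e, of f] by (simp add: d_def)
  moreover have "(\<Sum>l<d. x l * f (e l)) = (\<Sum>l<d. c l * f (e l)) - real n / real d * (\<Sum>l<d. f (e l))"
    by (simp add: x_def left_diff_distrib sum_subtractf sum_distrib_left)
  ultimately show ?thesis unfolding n_def[symmetric] d_def[symmetric] by simp
qed

section \<open>Determinants along linear differential equations\<close>

text \<open>Liouville's formula. The product rule produces the determinants in which one row \<open>i\<close> of \<open>M\<close> is
replaced by row \<open>i\<close> of \<open>X ** M\<close>; in its expansion by rows of \<open>M\<close> only the term with row \<open>i\<close> itself survives.\<close>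

lemma has_vector_derivative_det:
  fixes M :: "real \<Rightarrow> 'a::rc_scalar^'k^'k"
  assumes M: "(M has_vector_derivative X ** M t) (at t within T)"
  shows "((\<lambda>t. det (M t)) has_vector_derivative trace X * det (M t)) (at t within T)"
proof -
  let ?M' = "X ** M t"
  have nth: "((\<lambda>t. M t $ i $ j) has_vector_derivative ?M' $ i $ j) (at t within T)" for i j
    by (intro nth_has_vector_derivative M)
  have "((\<lambda>t. \<Prod>i\<in>UNIV. M t $ i $ p i) has_vector_derivative
      (\<Sum>i\<in>UNIV. ?M' $ i $ p i * (\<Prod>j\<in>UNIV - {i}. M t $ j $ p j))) (at t within T)" for p
  proof -
    have "((\<lambda>t. \<Prod>i\<in>UNIV. M t $ i $ p i) has_derivative
      (\<lambda>y. \<Sum>i\<in>UNIV. (y *\<^sub>R ?M' $ i $ p i) * (\<Prod>j\<in>UNIV - {i}. M t $ j $ p j))) (at t within T)"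
      using nth unfolding has_vector_derivative_def by (intro has_derivative_prod) simp
    then show ?thesis by (simp add: has_vector_derivative_def scaleR_sum_right)
  qed
  then have der: "((\<lambda>t. det (M t)) has_vector_derivative
      (\<Sum>p\<in>{p. p permutes UNIV}. of_int (sign p) * (\<Sum>i\<in>UNIV. ?M' $ i $ p i * (\<Prod>j\<in>UNIV - {i}. M t $ j $ p j))))
      (at t within T)"
    unfolding det_def by (intro has_vector_derivative_sum has_vector_derivative_mult_right)
  have row: "(\<Sum>p\<in>{p. p permutes UNIV}. of_int (sign p) * (?M' $ i $ p i * (\<Prod>j\<in>UNIV - {i}. M t $ j $ p j)))
      = X $ i $ i * det (M t)" for i
  proof -
    have "(\<Sum>p\<in>{p. p permutes UNIV}. of_int (sign p) * (?M' $ i $ p i * (\<Prod>j\<in>UNIV - {i}. M t $ j $ p j)))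
        = det (\<chi> j. if j = i then ?M' $ i else M t $ j)"
      unfolding det_def
    proof (intro sum.cong refl arg_cong2[where f = "(*)"])
      fix p
      have "(\<Prod>j\<in>UNIV. (\<chi> j. if j = i then ?M' $ i else M t $ j) $ j $ p j)
          = ?M' $ i $ p i * (\<Prod>j\<in>UNIV - {i}. (\<chi> j. if j = i then ?M' $ i else M t $ j) $ j $ p j)"
        by (subst prod.remove[of UNIV i]) simp_all
      also have "(\<Prod>j\<in>UNIV - {i}. (\<chi> j. if j = i then ?M' $ i else M t $ j) $ j $ p j)
          = (\<Prod>j\<in>UNIV - {i}. M t $ j $ p j)" by (intro prod.cong) auto
      finally show "?M' $ i $ p i * (\<Prod>j\<in>UNIV - {i}. M t $ j $ p j)
          = (\<Prod>j\<in>UNIV. (\<chi> j. if j = i then ?M' $ i else M t $ j) $ j $ p j)" by simp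
    qed
    also have "\<dots> = det (\<chi> j. if j = i then (\<Sum>k\<in>UNIV. X $ i $ k *s M t $ k) else M t $ j)"
    proof -
      have "?M' $ i = (\<Sum>k\<in>UNIV. X $ i $ k *s M t $ k)"
        by (simp add: vec_eq_iff matrix_matrix_mult_def)
      then show ?thesis by (simp only:)
    qed
    also have "det (\<chi> j. if j = i then (\<Sum>k\<in>UNIV. X $ i $ k *s M t $ k) else M t $ j)
        = (\<Sum>k\<in>UNIV. X $ i $ k * det (\<chi> j. if j = i then M t $ k else M t $ j))"
      by (subst det_linear_row_sum) (simp_all add: det_row_mul)
    also have "\<dots> = (\<Sum>k\<in>UNIV. if k = i then X $ i $ i * det (M t) else 0)"
    proof (intro sum.cong refl)
      fix k
      show "X $ i $ k * det (\<chi> j. if j = i then M t $ k else M t $ j)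
          = (if k = i then X $ i $ i * det (M t) else 0)"
      proof (cases "k = i")
        case True
        then have "(\<chi> j. if j = i then M t $ k else M t $ j) = M t" by (simp add: vec_eq_iff)
        then show ?thesis using True by simp
      next
        case False
        then have "det (\<chi> j. if j = i then M t $ k else M t $ j) = 0"
          by (intro det_identical_rows[of k i]) (simp_all add: row_def)
        then show ?thesis using False by simp
      qed
    qed
    finally show ?thesis by simp
  qed
  have "(\<Sum>p\<in>{p. p permutes UNIV}. of_int (sign p) * (\<Sum>i\<in>UNIV. ?M' $ i $ p i * (\<Prod>j\<in>UNIV - {i}. M t $ j $ p j)))
      = (\<Sum>i\<in>UNIV. X $ i $ i * det (M t))"
    unfolding sum_distrib_left by (subst sum.swap) (simp add: row)
  with der show ?thesis by (simp add: trace_def sum_distrib_right)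
qed

lemma scalar_linear_ode:
  fixes q :: "real \<Rightarrow> 'a::rc_scalar"
  assumes q: "\<And>t. t \<ge> 0 \<Longrightarrow> (q has_vector_derivative of_real (h t) * q t) (at t within {0..})"
    and H: "\<And>t. t \<ge> 0 \<Longrightarrow> (H has_real_derivative h t) (at t within {0..})" and H0: "H 0 = 0"
    and t: "t \<ge> 0"
  shows "q t = exp (H t) *\<^sub>R q 0"
proof -
  have "((\<lambda>t. exp (- H t) *\<^sub>R q t) has_vector_derivative 0) (at s within {0..})" if "s \<in> {0..}" for s
  proof -
    have s: "s \<ge> 0" using that by simp
    have "((\<lambda>t. exp (- H t)) has_real_derivative exp (- H s) * (- h s)) (at s within {0..})"
      by (auto intro!: derivative_eq_intros H s)
    from has_vector_derivative_scaleR[OF this q[OF s]]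
    show ?thesis by (simp add: scaleR_conv_of_real algebra_simps)
  qed
  then obtain c where c: "\<And>s. s \<in> {0..} \<Longrightarrow> exp (- H s) *\<^sub>R q s = c"
    using has_vector_derivative_zero_constant[of "{0..}" "\<lambda>t. exp (- H t) *\<^sub>R q t"] by auto
  have "exp (- H t) *\<^sub>R q t = q 0" using c[of t] c[of 0] t H0 by simp
  then have "exp (H t) *\<^sub>R (exp (- H t) *\<^sub>R q t) = exp (H t) *\<^sub>R q 0" by simp
  then show ?thesis by (simp flip: exp_add)
qed

lemma conjugate_prod: "conjugate (prod f S) = (\<Prod>i\<in>S. conjugate (f i :: 'a::rc_scalar))"
  by (induction S rule: infinite_finite_induct) (auto simp: conjugate_dist_mul)

lemma conjugate_of_int: "conjugate (of_int z :: 'a::rc_scalar) = of_int z"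
  using conjugate_of_real[of "of_int z :: real", where 'a = 'a] by simp

lemma det_adj: "det (adj M) = conjugate (det (M :: 'a::rc_scalar^'k^'k))"
proof -
  have "det (adj M) = det (transpose (adj M))" by simp
  also have "\<dots> = conjugate (det M)"
    by (simp add: det_def transpose_def sum_conjugate conjugate_dist_mul conjugate_prod conjugate_of_int)
  finally show ?thesis .
qed

lemma norm_det_unitary:
  assumes "adj C ** C = mat 1" shows "norm (det (C :: 'a::rc_scalar^'k^'k)) = 1"
proof -
  have "det (adj C) * det C = 1" using assms det_mul[of "adj C" C] by simp
  then have "norm (det (adj C)) * norm (det C) = 1" by (metis norm_mult norm_one)
  then have "(norm (det C))\<^sup>2 = 1" by (simp add: det_adj power2_eq_square)
  then show ?thesis using norm_ge_zero[of "det C"] by (auto simp only: power2_eq_1_iff)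
qed

lemma det_diag_matrix: "det (diag_matrix l :: 'a::rc_scalar^'k^'k) = of_real (\<Prod>j\<in>UNIV. l j)"
  by (subst det_diagonal) (simp_all add: diag_matrix_def)

lemma norm_det_le:
  fixes M :: "'a::rc_scalar^'k^'k"
  assumes "\<And>i j. norm (M $ i $ j) \<le> b"
  shows "norm (det M) \<le> fact CARD('k) * b ^ CARD('k)"
proof -
  have "norm (det M) \<le> (\<Sum>p\<in>{p. p permutes (UNIV::'k set)}. norm (of_int (sign p) * (\<Prod>i\<in>UNIV. M $ i $ p i)))"
    unfolding det_def by (rule norm_sum)
  also have "\<dots> \<le> (\<Sum>p\<in>{p. p permutes (UNIV::'k set)}. b ^ CARD('k))"
  proof (rule sum_mono)
    fix p
    have "norm (of_int (sign p) * (\<Prod>i\<in>UNIV. M $ i $ p i)) = (\<Prod>i\<in>UNIV. norm (M $ i $ p i))"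
      by (simp add: norm_mult sign_def prod_norm)
    also have "\<dots> \<le> (\<Prod>i\<in>(UNIV::'k set). b)" by (intro prod_mono) (simp add: assms)
    finally show "norm (of_int (sign p) * (\<Prod>i\<in>UNIV. M $ i $ p i)) \<le> b ^ CARD('k)" by simp
  qed
  also have "\<dots> = fact CARD('k) * b ^ CARD('k)" by (simp add: card_permutations)
  finally show ?thesis .
qed

text \<open>The eigenvalues are sorted along an enumeration given in advance, so that one enumeration serves all
matrices in \<open>uniform_balanced_minors\<close>.\<close>

lemma sorted_eigenbasis:
  fixes M :: "'a::rc_scalar^'d^'d" and e :: "nat \<Rightarrow> 'd"
  assumes M: "adj M = M" and e: "bij_betw e {..<CARD('d)} UNIV"
  obtains u l where "orthonormal u" "adj (transpose u) ** M ** transpose u = diag_matrix l"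
    "\<And>i j. i \<le> j \<Longrightarrow> j < CARD('d) \<Longrightarrow> l (e i) \<le> l (e j)"
proof -
  obtain u l where u: "orthonormal u" and Mu: "\<And>j. M *v (u $ j) = of_real (l j) *s (u $ j)"
    by (rule spectral_theorem[OF M]) blast
  obtain f :: "nat \<Rightarrow> 'd" where f: "bij_betw f {..<CARD('d)} UNIV"
    and mono: "\<And>i j. i \<le> j \<Longrightarrow> j < CARD('d) \<Longrightarrow> l (f i) \<le> l (f j)"
    by (rule increasing_enumeration[of l]) blast
  define \<pi> where "\<pi> = f \<circ> the_inv_into {..<CARD('d)} e"
  have pi: "bij \<pi>" unfolding \<pi>_def by (rule bij_betw_trans[OF bij_betw_the_inv_into[OF e] f])
  have pe: "\<pi> (e i) = f i" if "i < CARD('d)" for i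
    using e that by (simp add: \<pi>_def bij_betw_def the_inv_into_f_f)
  define u' where "u' = (\<chi> j. u $ \<pi> j)"
  have u': "orthonormal u'"
    using u bij_is_inj[OF pi] by (simp add: orthonormal_def u'_def inj_eq)
  show thesis
  proof (rule that[OF u'])
    show "adj (transpose u') ** M ** transpose u' = diag_matrix (l \<circ> \<pi>)"
      by (rule conj_eigenbasis[OF u']) (simp add: u'_def Mu)
    show "(l \<circ> \<pi>) (e i) \<le> (l \<circ> \<pi>) (e j)" if "i \<le> j" "j < CARD('d)" for i j
      using mono[OF that] that by (simp add: pe)
  qed
qed

lemma minor_diag:
  "minor \<sigma> R (B ** diag_matrix l) = minor \<sigma> R B ** diag_matrix (\<lambda>s. if s \<in> R then l (\<sigma> s) else 1)"
  by (simp add: vec_eq_iff diag_matrix_mult_right) (simp add: minor_def diag_matrix_mult_right)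

lemma has_vector_derivative_minor:
  fixes B :: "real \<Rightarrow> 'a::rc_scalar^'d^'r"
  assumes B: "(B has_vector_derivative H ** B t) (at t within T)" and H: "\<And>r s. s \<notin> R \<Longrightarrow> H $ r $ s = 0"
  shows "((\<lambda>t. minor \<sigma> R (B t)) has_vector_derivative H ** minor \<sigma> R (B t)) (at t within T)"
proof -
  define L :: "'a^'r^'d" where "L = (\<chi> j s. if s \<in> R \<and> \<sigma> s = j then 1 else 0)"
  define N :: "'a^'r^'r" where "N = (\<chi> r s. if s \<in> R then 0 else if r = s then 1 else 0)"
  have eq: "minor \<sigma> R X = X ** L + N" for X
  proof -
    have "(\<Sum>k\<in>UNIV. X $ r $ k * (if s \<in> R \<and> \<sigma> s = k then 1 else 0)) = (if s \<in> R then X $ r $ \<sigma> s else 0)" for r s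
      by (cases "s \<in> R") (simp_all add: if_distrib[of "(*) _"] cong: if_cong)
    then show ?thesis by (simp add: vec_eq_iff minor_def L_def N_def matrix_matrix_mult_def)
  qed
  have "H ** N = 0"
    using H by (auto simp: vec_eq_iff N_def matrix_matrix_mult_def intro!: sum.neutral)
  then have "H ** minor \<sigma> R (B t) = (H ** B t) ** L"
    by (simp add: eq matrix_bilin matrix_mul_assoc)
  moreover have "((\<lambda>t. B t ** L) has_vector_derivative (H ** B t) ** L) (at t within T)"
    using bounded_linear.has_vector_derivative[OF bounded_bilinear.bounded_linear_left[OF bounded_bilinear_matrix_mult] B] .
  then have "((\<lambda>t. B t ** L + N) has_vector_derivative (H ** B t) ** L) (at t within T)"
    by (auto intro!: derivative_eq_intros)
  ultimately show ?thesis by (simp add: eq)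
qed

section \<open>The excess potential along a trajectory\<close>

text \<open>A solution of the flow for nonnegative times among all tuples with orthonormal rows; the derivative at
\<open>0\<close> is one-sided.\<close>

definition gradient_trajectory ::
    "('n::finite \<Rightarrow> 'r::finite set) \<Rightarrow> (real \<Rightarrow> 'a::rc_scalar^'d^'r^'n) \<Rightarrow> bool" where
  "gradient_trajectory R A \<longleftrightarrow> (\<forall>t\<ge>0. A t \<in> row_frames R \<and>
     (A has_vector_derivative - grad_FFP (A t)) (at t within {0..}))"

lemma gradient_trajectoryD:
  assumes "gradient_trajectory R A" and "t \<ge> 0"
  shows "A t \<in> row_frames R" and "(A has_vector_derivative - grad_FFP (A t)) (at t within {0..})"
  using assms by (auto simp: gradient_trajectory_def)

lemma FFP_trajectory_derivative:
  assumes A: "gradient_trajectory R A" and t: "t \<ge> 0"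
  shows "((\<lambda>t. FFP (A t)) has_real_derivative - (norm (grad_FFP (A t)))\<^sup>2) (at t within {0..})"
proof -
  let ?v = "- grad_FFP (A t)"
  have "A t $ i ** adj (?v $ i) + ?v $ i ** adj (A t $ i) = 0" for i
    unfolding minus_grad_FFP_nth
    by (simp add: adj_mul adj_flow_generator matrix_bilin matrix_mul_assoc)
  from grad_FFP_inner[OF gradient_trajectoryD(1)[OF A t] this]
  show ?thesis
    using FFP_has_real_derivative[OF gradient_trajectoryD(2)[OF A t]]
    by (simp add: power2_norm_eq_inner)
qed

lemma at_within_ge: "0 < x \<Longrightarrow> at x within {0..} = at (x::real)"
  by (rule at_within_interior) simp

lemma FFP_trajectory_antimono:
  assumes A: "gradient_trajectory R A" and st: "0 \<le> s" "s \<le> t"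
  shows "FFP (A t) \<le> FFP (A s)"
proof (rule DERIV_nonpos_imp_decreasing_open[OF st(2)])
  fix x assume "s < x" "x < t"
  then have x: "0 < x" using st by simp
  show "\<exists>y. ((\<lambda>t. FFP (A t)) has_real_derivative y) (at x) \<and> y \<le> 0"
    using FFP_trajectory_derivative[OF A, of x] x by (auto simp: at_within_ge intro!: exI)
next
  have "continuous_on {0..} (\<lambda>t. FFP (A t))"
    using FFP_trajectory_derivative[OF A] by (intro DERIV_continuous_on) auto
  then show "continuous_on {s..t} (\<lambda>t. FFP (A t))" by (rule continuous_on_subset) (use st in auto)
qed

text \<open>The trace of the frame operator is \<open>n\<close>, so \<open>(n / d) I\<close> is its projection to the scalar matrices.\<close>

lemma excess_eq:
  fixes A :: "'a::rc_scalar^'d^'r^'n"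
  assumes A: "A \<in> row_frames R" and n: "n = (\<Sum>i\<in>UNIV. card (R i))"
  shows "(norm (frame_operator A - (real n / real CARD('d)) *\<^sub>R mat 1))\<^sup>2
    = FFP A - (real n)\<^sup>2 / real CARD('d)"
proof -
  let ?S = "frame_operator A" and ?I = "mat 1 :: 'a^'d^'d"
  have 1: "?S \<bullet> ?I = real n" using trace_frame_operator[OF A] by (simp add: matrix_inner_trace n flip: of_nat_sum)
  have 2: "?I \<bullet> ?I = real CARD('d)" by (simp add: matrix_inner_trace trace_I)
  have "(norm (?S - r *\<^sub>R ?I))\<^sup>2 = ?S \<bullet> ?S - 2 * r * real n + r * r * real CARD('d)" for r
    by (simp add: power2_norm_eq_inner inner_diff_left inner_diff_right 1 2 inner_commute[of ?I ?S] right_diff_distrib)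
  then have "(norm (?S - (real n / real CARD('d)) *\<^sub>R ?I))\<^sup>2
      = ?S \<bullet> ?S - 2 * (real n / real CARD('d)) * real n
        + (real n / real CARD('d)) * (real n / real CARD('d)) * real CARD('d)" .
  also have "\<dots> = FFP A - (real n)\<^sup>2 / real CARD('d)"
    by (simp add: FFP_def power2_norm_eq_inner) (simp add: power2_eq_square)
  finally show ?thesis .
qed

lemma norm_row_frame:
  assumes "A \<in> row_frames R"
  shows "(norm A)\<^sup>2 = real (\<Sum>i\<in>UNIV. card (R i))" and "(norm (A $ i))\<^sup>2 = real (card (R i))"
proof -
  show "(norm A)\<^sup>2 = real (\<Sum>i\<in>UNIV. card (R i))"
    by (simp add: norm_tuple_squared row_framesD[OF assms] trace_coord_proj)
  show "(norm (A $ i))\<^sup>2 = real (card (R i))"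
    by (simp add: power2_norm_eq_inner matrix_inner_trace row_framesD[OF assms] trace_coord_proj)
qed

lemma trace_hermitian:
  assumes "adj H = H" shows "trace H = of_real (re_part (trace (H :: 'a::rc_scalar^'k^'k)))"
proof (rule self_conjugate_of_real)
  have "trace (adj H) = conjugate (trace H)" by (simp add: trace_def sum_conjugate)
  then show "conjugate (trace H) = trace H" by (simp add: assms)
qed

text \<open>At time \<open>\<tau>\<close>, let \<open>C\<close> be a unitary matrix of eigenvectors of \<open>adj K ** K\<close>, with eigenvalues \<open>l j = (\<delta> j)\<^sup>2\<close>; then
\<open>K ** C\<close> is a unitary matrix \<open>X\<close> times the diagonal matrix of \<open>\<delta>\<close>. The minor of \<open>A\<^sub>i K C\<close> with
columns \<open>\<sigma> i\<close> is a bounded minor of \<open>A\<^sub>i X\<close> times a product of values of \<open>\<delta>\<close>, and by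
\<open>minor_growth\<close> it is also \<open>exp (4 T\<^sub>i)\<close> times the corresponding minor of the initial frame.
By \<open>balanced_weight\<close> the product of all \<open>\<delta>\<close> that occur is at most \<open>(det K) powr (n / d)\<close>, that is
\<open>exp (4 n\<^sup>2 \<tau> / d)\<close>. So \<open>(\<Sum>i. T\<^sub>i) - n\<^sup>2 \<tau> / d\<close>, the integral of the excess up to \<open>\<tau>\<close>, is bounded.\<close>

theorem excess_decay:
  fixes A :: "real \<Rightarrow> 'a::rc_scalar^'d^'r^'n"
  assumes A: "gradient_trajectory R A" and k: "\<And>i. card (R i) = k i" and S: "property_S k (A 0)"
    and n: "n = (\<Sum>i\<in>UNIV. card (R i))"
  obtains B where "\<And>\<tau>. \<tau> \<ge> 0 \<Longrightarrow> \<tau> * (FFP (A \<tau>) - (real n)\<^sup>2 / real CARD('d)) \<le> B"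
proof -
  define d where "d = real CARD('d)"
  have d: "d > 0" by (simp add: d_def)
  note rf = gradient_trajectoryD(1)[OF A]
  note A' = gradient_trajectoryD(2)[OF A]
  obtain e :: "nat \<Rightarrow> 'd" where e: "bij_betw e {..<CARD('d)} UNIV"
    by (rule increasing_enumeration[of "\<lambda>_. 0"]) blast
  obtain c where c: "c > 0" and minors: "\<And>u :: 'a^'d^'d. orthonormal u \<Longrightarrow>
    \<exists>\<sigma>. balanced e R \<sigma> \<and> c \<le> (\<Prod>i\<in>UNIV. norm (det (minor (\<sigma> i) (R i) (A 0 $ i ** transpose u))))"
  proof (rule uniform_balanced_minors[OF rf[OF order_refl] k S e])
    fix c assume 1: "c > 0" and 2: "\<And>u :: 'a^'d^'d. orthonormal u \<Longrightarrow>
      \<exists>\<sigma>. balanced e R \<sigma> \<and> c \<le> (\<Prod>i\<in>UNIV. norm (det (minor (\<sigma> i) (R i) (A 0 $ i ** transpose u))))"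
    show ?thesis by (rule that[OF 1 2])
  qed

  \<comment> \<open>The trajectory is continued constantly to negative times, because
    \<open>global_solution\<close> and \<open>primitive\<close> use the whole line.\<close>
  define A1 where "A1 = (\<lambda>t. A (max 0 t))"
  define Sx where "Sx = (\<lambda>t. frame_operator (A1 t))"
  have A1: "A1 t = A t" if "t \<ge> 0" for t using that by (simp add: A1_def)
  have A1_rf: "A1 t \<in> row_frames R" for t by (simp add: A1_def rf)
  have "continuous_on {0..} A"
    using A' by (meson continuous_on_eq_continuous_within has_vector_derivative_continuous atLeast_iff)
  then have A1_cont: "continuous_on UNIV A1"
    unfolding A1_def by (rule continuous_on_compose2) (auto intro!: continuous_intros)
  note mult_cont = bounded_bilinear.continuous_on[OF bounded_bilinear_matrix_mult]
  have nth_cont: "continuous_on UNIV (\<lambda>t. A1 t $ i)" for i by (intro continuous_intros A1_cont)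
  have Sx_cont: "continuous_on UNIV Sx"
    unfolding Sx_def frame_operator_def
    by (intro continuous_on_sum mult_cont bounded_linear.continuous_on[OF bounded_linear_adj] nth_cont)

  define F where "F = (\<lambda>t (K::'a^'d^'d). 4 *\<^sub>R (Sx t ** K))"
  have F_lip: "norm (F t x - F t y) \<le> (4 * real n) * norm (x - y)" for t x y
  proof -
    have "norm (Sx t ** (x - y)) \<le> norm (Sx t) * norm (x - y)" by (rule norm_matrix_mult_le)
    also have "\<dots> \<le> real n * norm (x - y)"
      using norm_frame_operator_le[of "A1 t"] norm_row_frame(1)[OF A1_rf, of t]
      by (intro mult_right_mono) (simp_all add: Sx_def n)
    finally show ?thesis by (simp add: F_def matrix_bilin flip: scaleR_diff_right)
  qed
  have F_cont: "continuous_on UNIV (\<lambda>p. F (fst p) (snd p))"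
    unfolding F_def
    by (intro continuous_on_scaleR mult_cont continuous_on_const continuous_on_compose2[OF Sx_cont])
      (auto intro!: continuous_intros)
  have F0: "norm (F t 0) \<le> 0" for t by (simp add: F_def matrix_bilin)
  obtain K where K0: "K 0 = mat 1" and K: "\<And>t. (K has_vector_derivative F t (K t)) (at t)"
    using global_solution[OF F_cont F_lip F0] by blast
  have K': "(K has_vector_derivative (4 *\<^sub>R frame_operator (A t)) ** K t) (at t within {0..})" if "t \<ge> 0" for t
    using has_vector_derivative_at_within[OF K[of t], of "{0..}"] that by (simp add: F_def Sx_def A1 matrix_bilin)

  define H where "H = (\<lambda>t i. A1 t $ i ** Sx t ** adj (A1 t $ i))"
  have H_adj: "adj (H t i) = H t i" for t i by (simp add: H_def Sx_def adj_mul matrix_mul_assoc)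
  define h where "h = (\<lambda>i t. re_part (trace (H t i)))"
  have h_cont: "continuous_on UNIV (h i)" for i
    unfolding h_def H_def re_part_def trace_def
    by (intro continuous_intros mult_cont Sx_cont nth_cont bounded_linear.continuous_on[OF bounded_linear_adj])
  define T where "T = (\<lambda>i. primitive (h i))"
  have T: "(T i has_real_derivative h i t) (at t)" for i t
    unfolding T_def has_real_derivative_iff_has_vector_derivative
    by (rule has_vector_derivative_primitive[OF h_cont])
  have h_sum: "(\<Sum>i\<in>UNIV. h i t) = FFP (A1 t)" for t
  proof -
    have "h i t = Sx t \<bullet> frame_proj (A1 t) i" for i
      using inner_mat_mult_left[of "adj (A1 t $ i)" "A1 t $ i" "Sx t"]
      by (simp add: h_def H_def frame_proj_def inner_commute[of "Sx t"] matrix_inner_trace[of "A1 t $ i ** Sx t", symmetric]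
         inner_commute[of "A1 t $ i"])
    then show ?thesis
      by (simp add: FFP_def power2_norm_eq_inner Sx_def frame_operator_sum[of "A1 t"] flip: inner_sum_right)
  qed

  have detK: "norm (det (K t)) = exp (4 * real n * t)" if t: "t \<ge> 0" for t
  proof -
    have "((\<lambda>t. det (K t)) has_vector_derivative of_real (4 * real n) * det (K s)) (at s within {0..})" if s: "s \<ge> 0" for s
    proof -
      have "trace (4 *\<^sub>R frame_operator (A s)) = of_real 4 * trace (frame_operator (A s))"
        by (simp add: trace_def scaleR_conv_of_real sum_distrib_left)
      also have "\<dots> = of_real (4 * real n)" by (simp add: trace_frame_operator[OF rf[OF s]] n)
      finally show ?thesis using has_vector_derivative_det[OF K'[OF s]] by simp
    qed
    from scalar_linear_ode[of "\<lambda>t. det (K t)" "\<lambda>_. 4 * real n" "\<lambda>t. 4 * real n * t", OF this _ _ t]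
    show ?thesis by (auto intro!: derivative_eq_intros simp: K0)
  qed

  have minor_growth: "norm (det (minor \<sigma> (R i) (A t $ i ** K t ** C)))
      = exp (4 * T i t) * norm (det (minor \<sigma> (R i) (A 0 $ i ** C)))"
    if t: "t \<ge> 0" for t i \<sigma> and C :: "'a^'d^'d"
  proof -
    let ?q = "\<lambda>t. det (minor \<sigma> (R i) (A t $ i ** K t ** C))"
    have "(?q has_vector_derivative of_real (4 * h i s) * ?q s) (at s within {0..})" if s: "s \<ge> 0" for s
    proof -
      have Hs: "H s i = A s $ i ** frame_operator (A s) ** adj (A s $ i)" using s by (simp add: H_def Sx_def A1)
      have "((\<lambda>t. A t $ i ** K t ** C) has_vector_derivative
          (A s $ i ** ((4 *\<^sub>R frame_operator (A s)) ** K s) + (- grad_FFP (A s)) $ i ** K s) ** C) (at s within {0..})"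
        by (intro bounded_linear.has_vector_derivative[OF bounded_bilinear.bounded_linear_left[OF bounded_bilinear_matrix_mult]]
            matrix_mult_has_vector_derivative nth_has_vector_derivative A' K' s)
      also have "(A s $ i ** ((4 *\<^sub>R frame_operator (A s)) ** K s) + (- grad_FFP (A s)) $ i ** K s) ** C
          = (4 *\<^sub>R H s i) ** (A s $ i ** K s ** C)"
        unfolding vector_uminus_component grad_FFP_nth[OF rf[OF s]] Hs
        by (simp add: matrix_bilin matrix_mul_assoc scaleR_diff_right)
      finally have mv: "((\<lambda>t. minor \<sigma> (R i) (A t $ i ** K t ** C)) has_vector_derivative
          (4 *\<^sub>R H s i) ** minor \<sigma> (R i) (A s $ i ** K s ** C)) (at s within {0..})"
      proof (rule has_vector_derivative_minor)
        fix p q assume "q \<notin> R i"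
        then have "A s $ i $ q = 0" by (rule coord_proj_mult_rows(1)[OF row_framesD[OF rf[OF s]]])
        then show "(4 *\<^sub>R H s i) $ p $ q = 0" by (simp add: Hs matrix_matrix_mult_def)
      qed
      have tr: "trace (4 *\<^sub>R H s i) = of_real (4 * h i s)"
      proof -
        have "trace (4 *\<^sub>R H s i) = of_real 4 * trace (H s i)"
          by (simp add: trace_def scaleR_conv_of_real sum_distrib_left)
        also have "trace (H s i) = of_real (h i s)"
          unfolding h_def by (rule trace_hermitian[OF H_adj])
        finally show ?thesis by simp
      qed
      from has_vector_derivative_det[OF mv] show ?thesis unfolding tr .
    qed
    moreover have "((\<lambda>t. 4 * T i t) has_real_derivative 4 * h i s) (at s within {0..})" for s
      by (rule DERIV_cmult[OF has_field_derivative_at_within[OF T]])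
    ultimately have "?q t = exp (4 * T i t) *\<^sub>R ?q 0"
      using t by (intro scalar_linear_ode[of ?q "\<lambda>s. 4 * h i s"]) (auto simp: T_def)
    then show ?thesis by (simp add: K0)
  qed

  define C1 where "C1 = fact CARD('r) * (real n + 1) ^ CARD('r)"
  define N where "N = CARD('n)"
  have bound: "4 * ((\<Sum>i\<in>UNIV. T i \<tau>) - (real n)\<^sup>2 / d * \<tau>) \<le> ln (C1 ^ N / c)" if \<tau>: "\<tau> \<ge> 0" for \<tau>
  proof -
    define M where "M = adj (K \<tau>) ** K \<tau>"
    have M: "adj M = M" by (simp add: M_def adj_mul)
    obtain u l where u: "orthonormal u" and Ml: "adj (transpose u) ** M ** transpose u = diag_matrix l"
      and mono: "\<And>i j. i \<le> j \<Longrightarrow> j < CARD('d) \<Longrightarrow> l (e i) \<le> l (e j)"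
      by (rule sorted_eigenbasis[OF M e]) blast
    define C where "C = transpose u"
    have C: "adj C ** C = mat 1" unfolding C_def by (rule transpose_orthonormal(1)[OF u])
    define Y where "Y = K \<tau> ** C"
    have YY: "adj Y ** Y = diag_matrix l"
      using Ml by (simp add: Y_def M_def C_def adj_mul matrix_mul_assoc)
    have prod_l: "(\<Prod>j\<in>UNIV. l j) = exp (8 * real n * \<tau>)"
    proof -
      have "of_real (\<Prod>j\<in>UNIV. l j) = det (adj Y ** Y)" unfolding YY by (rule det_diag_matrix[symmetric])
      also have "\<dots> = of_real ((norm (det Y))\<^sup>2)"
        by (simp only: det_mul det_adj mult.commute[of "conjugate _"] mult_conjugate_norm)
      finally have "(\<Prod>j\<in>UNIV. l j) = (norm (det Y))\<^sup>2" by (simp only: of_real_eq_iff)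
      also have "norm (det Y) = exp (4 * real n * \<tau>)"
        by (simp add: Y_def det_mul norm_mult detK[OF \<tau>] norm_det_unitary[OF C])
      finally show ?thesis by (simp add: power2_eq_square flip: exp_add)
    qed
    have l_pos: "l j > 0" for j
    proof -
      have "of_real (l j) = (\<Sum>a\<in>UNIV. conjugate (Y $ a $ j) * Y $ a $ j)"
        using arg_cong[OF YY, of "\<lambda>X. X $ j $ j"] by (simp add: matrix_matrix_mult_def diag_matrix_def)
      also have "\<dots> = of_real (\<Sum>a\<in>UNIV. (norm (Y $ a $ j))\<^sup>2)"
        by (simp only: mult.commute[of "conjugate _"] mult_conjugate_norm of_real_sum)
      finally have "l j = (\<Sum>a\<in>UNIV. (norm (Y $ a $ j))\<^sup>2)" by (simp only: of_real_eq_iff)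
      then have "l j \<ge> 0" by (simp add: sum_nonneg)
      moreover have "l j \<noteq> 0"
      proof
        assume "l j = 0"
        then have "(\<Prod>j\<in>UNIV. l j) = 0" by (intro prod_zero) auto
        then show False by (simp add: prod_l)
      qed
      ultimately show ?thesis by simp
    qed
    define \<delta> where "\<delta> = (\<lambda>j. sqrt (l j))"
    have \<delta>: "\<delta> j > 0" "\<delta> j * \<delta> j = l j" for j using l_pos[of j] by (simp_all add: \<delta>_def)
    have diag_mult: "diag_matrix f ** diag_matrix g = (diag_matrix (\<lambda>j. f j * g j) :: 'a^'d^'d)" for f g
      by (simp add: vec_eq_iff diag_matrix_mult_left) (simp add: diag_matrix_def)
    have diag_one: "diag_matrix (\<lambda>_. 1) = (mat 1 :: 'a^'d^'d)" by (simp add: vec_eq_iff diag_matrix_def mat_def)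
    have adj_diag: "adj (diag_matrix f) = (diag_matrix f :: 'a^'d^'d)" for f
      by (auto simp: vec_eq_iff diag_matrix_def)
    define X where "X = Y ** diag_matrix (\<lambda>j. 1 / \<delta> j)"
    have YX: "Y = X ** diag_matrix \<delta>"
      using \<delta>(1) by (simp add: X_def diag_mult diag_one less_imp_neq[symmetric] flip: matrix_mul_assoc)
    have "adj X ** X = diag_matrix (\<lambda>j. 1 / \<delta> j) ** (adj Y ** Y) ** diag_matrix (\<lambda>j. 1 / \<delta> j)"
      by (simp add: X_def adj_mul adj_diag matrix_mul_assoc)
    also have "\<dots> = diag_matrix (\<lambda>j. 1 / \<delta> j * l j * (1 / \<delta> j))" unfolding YY diag_mult ..
    also have "(\<lambda>j. 1 / \<delta> j * l j * (1 / \<delta> j)) = (\<lambda>_. 1)"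
    proof
      fix j show "1 / \<delta> j * l j * (1 / \<delta> j) = 1"
        using \<delta>(1)[of j] unfolding \<delta>(2)[of j, symmetric] by simp
    qed
    finally have "adj X ** X = mat 1" unfolding diag_one .
    then have XX: "X ** adj X = mat 1" by (simp add: matrix_left_right_inverse)
    have ent: "norm ((A \<tau> $ i ** X) $ r $ j) \<le> real n + 1" for i r j
    proof -
      have "(norm (A \<tau> $ i ** X))\<^sup>2 = (norm (A \<tau> $ i))\<^sup>2"
        by (simp add: power2_norm_eq_inner inner_mat_mult_right XX flip: matrix_mul_assoc)
      also have "\<dots> = real (card (R i))" by (rule norm_row_frame(2)[OF rf[OF \<tau>]])
      also have "\<dots> \<le> real n" unfolding n of_nat_le_iff by (rule member_le_sum) auto
      also have "\<dots> \<le> (real n + 1)\<^sup>2" by (simp add: power2_eq_square algebra_simps)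
      finally have "norm (A \<tau> $ i ** X) \<le> real n + 1" by (rule power2_le_imp_le) simp
      then show ?thesis
        using Finite_Cartesian_Product.norm_nth_le[of "A \<tau> $ i ** X" r]
          Finite_Cartesian_Product.norm_nth_le[of "(A \<tau> $ i ** X) $ r" j] by linarith
    qed
    obtain \<sigma> where bal: "balanced e R \<sigma>"
      and cq: "c \<le> (\<Prod>i\<in>UNIV. norm (det (minor (\<sigma> i) (R i) (A 0 $ i ** C))))"
      using minors[OF u] unfolding C_def by (elim exE conjE)
    have each: "norm (det (minor (\<sigma> i) (R i) (A 0 $ i ** C))) * exp (4 * T i \<tau>) \<le> C1 * (\<Prod>s\<in>R i. \<delta> (\<sigma> i s))" for i
    proof -
      have "norm (det (minor (\<sigma> i) (R i) (A 0 $ i ** C))) * exp (4 * T i \<tau>)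
          = norm (det (minor (\<sigma> i) (R i) ((A \<tau> $ i ** X) ** diag_matrix \<delta>)))"
        using minor_growth[OF \<tau>, of "\<sigma> i" i C] Y_def YX by (simp flip: matrix_mul_assoc)
      also have "\<dots> = norm (det (minor (\<sigma> i) (R i) (A \<tau> $ i ** X))) * (\<Prod>s\<in>UNIV. if s \<in> R i then \<delta> (\<sigma> i s) else 1)"
        unfolding minor_diag det_mul det_diag_matrix norm_mult norm_of_real
        by (simp add: abs_prod \<delta>(1) less_imp_le if_distrib[of abs] cong: if_cong)
      also have "(\<Prod>s\<in>UNIV. if s \<in> R i then \<delta> (\<sigma> i s) else 1) = (\<Prod>s\<in>R i. \<delta> (\<sigma> i s))"
        by (simp flip: prod.inter_restrict)
      also have "norm (det (minor (\<sigma> i) (R i) (A \<tau> $ i ** X))) * (\<Prod>s\<in>R i. \<delta> (\<sigma> i s))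
          \<le> C1 * (\<Prod>s\<in>R i. \<delta> (\<sigma> i s))"
        unfolding C1_def
        by (intro mult_right_mono norm_det_le prod_nonneg) (auto simp: minor_def ent \<delta>(1) less_imp_le)
      finally show ?thesis .
    qed
    have "c * exp (4 * (\<Sum>i\<in>UNIV. T i \<tau>))
        \<le> (\<Prod>i\<in>UNIV. norm (det (minor (\<sigma> i) (R i) (A 0 $ i ** C)))) * exp (4 * (\<Sum>i\<in>UNIV. T i \<tau>))"
      by (intro mult_right_mono cq) simp
    also have "\<dots> = (\<Prod>i\<in>UNIV. norm (det (minor (\<sigma> i) (R i) (A 0 $ i ** C))) * exp (4 * T i \<tau>))"
      by (simp add: prod.distrib exp_sum[symmetric] sum_distrib_left)
    also have "\<dots> \<le> (\<Prod>i\<in>UNIV. C1 * (\<Prod>s\<in>R i. \<delta> (\<sigma> i s)))"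
      by (intro prod_mono) (simp add: each)
    also have "\<dots> = C1 ^ N * (\<Prod>i\<in>UNIV. \<Prod>s\<in>R i. \<delta> (\<sigma> i s))"
      by (simp add: prod.distrib N_def)
    also have "(\<Prod>i\<in>UNIV. \<Prod>s\<in>R i. \<delta> (\<sigma> i s)) = exp (1/2 * (\<Sum>i\<in>UNIV. \<Sum>s\<in>R i. ln (l (\<sigma> i s))))"
    proof -
      have "\<delta> j = exp (1/2 * ln (l j))" for j
        using l_pos[of j] by (simp add: \<delta>_def ln_sqrt[symmetric])
      then show ?thesis by (simp add: exp_sum[symmetric] sum_distrib_left)
    qed
    also have "(\<Sum>i\<in>UNIV. \<Sum>s\<in>R i. ln (l (\<sigma> i s))) \<le> real n / d * (\<Sum>j\<in>UNIV. ln (l j))"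
      unfolding n d_def
    proof (rule balanced_weight[OF e _ bal])
      show "ln (l (e i)) \<le> ln (l (e j))" if "i \<le> j" "j < CARD('d)" for i j
        using mono[OF that] l_pos by simp
    qed
    also have "(\<Sum>j\<in>UNIV. ln (l j)) = 8 * real n * \<tau>"
    proof -
      have "(\<Sum>j\<in>UNIV. ln (l j)) = ln (\<Prod>j\<in>UNIV. l j)"
        by (rule ln_prod[symmetric]) (simp_all add: l_pos less_imp_neq[symmetric])
      then show ?thesis by (simp add: prod_l)
    qed
    finally have le: "c * exp (4 * (\<Sum>i\<in>UNIV. T i \<tau>)) \<le> C1 ^ N * exp (1/2 * (real n / d * (8 * real n * \<tau>)))"
      by (simp add: C1_def)
    have C1: "C1 > 0" by (simp add: C1_def)
    have "ln (c * exp (4 * (\<Sum>i\<in>UNIV. T i \<tau>))) \<le> ln (C1 ^ N * exp (1/2 * (real n / d * (8 * real n * \<tau>))))"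
      using le c C1 by (subst ln_le_cancel_iff) auto
    then show ?thesis
      using c C1 by (simp add: ln_mult ln_div power2_eq_square algebra_simps)
  qed

  show thesis
  proof (rule that)
    fix \<tau> :: real assume \<tau>: "\<tau> \<ge> 0"
    define z where "z = FFP (A \<tau>) - (real n)\<^sup>2 / d"
    define w where "w = (\<lambda>t. (\<Sum>i\<in>UNIV. T i t) - (real n)\<^sup>2 / d * t - z * t)"
    have "w 0 \<le> w \<tau>"
    proof (rule DERIV_nonneg_imp_nondecreasing[OF \<tau>])
      fix x assume x: "0 \<le> x" "x \<le> \<tau>"
      have "(w has_real_derivative (\<Sum>i\<in>UNIV. h i x) - (real n)\<^sup>2 / d * 1 - z * 1) (at x)"
        unfolding w_def by (intro DERIV_diff DERIV_sum T DERIV_cmult DERIV_ident)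
      moreover have "0 \<le> (\<Sum>i\<in>UNIV. h i x) - (real n)\<^sup>2 / d * 1 - z * 1"
        using FFP_trajectory_antimono[OF A x] x by (simp add: h_sum A1 z_def)
      ultimately show "\<exists>y. (w has_real_derivative y) (at x) \<and> 0 \<le> y" by blast
    qed
    then have "z * \<tau> \<le> (\<Sum>i\<in>UNIV. T i \<tau>) - (real n)\<^sup>2 / d * \<tau>" by (simp add: w_def T_def)
    with bound[OF \<tau>] show "\<tau> * (FFP (A \<tau>) - (real n)\<^sup>2 / real CARD('d)) \<le> ln (C1 ^ N / c) / 4"
      by (simp add: z_def d_def mult.commute)
  qed
qed

section \<open>Convergence to a global minimum\<close>

lemma continuous_on_frame_operator: "continuous_on S (frame_operator :: 'a::rc_scalar^'d^'r^'n \<Rightarrow> _)"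
  unfolding frame_operator_def
  by (intro continuous_on_sum bounded_bilinear.continuous_on[OF bounded_bilinear_matrix_mult]
      bounded_linear.continuous_on[OF bounded_linear_adj] continuous_intros)

lemma grad_FFP_tight: "frame_operator A = c *\<^sub>R mat 1 \<Longrightarrow> grad_FFP A = 0"
  by (simp add: grad_FFP_def matrix_bilin) (simp add: vec_eq_iff)

text \<open>Cauchy's criterion, checked on the integers and transferred to the reals by the tail bound.\<close>

lemma convergent_of_tail_bound:
  fixes A :: "real \<Rightarrow> 'b::euclidean_space"
  assumes bd: "\<And>s t. T0 \<le> s \<Longrightarrow> s \<le> t \<Longrightarrow> norm (A t - A s) \<le> w s" and w: "(w \<longlongrightarrow> 0) at_top"
  obtains L where "(A \<longlongrightarrow> L) at_top"
proof -
  have "Cauchy (\<lambda>m. A (real m))"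
  proof (rule metric_CauchyI)
    fix e :: real assume e: "e > 0"
    have "eventually (\<lambda>t. w t < e / 2) at_top" using w e by (auto dest: order_tendstoD(2)[where a = "e / 2"])
    then obtain t1 where t1: "\<And>t. t \<ge> t1 \<Longrightarrow> w t < e / 2" by (auto simp: eventually_at_top_linorder)
    define s where "s = max T0 t1"
    obtain M :: nat where M: "real M \<ge> s" using real_arch_simple by blast
    show "\<exists>M. \<forall>m\<ge>M. \<forall>n\<ge>M. dist (A (real m)) (A (real n)) < e"
    proof (intro exI allI impI)
      fix m n assume mn: "M \<le> m" "M \<le> n"
      have "norm (A (real m) - A s) \<le> w s" "norm (A (real n) - A s) \<le> w s"
        using mn M by (auto intro!: bd simp: s_def)
      moreover have "w s < e / 2" by (rule t1) (simp add: s_def)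
      ultimately show "dist (A (real m)) (A (real n)) < e"
        using dist_triangle2[of "A (real m)" "A (real n)" "A s"] by (simp add: dist_norm)
    qed
  qed
  then obtain L where L: "(\<lambda>m. A (real m)) \<longlonglongrightarrow> L" using Cauchy_convergent convergent_def by blast
  have tail: "norm (A s - L) \<le> w s" if s: "T0 \<le> s" for s
  proof (rule tendsto_upperbound)
    show "(\<lambda>m. norm (A s - A (real m))) \<longlonglongrightarrow> norm (A s - L)" by (intro tendsto_intros L)
    obtain M :: nat where M: "real M \<ge> s" using real_arch_simple by blast
    show "\<forall>\<^sub>F m in sequentially. norm (A s - A (real m)) \<le> w s"
    proof (rule eventually_sequentiallyI[of M])
      fix m assume "M \<le> m"
      then have "s \<le> real m" using M by linarith
      from bd[OF s this] show "norm (A s - A (real m)) \<le> w s" by (simp only: norm_minus_commute)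
    qed
  qed simp
  have "((\<lambda>t. A t - L) \<longlongrightarrow> 0) at_top"
    by (rule Lim_null_comparison[OF _ w]) (use tail in \<open>auto simp: eventually_at_top_linorder\<close>)
  then show thesis by (intro that[of L]) (simp add: LIM_zero_iff)
qed

text \<open>By \<open>lojasiewicz_FFP\<close> the speed of the trajectory is at most the rate of decrease of a multiple of the
fourth root of the excess \<open>z\<close>, which therefore bounds the remaining length. This root is
differentiable only while \<open>z\<close> is positive; once \<open>z\<close> vanishes, the trajectory is constant.\<close>

theorem trajectory_converges_to_tight:
  fixes A :: "real \<Rightarrow> 'a::rc_scalar^'d^'r^'n"
  assumes A: "gradient_trajectory R A" and k: "\<And>i. card (R i) = k i" and S: "property_S k (A 0)"
    and n: "n = (\<Sum>i\<in>UNIV. card (R i))"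
  obtains L where "(A \<longlongrightarrow> L) at_top" "L \<in> row_frames R"
    "frame_operator L = (real n / real CARD('d)) *\<^sub>R mat 1"
proof -
  define c where "c = real n / real CARD('d)"
  note rf = gradient_trajectoryD(1)[OF A]
  note A' = gradient_trajectoryD(2)[OF A]
  define z where "z = (\<lambda>t. FFP (A t) - (real n)\<^sup>2 / real CARD('d))"
  have z: "z t = (norm (frame_operator (A t) - c *\<^sub>R mat 1))\<^sup>2" if "t \<ge> 0" for t
    unfolding z_def c_def by (rule excess_eq[OF rf[OF that] n, symmetric])
  have z_nonneg: "z t \<ge> 0" if "t \<ge> 0" for t using z[OF that] by simp
  have z_anti: "z t \<le> z s" if "0 \<le> s" "s \<le> t" for s t
    using FFP_trajectory_antimono[OF A that] by (simp add: z_def)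
  obtain B where B: "\<And>\<tau>. \<tau> \<ge> 0 \<Longrightarrow> \<tau> * z \<tau> \<le> B"
    unfolding z_def by (rule excess_decay[OF A k S n]) blast
  have z_lim: "(z \<longlongrightarrow> 0) at_top"
  proof (rule Lim_null_comparison)
    show "((\<lambda>t. B / t) \<longlongrightarrow> 0) at_top"
      by (intro tendsto_divide_0[OF tendsto_const] filterlim_at_top_imp_at_infinity filterlim_ident)
    have "norm (z t) \<le> B / t" if "t \<ge> 1" for t
      using B[of t] z_nonneg[of t] that by (simp add: pos_le_divide_eq mult.commute)
    then show "\<forall>\<^sub>F t in at_top. norm (z t) \<le> B / t" by (auto simp: eventually_at_top_linorder)
  qed
  have "\<exists>L. (A \<longlongrightarrow> L) at_top"
  proof -
    obtain \<kappa> \<epsilon> where \<kappa>: "\<kappa> > 0" and \<epsilon>: "\<epsilon> > 0"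
      and loj: "\<And>A :: 'a^'d^'r^'n. \<lbrakk>A \<in> row_frames R; norm (frame_operator A - c *\<^sub>R mat 1) \<le> \<epsilon>\<rbrakk>
        \<Longrightarrow> (norm (grad_FFP A))\<^sup>2 \<ge> \<kappa> * norm (frame_operator A - c *\<^sub>R mat 1) ^ 3"
    proof (rule lojasiewicz_FFP[OF n])
      fix \<kappa> \<epsilon> :: real assume 1: "\<kappa> > 0" "\<epsilon> > 0"
        and 2: "\<And>A :: 'a^'d^'r^'n. \<lbrakk>A \<in> row_frames R; norm (frame_operator A - (real n / real CARD('d)) *\<^sub>R mat 1) \<le> \<epsilon>\<rbrakk>
        \<Longrightarrow> (norm (grad_FFP A))\<^sup>2 \<ge> \<kappa> * norm (frame_operator A - (real n / real CARD('d)) *\<^sub>R mat 1) ^ 3"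
      show ?thesis by (rule that[OF 1 2[folded c_def]])
    qed
    have "\<forall>\<^sub>F t in at_top. z t < \<epsilon>\<^sup>2" using order_tendstoD(2)[OF z_lim, of "\<epsilon>\<^sup>2"] \<epsilon> by simp
    then obtain t0 where t0: "\<And>t. t \<ge> t0 \<Longrightarrow> z t < \<epsilon>\<^sup>2" by (auto simp: eventually_at_top_linorder)
    define T0 where "T0 = max 1 t0"
    have T0: "T0 \<ge> 1" "T0 \<ge> t0" by (auto simp: T0_def)
    show ?thesis
    proof (cases "\<exists>t1\<ge>T0. z t1 = 0")
      case True
      then obtain t1 where t1: "t1 \<ge> T0" "z t1 = 0" by blast
      have "(A has_vector_derivative 0) (at t within {t1..})" if t: "t \<in> {t1..}" for t
      proof -
        have tt: "0 \<le> t1" "t1 \<le> t" "0 \<le> t" using t t1 T0 by auto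
        have "z t = 0" using z_anti[OF tt(1,2)] z_nonneg[OF tt(3)] t1 by simp
        then have "frame_operator (A t) = c *\<^sub>R mat 1" using z[OF tt(3)] by simp
        then have "grad_FFP (A t) = 0" by (rule grad_FFP_tight)
        then have "(A has_vector_derivative 0) (at t within {0..})" using A'[OF tt(3)] by simp
        then show ?thesis by (rule has_vector_derivative_within_subset) (use tt in auto)
      qed
      then obtain L where "\<And>t. t \<in> {t1..} \<Longrightarrow> A t = L"
        using has_vector_derivative_zero_constant[of "{t1..}" A] by auto
      then have "\<forall>\<^sub>F t in at_top. A t = L" by (auto simp: eventually_at_top_linorder)
      then show ?thesis using tendsto_eventually by blast
    next
      case False
      then have z_pos: "z t > 0" if "t \<ge> T0" for t using z_nonneg[of t] that T0 by force
      \<comment> \<open>With \<open>g\<close> the norm of the gradient and \<open>q\<close> the fourth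
        root of \<open>z\<close>, the derivative of \<open>- C * q\<close> is \<open>C * g\<^sup>2 / (4 *
        q ^ 3)\<close>, which is at least \<open>g\<close> because \<open>sqrt \<kappa> * q ^ 3 \<le>
        g\<close>.\<close>
      define C where "C = 4 / sqrt \<kappa>"
      have C: "C > 0" using \<kappa> by (simp add: C_def)
      define q where "q = (\<lambda>t. sqrt (sqrt (z t)))"
      have q_nonneg: "q t \<ge> 0" if "t \<ge> 0" for t using z_nonneg[OF that] by (simp add: q_def)
      have tail: "norm (A t - A s) \<le> C * q s" if st: "T0 \<le> s" "s \<le> t" for s t
      proof (cases "s = t")
        case True then show ?thesis using C q_nonneg[of s] st T0 by simp
      next
        case False
        then have "s < t" using st by simp
        define \<phi>' where "\<phi>' = (\<lambda>x. C * ((norm (grad_FFP (A x)))\<^sup>2 / (4 * q x ^ 3)))"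
        have zder: "(z has_real_derivative - (norm (grad_FFP (A x)))\<^sup>2) (at x)" if "x > 0" for x
          unfolding z_def
          using DERIV_diff[OF FFP_trajectory_derivative[OF A, of x] DERIV_const] that
          by (simp add: at_within_ge)
        have \<phi>der: "((\<lambda>x. - C * q x) has_vector_derivative \<phi>' x) (at x)" if x: "x \<ge> s" for x
        proof -
          have x0: "x > 0" "z x > 0" using x st T0 z_pos by auto
          have qq: "q x > 0" "q x * q x = sqrt (z x)" using x0 by (simp_all add: q_def)
          have "(q has_real_derivative - (norm (grad_FFP (A x)))\<^sup>2 * (inverse (sqrt (z x)) / 2) * (inverse (sqrt (sqrt (z x))) / 2)) (at x)"
            unfolding q_def using x0 by (auto intro!: derivative_eq_intros zder simp: mult_ac)
          moreover have "- (norm (grad_FFP (A x)))\<^sup>2 * (inverse (sqrt (z x)) / 2) * (inverse (sqrt (sqrt (z x))) / 2)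
              = - ((norm (grad_FFP (A x)))\<^sup>2 / (4 * q x ^ 3))"
            unfolding q_def[symmetric, THEN fun_cong] qq(2)[symmetric] using qq(1)
            by (simp add: field_simps power3_eq_cube q_def)
          ultimately have "(q has_real_derivative - ((norm (grad_FFP (A x)))\<^sup>2 / (4 * q x ^ 3))) (at x)"
            by (simp only:)
          from DERIV_cmult[OF this, of "- C"]
          show ?thesis by (simp add: \<phi>'_def has_real_derivative_iff_has_vector_derivative)
        qed
        have "norm (A t - A s) \<le> - C * q t - - C * q s"
        proof (rule differentiable_bound_general[OF \<open>s < t\<close>])
          show "(A has_vector_derivative - grad_FFP (A x)) (at x)" if "s < x" "x < t" for x
            using A'[of x] that st T0 by (simp add: at_within_ge)
          show "((\<lambda>x. - C * q x) has_vector_derivative \<phi>' x) (at x)" if "s < x" "x < t" for x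
            using \<phi>der that by simp
          show "continuous_on {s..t} A"
          proof (rule continuous_on_subset)
            show "continuous_on {0..} A"
              using A' by (meson continuous_on_eq_continuous_within has_vector_derivative_continuous atLeast_iff)
          qed (use st T0 in auto)
          show "continuous_on {s..t} (\<lambda>x. - C * q x)"
            using \<phi>der by (auto intro!: continuous_at_imp_continuous_on has_vector_derivative_continuous)
          fix x assume x: "s < x" "x < t"
          have x0: "x \<ge> 0" "x \<ge> T0" "x \<ge> t0" using x st T0 by auto
          define g where "g = norm (grad_FFP (A x))"
          have q_pos: "q x > 0" using z_pos[OF x0(2)] by (simp add: q_def)
          have "q x * q x = sqrt (z x)" using z_nonneg[OF x0(1)] by (simp add: q_def)
          also have "\<dots> = norm (frame_operator (A x) - c *\<^sub>R mat 1)"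
            by (simp only: z[OF x0(1)] real_sqrt_abs abs_norm_cancel)
          finally have qq: "norm (frame_operator (A x) - c *\<^sub>R mat 1) = q x * q x" ..
          have "norm (frame_operator (A x) - c *\<^sub>R mat 1) \<le> \<epsilon>"
          proof (rule power2_le_imp_le)
            show "(norm (frame_operator (A x) - c *\<^sub>R mat 1))\<^sup>2 \<le> \<epsilon>\<^sup>2"
              using t0[OF x0(3)] unfolding z[OF x0(1)] by (rule less_imp_le)
          qed (use \<epsilon> in simp)
          from loj[OF rf[OF x0(1)] this] have "\<kappa> * (q x * q x) ^ 3 \<le> g\<^sup>2" unfolding qq g_def .
          also have "\<kappa> * (q x * q x) ^ 3 = (sqrt \<kappa> * q x ^ 3)\<^sup>2"
            using \<kappa> by (simp add: power_mult_distrib power2_eq_square power3_eq_cube mult_ac)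
          finally have "sqrt \<kappa> * q x ^ 3 \<le> g" by (rule power2_le_imp_le) (simp add: g_def)
          then have "g * (sqrt \<kappa> * q x ^ 3) \<le> g * g" by (intro mult_left_mono) (simp_all add: g_def)
          then have "g \<le> (g * g) / (sqrt \<kappa> * q x ^ 3)" using \<kappa> q_pos by (simp add: pos_le_divide_eq)
          also have "\<dots> = \<phi>' x" by (simp add: \<phi>'_def C_def g_def power2_eq_square)
          finally show "norm (- grad_FFP (A x)) \<le> \<phi>' x" by (simp add: g_def)
        qed
        also have "\<dots> \<le> C * q s" using C q_nonneg[of t] st T0 by simp
        finally show ?thesis .
      qed
      have "((\<lambda>t. C * q t) \<longlongrightarrow> C * sqrt (sqrt 0)) at_top"
        unfolding q_def by (intro tendsto_intros z_lim)
      then have "((\<lambda>t. C * q t) \<longlongrightarrow> 0) at_top" by simp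
      from convergent_of_tail_bound[OF tail this] show ?thesis by blast
    qed
  qed
  then obtain L where L: "(A \<longlongrightarrow> L) at_top" ..
  show thesis
  proof (rule that[OF L])
    show "L \<in> row_frames R"
    proof -
      have "L $ i ** adj (L $ i) = coord_proj (R i)" for i
      proof (rule tendsto_unique[OF trivial_limit_at_top_linorder])
        show "((\<lambda>t. A t $ i ** adj (A t $ i)) \<longlongrightarrow> L $ i ** adj (L $ i)) at_top"
          by (intro bounded_bilinear.tendsto[OF bounded_bilinear_matrix_mult]
              bounded_linear.tendsto[OF bounded_linear_adj] tendsto_vec_nth L)
        show "((\<lambda>t. A t $ i ** adj (A t $ i)) \<longlongrightarrow> coord_proj (R i)) at_top"
          by (rule tendsto_eventually) (auto simp: eventually_at_top_linorder row_framesD[OF rf] intro!: exI[of _ 0])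
      qed
      then show ?thesis by (simp add: row_frames_def)
    qed
    have "(norm (frame_operator L - c *\<^sub>R mat 1))\<^sup>2 = 0"
    proof (rule tendsto_unique[OF trivial_limit_at_top_linorder _ z_lim])
      have "((\<lambda>t. frame_operator (A t)) \<longlongrightarrow> frame_operator L) at_top"
        by (rule continuous_on_tendsto_compose[OF continuous_on_frame_operator[of UNIV] L]) auto
      then have "((\<lambda>t. (norm (frame_operator (A t) - c *\<^sub>R mat 1))\<^sup>2) \<longlongrightarrow> (norm (frame_operator L - c *\<^sub>R mat 1))\<^sup>2) at_top"
        by (intro tendsto_intros)
      then show "(z \<longlongrightarrow> (norm (frame_operator L - c *\<^sub>R mat 1))\<^sup>2) at_top"
        by (rule Lim_transform_eventually) (auto simp: eventually_at_top_linorder z intro!: exI[of _ 0])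
    qed
    then show "frame_operator L = (real n / real CARD('d)) *\<^sub>R mat 1" by (simp add: c_def)
  qed
qed

lemma negative_gradient_flow_exists:
  assumes k: "\<And>i. card (R i) = k i"
  shows "\<exists>\<Gamma> :: 'a::rc_scalar^'d^'r^'n \<Rightarrow> real \<Rightarrow> 'a^'d^'r^'n. negative_gradient_flow (fusion_frames k R) FFP \<Gamma>"
proof -
  let ?M = "fusion_frames k R :: ('a^'d^'r^'n) set"
  have "\<exists>f. f 0 = p \<and> (\<forall>t\<ge>0. f t \<in> ?M \<and>
      (f has_vector_derivative - riemannian_gradient ?M FFP (f t)) (at t within {0..}))" if p: "p \<in> ?M" for p
  proof (rule global_gradient_flow[OF k p])
    fix f assume f: "f 0 = p" "\<And>t. (f has_vector_derivative - grad_FFP (f t)) (at t)" "\<And>t. f t \<in> ?M"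
    show ?thesis
      using f by (intro exI[of _ f] conjI allI impI)
        (simp_all add: riemannian_gradient_FFP[OF k f(3)] has_vector_derivative_at_within)
  qed
  then have "\<exists>\<Gamma>. \<forall>p\<in>?M. \<Gamma> p 0 = p \<and> (\<forall>t\<ge>0. \<Gamma> p t \<in> ?M \<and>
      (\<Gamma> p has_vector_derivative - riemannian_gradient ?M FFP (\<Gamma> p t)) (at t within {0..}))"
    by (intro bchoice ballI)
  then show ?thesis unfolding negative_gradient_flow_def .
qed

lemma negative_gradient_flow_limit:
  fixes \<Gamma> :: "'a::rc_scalar^'d^'r^'n \<Rightarrow> real \<Rightarrow> 'a^'d^'r^'n"
  assumes pos: "\<And>i. k i > 0" and k: "\<And>i. card (R i) = k i"
    and flow: "negative_gradient_flow (fusion_frames k R) FFP \<Gamma>"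
    and A0: "A0 \<in> fusion_frames k R" and S: "property_S k A0"
  shows "\<exists>A_inf\<in>fusion_frames k R. (\<Gamma> A0 \<longlongrightarrow> A_inf) at_top \<and> global_minimum_on (fusion_frames k R) FFP A_inf"
proof -
  let ?M = "fusion_frames k R :: ('a^'d^'r^'n) set"
  define n where "n = (\<Sum>i\<in>UNIV. card (R i))"
  have \<Gamma>: "\<Gamma> A0 0 = A0" "\<And>t. t \<ge> 0 \<Longrightarrow> \<Gamma> A0 t \<in> ?M"
    "\<And>t. t \<ge> 0 \<Longrightarrow> (\<Gamma> A0 has_vector_derivative - riemannian_gradient ?M FFP (\<Gamma> A0 t)) (at t within {0..})"
    using flow A0 unfolding negative_gradient_flow_def by blast+
  have traj: "gradient_trajectory R (\<Gamma> A0)"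
    unfolding gradient_trajectory_def
  proof (intro allI impI conjI)
    fix t :: real assume t: "t \<ge> 0"
    show "\<Gamma> A0 t \<in> row_frames R" by (rule fusion_frames_row_frames[OF k \<Gamma>(2)[OF t]])
    show "(\<Gamma> A0 has_vector_derivative - grad_FFP (\<Gamma> A0 t)) (at t within {0..})"
      using \<Gamma>(3)[OF t] unfolding riemannian_gradient_FFP[OF k \<Gamma>(2)[OF t]] .
  qed
  have S0: "property_S k (\<Gamma> A0 0)" unfolding \<Gamma>(1) by (rule S)
  obtain L where L: "(\<Gamma> A0 \<longlongrightarrow> L) at_top" "L \<in> row_frames R"
    "frame_operator L = (real n / real CARD('d)) *\<^sub>R mat 1"
    by (rule trajectory_converges_to_tight[OF traj k S0 n_def])
  have n: "n > 0"
  proof -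
    fix i :: 'n
    have "card (R i) \<le> n" unfolding n_def by (rule member_le_sum) auto
    then show ?thesis using pos[of i] k[of i] by simp
  qed
  have LM: "L \<in> ?M"
  proof (rule iffD2[OF fusion_frames_iff[OF k]], intro conjI allI impI L(2))
    fix x :: "'a^'d" assume "x \<noteq> 0"
    then show "x \<bullet> (frame_operator L *v x) > 0"
      using n by (simp add: L(3) bounded_bilinear.scaleR_left[OF bounded_bilinear_matrix_vector])
  qed
  have "FFP L \<le> FFP q" if "q \<in> ?M" for q
    using excess_eq[OF L(2) n_def] excess_eq[OF fusion_frames_row_frames[OF k that] n_def]
      zero_le_power2[of "norm (frame_operator q - (real n / real CARD('d)) *\<^sub>R mat 1)"]
    by (simp add: L(3))
  with LM have "global_minimum_on ?M FFP L" by (simp add: global_minimum_on_def)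
  with LM L(1) show ?thesis by blast
qed

theorem theorem1p14:
  fixes k :: "'n::finite \<Rightarrow> nat" and R :: "'n \<Rightarrow> 'r::finite set"
  assumes "\<And>i. k i > 0" and "\<And>i. card (R i) = k i"
  shows
    "((\<exists>\<Gamma> :: real^'d^'r^'n \<Rightarrow> real \<Rightarrow> real^'d^'r^'n.
         negative_gradient_flow (fusion_frames k R) FFP \<Gamma>) \<and>
      (\<forall>\<Gamma> :: real^'d^'r^'n \<Rightarrow> real \<Rightarrow> real^'d^'r^'n.
         negative_gradient_flow (fusion_frames k R) FFP \<Gamma> \<longrightarrow>
         (\<forall>A\<^sub>0\<in>fusion_frames k R. property_S k A\<^sub>0 \<longrightarrow>
            (\<exists>A_inf\<in>fusion_frames k R. (\<Gamma> A\<^sub>0 \<longlongrightarrow> A_inf) at_top \<and>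
               global_minimum_on (fusion_frames k R) FFP A_inf)))) \<and>
     ((\<exists>\<Gamma> :: complex^'d^'r^'n \<Rightarrow> real \<Rightarrow> complex^'d^'r^'n.
         negative_gradient_flow (fusion_frames k R) FFP \<Gamma>) \<and>
      (\<forall>\<Gamma> :: complex^'d^'r^'n \<Rightarrow> real \<Rightarrow> complex^'d^'r^'n.
         negative_gradient_flow (fusion_frames k R) FFP \<Gamma> \<longrightarrow>
         (\<forall>A\<^sub>0\<in>fusion_frames k R. property_S k A\<^sub>0 \<longrightarrow>
            (\<exists>A_inf\<in>fusion_frames k R. (\<Gamma> A\<^sub>0 \<longlongrightarrow> A_inf) at_top \<and>
               global_minimum_on (fusion_frames k R) FFP A_inf))))"
  by (intro conjI allI ballI impI negative_gradient_flow_exists[OF assms(2)]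
      negative_gradient_flow_limit[OF assms])

end
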